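(* For any $N\ge 2$ and $x\in\mathbb R$, the integrable spin-one XXZ Hamiltonian $H$ on $N$ sites with the anti-diagonal twist possesses the simple eigenvalue $E=0$ in the subsector where $(-1)^M\equiv(-1)^N$ and $F\equiv(-1)^N$.
   Context: $V=(\mathbb C^3)^{\otimes N}$, with single-site basis $|{\Uparrow}\rangle=(1,0,0)^t$, $|0\rangle=(0,1,0)^t$, $|{\Downarrow}\rangle=(0,0,1)^t$. Spin-one matrices: $s^1=\frac1{\sqrt2}\begin{pmatrix}0&1&0\\1&0&1\\0&1&0\end{pmatrix}$, $s^2=\frac1{\sqrt2}\begin{pmatrix}0&-\mathrm i&0\\ \mathrm i&0&-\mathrm i\\0&\mathrm i&0\end{pmatrix}$, $s^3=\mathrm{diag}(1,0,-1)$; $s^a_j$ is $s^a$ acting on site $j$. The Hamiltonian, acting on $V$, is $$H=\sum_{j=1}^N\Big(\sum_{a=1}^3J_a\big(s_j^as_{j+1}^a+2(s_j^a)^2\big)-\sum_{a,b=1}^3A_{ab}\,s_j^as_j^bs_{j+1}^as_{j+1}^b\Big),$$ with $J_1=J_2=1$, $J_3=\frac12(x^2-2)$, $A_{ab}=A_{ba}$, $A_{aa}=J_a$, $A_{12}=1$, $A_{13}=A_{23}=x-1$. Anti-diagonal twist: $s^1_{N+1}=s^1_1$, $s^2_{N+1}=-s^2_1$, $s^3_{N+1}=-s^3_1$. The magnetisation is $M=\sum_{j=1}^Ns_j^3$ and the spin-reversal operator is $F=\begin{pmatrix}0&0&1\\0&1&0\\1&0&0\end{pmatrix}^{\otimes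 N}$; with this twist $H$ commutes with $(-1)^M$ and with $F$. The subsector where $(-1)^M\equiv(-1)^N$ and $F\equiv(-1)^N$ is the subspace of vectors $|\phi\rangle\in V$ with $(-1)^M|\phi\rangle=(-1)^N|\phi\rangle$ and $F|\phi\rangle=(-1)^N|\phi\rangle$.
   Formalization: E=0 is shown to be an eigenvalue in the subsector for all N≥2 and real x, but simple only if x≠0 or N is odd; for x=0 and N even simplicity fails (for N=2 both ⇑⇑+⇓⇓ and ⇑⇓+⇓⇑ are annihilated by H). *)

theory Defs
  imports "HOL-Analysis.Analysis" "HOL-Library.Function_Algebras"
begin

text \<open>
  A vector of the N-fold tensor power of \<open>\<complex>\<^sup>3\<close> is given by its components in the tensor basis. The basis
  is indexed by the words of length N over the three-element type \<open>3\<close>, where the letters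
  1, 2, 3 stand for \<open>|\<Up>\<rangle>, |0\<rangle>, |\<Down>\<rangle>\<close>. Sites are numbered from 0 as list positions, so that the
  physical sites \<open>1, \<dots>, N\<close> are the positions \<open>0, \<dots>, N - 1\<close>, and position N is the site \<open>N + 1\<close>
  that the twist identifies with the first one. Addition of vectors is pointwise.
\<close>

type_synonym state = "3 list \<Rightarrow> complex"

definition state_space :: "nat \<Rightarrow> state set" where
  "state_space N = {\<phi>. \<forall>\<sigma>. length \<sigma> \<noteq> N \<longrightarrow> \<phi> \<sigma> = 0}"

definition vscale :: "complex \<Rightarrow> state \<Rightarrow> state"  (infixr "\<bullet>\<^sub>v" 75) where
  "c \<bullet>\<^sub>v \<phi> = (\<lambda>\<sigma>. c * \<phi> \<sigma>)"

lemma vector_space_vscale: "vector_space vscale"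
  by unfold_locales (auto simp: vscale_def fun_eq_iff algebra_simps)

definition spin_matrix :: "3 \<Rightarrow> complex^3^3" where
  "spin_matrix a =
     (if a = 1 then (1 / sqrt 2) *\<^sub>R vector [vector [0, 1, 0], vector [1, 0, 1], vector [0, 1, 0]]
      else if a = 2 then (1 / sqrt 2) *\<^sub>R vector [vector [0, - \<i>, 0], vector [\<i>, 0, - \<i>], vector [0, \<i>, 0]]
      else vector [vector [1, 0, 0], vector [0, 0, 0], vector [0, 0, -1]])"

text \<open>The matrix \<open>A\<close> acting on the tensor factor at position \<open>j\<close>.\<close>

definition site_op :: "nat \<Rightarrow> complex^3^3 \<Rightarrow> state \<Rightarrow> state" where
  "site_op j A \<phi> = (\<lambda>\<sigma>. if j < length \<sigma> then \<Sum>t\<in>UNIV. A $ (\<sigma> ! j) $ t * \<phi> (\<sigma>[j := t]) else 0)"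

definition tensor_power_op :: "nat \<Rightarrow> complex^3^3 \<Rightarrow> state \<Rightarrow> state" where
  "tensor_power_op N A \<phi> =
     (\<lambda>\<sigma>. if length \<sigma> = N then \<Sum>\<tau> | length \<tau> = N. (\<Prod>j<N. A $ (\<sigma> ! j) $ (\<tau> ! j)) * \<phi> \<tau> else 0)"

definition twist_sign :: "3 \<Rightarrow> complex" where
  "twist_sign a = (if a = 1 then 1 else -1)"

definition spin_op :: "nat \<Rightarrow> 3 \<Rightarrow> nat \<Rightarrow> state \<Rightarrow> state" where
  "spin_op N a j \<phi> =
     (if j = N then twist_sign a \<bullet>\<^sub>v site_op 0 (spin_matrix a) \<phi> else site_op j (spin_matrix a) \<phi>)"

definition coupling_J :: "real \<Rightarrow> 3 \<Rightarrow> real" where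
  "coupling_J x a = (if a = 3 then (x^2 - 2) / 2 else 1)"

definition coupling_A :: "real \<Rightarrow> 3 \<Rightarrow> 3 \<Rightarrow> real" where
  "coupling_A x a b = (if a = b then coupling_J x a else if {a, b} = {1, 2} then 1 else x - 1)"

definition hamiltonian :: "nat \<Rightarrow> real \<Rightarrow> state \<Rightarrow> state" where
  "hamiltonian N x \<phi> =
     (\<Sum>j<N.
        (\<Sum>a\<in>UNIV. complex_of_real (coupling_J x a) \<bullet>\<^sub>v
           (spin_op N a j (spin_op N a (Suc j) \<phi>) + 2 \<bullet>\<^sub>v spin_op N a j (spin_op N a j \<phi>)))
      - (\<Sum>a\<in>UNIV. \<Sum>b\<in>UNIV. complex_of_real (coupling_A x a b) \<bullet>\<^sub>v
           spin_op N a j (spin_op N b j (spin_op N a (Suc j) (spin_op N b (Suc j) \<phi>)))))"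

definition magnetisation :: "nat \<Rightarrow> state \<Rightarrow> state" where
  "magnetisation N \<phi> = (\<Sum>j<N. spin_op N 3 j \<phi>)"

text \<open>
  The magnetisation is diagonal in the tensor basis, with the integer eigenvalue \<open>weight \<sigma>\<close> on the
  basis vector \<open>\<sigma>\<close> (lemma \<open>magnetisation_diagonal\<close>). The operator \<open>(-1)\<close> to the power M is obtained
  from it by functional calculus; lemma \<open>magnetisation_parity_eigenvector\<close> is its defining property.
\<close>

definition weight :: "3 list \<Rightarrow> int" where
  "weight \<sigma> = (\<Sum>j<length \<sigma>. if \<sigma> ! j = 1 then 1 else if \<sigma> ! j = 2 then 0 else -1)"

definition magnetisation_parity :: "state \<Rightarrow> state" where
  "magnetisation_parity \<phi> = (\<lambda>\<sigma>. (-1) powi weight \<sigma> * \<phi> \<sigma>)"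

lemma sum_fun_apply: "(\<Sum>i\<in>I. f i) \<sigma> = (\<Sum>i\<in>I. (f i :: state) \<sigma>)"
  by (induction I rule: infinite_finite_induct) auto

lemma magnetisation_diagonal:
  assumes "\<phi> \<in> state_space N"
  shows "magnetisation N \<phi> = (\<lambda>\<sigma>. of_int (weight \<sigma>) * \<phi> \<sigma>)"
proof
  fix \<sigma> :: "3 list"
  have ne: "(1::3) \<noteq> 2" "(1::3) \<noteq> 3" "(2::3) \<noteq> 3" by auto
  have site: "spin_op N 3 j \<phi> \<sigma> =
      of_int (if \<sigma> ! j = 1 then 1 else if \<sigma> ! j = 2 then 0 else -1) * \<phi> \<sigma>"
    if "j < length \<sigma>" "length \<sigma> = N" for j
  proof -
    have "\<sigma> ! j = 1 \<or> \<sigma> ! j = 2 \<or> \<sigma> ! j = 3" by (rule exhaust_3)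
    then show ?thesis
      using that ne list_update_id[of \<sigma> j]
      by (elim disjE) (simp_all add: spin_op_def site_op_def spin_matrix_def sum_3 vector_3)
  qed
  show "magnetisation N \<phi> \<sigma> = of_int (weight \<sigma>) * \<phi> \<sigma>"
  proof (cases "length \<sigma> = N")
    case True
    then show ?thesis
      by (simp add: magnetisation_def weight_def sum_fun_apply site sum_distrib_right del: of_int_sum)
         (simp add: sum_distrib_right site)
  next
    case False
    then have z: "\<phi> \<sigma> = 0" "\<And>j t. \<phi> (\<sigma>[j := t]) = 0"
      using assms by (auto simp: state_space_def)
    then show ?thesis
      by (auto simp: magnetisation_def sum_fun_apply spin_op_def site_op_def intro!: sum.neutral)
  qed
qed

lemma magnetisation_parity_eigenvector:
  assumes "\<phi> \<in> state_space N" and "magnetisation N \<phi> = of_int m \<bullet>\<^sub>v \<phi>"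
  shows "magnetisation_parity \<phi> = ((-1) powi m) \<bullet>\<^sub>v \<phi>"
proof
  fix \<sigma>
  have "of_int (weight \<sigma>) * \<phi> \<sigma> = of_int m * \<phi> \<sigma>"
    using assms(2) unfolding magnetisation_diagonal[OF assms(1)] by (metis vscale_def)
  then have "\<phi> \<sigma> = 0 \<or> weight \<sigma> = m" by simp
  then show "magnetisation_parity \<phi> \<sigma> = (((-1) powi m) \<bullet>\<^sub>v \<phi>) \<sigma>"
    by (auto simp: magnetisation_parity_def vscale_def)
qed

definition spin_reversal :: "nat \<Rightarrow> state \<Rightarrow> state" where
  "spin_reversal N = tensor_power_op N (vector [vector [0, 0, 1], vector [0, 1, 0], vector [1, 0, 0]])"

definition subsector :: "nat \<Rightarrow> state set" where
  "subsector N = {\<phi> \<in> state_space N.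
     magnetisation_parity \<phi> = (-1) ^ N \<bullet>\<^sub>v \<phi> \<and> spin_reversal N \<phi> = (-1) ^ N \<bullet>\<^sub>v \<phi>}"

definition eigenvalue_on :: "(state \<Rightarrow> state) \<Rightarrow> state set \<Rightarrow> complex \<Rightarrow> bool" where
  "eigenvalue_on T W e \<longleftrightarrow> (\<exists>\<phi>\<in>W. \<phi> \<noteq> 0 \<and> T \<phi> = e \<bullet>\<^sub>v \<phi>)"

definition generalised_eigenspace :: "(state \<Rightarrow> state) \<Rightarrow> state set \<Rightarrow> complex \<Rightarrow> state set" where
  "generalised_eigenspace T W e = {\<phi> \<in> W. \<exists>k. ((\<lambda>\<psi>. T \<psi> - e \<bullet>\<^sub>v \<psi>) ^^ k) \<phi> = 0}"

text \<open>
  An eigenvalue of the restriction of \<open>T\<close> to the subspace \<open>W\<close> is simple if its algebraic multiplicity is one.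
  For \<open>x = 0\<close> and N even the eigenvalue 0 of the Hamiltonian on the subsector has multiplicity at least two:
  for N = 2 both \<open>|\<Up>\<Up>\<rangle> + |\<Down>\<Down>\<rangle>\<close> and \<open>|\<Up>\<Down>\<rangle> + |\<Down>\<Up>\<rangle>\<close> are annihilated.
\<close>

definition simple_eigenvalue_on :: "(state \<Rightarrow> state) \<Rightarrow> state set \<Rightarrow> complex \<Rightarrow> bool" where
  "simple_eigenvalue_on T W e \<longleftrightarrow>
     eigenvalue_on T W e \<and> vector_space.dim vscale (generalised_eigenspace T W e) = 1"

end

theory Submission
  imports Defs "HOL-Library.Multiset"
begin

text \<open>
  The Hamiltonian has a dynamical lattice supersymmetry. The coproduct
  \<open>|\<Up>\<rangle> \<mapsto> x/2 (|\<Up>0\<rangle> - |0\<Up>\<rangle>)\<close>, \<open>|0\<rangle> \<mapsto> |\<Up>\<Down>\<rangle> - |\<Down>\<Up>\<rangle>\<close>, \<open>|\<Down>\<rangle> \<mapsto> x/2 (|0\<Down>\<rangle> - |\<Down>0\<rangle>)\<close> is, for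
  \<open>x \<noteq> 0\<close> and in a suitable basis, dual to half the commutator on traceless 2 by 2 matrices.
  Inserting it at every site with alternating signs gives a supercharge \<open>Q\<close> from the
  twisted-translation-invariant states on N sites to those on N + 1 sites. It satisfies
  \<open>Q Q = 0\<close>, and \<open>\<langle>\<phi>|H|\<phi>\<rangle>\<close> is a positive combination of \<open>\<parallel>Q \<phi>\<parallel>\<^sup>2\<close> and \<open>\<parallel>Q\<^sup>\<dagger> \<phi>\<parallel>\<^sup>2\<close> on
  these states. An explicit element of the kernel of \<open>Q\<close> has non-zero overlap with an explicit element
  of the kernel of \<open>Q\<^sup>\<dagger>\<close>, so the cohomology is non-trivial and H has a zero-energy state.

  Where the number of zeros is even, a diagonal sign change makes all off-diagonal elements of H
  non-positive. By the Cauchy-Schwarz inequality, replacing a state by the root mean square of its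
  rotations can then only lower the energy, so \<open>H \<ge> 0\<close> there without assuming translation invariance.
  Hence the absolute value (in the gauge) of a zero-energy state is again one, and its zeros spread
  to all configurations connected by H: a zero-energy state that vanishes at \<open>|\<Up>\<dots>\<Up>\<rangle>\<close> is zero.
  For \<open>x = 0\<close> and N odd, H is not irreducible, and one needs in addition that adjacent zeros cost energy
  and that the spin reversal exchanges the two components without zeros.
\<close>

section \<open>Words, twisted rotations and orbit sums\<close>

definition flip :: "3 \<Rightarrow> 3" where
  "flip a = (if a = 1 then 3 else if a = 2 then 2 else 1)"

lemma three_distinct [simp]: "(1::3) \<noteq> 2" "(2::3) \<noteq> 1" "(1::3) \<noteq> 3" "(3::3) \<noteq> 1" "(2::3) \<noteq> 3" "(3::3) \<noteq> 2"
  by auto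

lemma flip_simps [simp]: "flip 1 = 3" "flip 2 = 2" "flip 3 = 1"
  by (simp_all add: flip_def)

lemma flip_flip [simp]: "flip (flip a) = a"
  using exhaust_3[of a] by auto

lemma flip_comp_flip [simp]: "flip \<circ> flip = id"
  by (simp add: fun_eq_iff)

lemma flip_eq_iff [simp]: "flip a = flip b \<longleftrightarrow> a = b"
  by (metis flip_flip)

lemma flip_eq_2_iff [simp]: "flip a = 2 \<longleftrightarrow> a = 2"
  using exhaust_3[of a] by auto

lemma bij_flip: "bij flip"
  by (metis bij_betw_byWitness UNIV_I flip_flip subset_UNIV)

lemma sum_flip: "(\<Sum>a\<in>UNIV. F (flip a)) = (\<Sum>a\<in>UNIV. F a)"
  by (rule sum.reindex_bij_betw[OF bij_flip])

section \<open>Words of fixed length and sums over them\<close>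

definition words :: "nat \<Rightarrow> 3 list set" where
  "words N = {\<sigma>. length \<sigma> = N}"

lemma finite_words [simp]: "finite (words N)"
  using finite_lists_length_eq[of "UNIV :: 3 set" N] by (simp add: words_def)

lemma words_0 [simp]: "words 0 = {[]}"
  by (auto simp: words_def)

lemma sum_words_Suc:
  "(\<Sum>\<sigma>\<in>words (Suc n). F \<sigma>) = (\<Sum>a\<in>UNIV. \<Sum>w\<in>words n. F (a # w))"
proof -
  have "(\<Sum>\<sigma>\<in>words (Suc n). F \<sigma>) = (\<Sum>(a, w)\<in>UNIV \<times> words n. F (a # w))"
    by (rule sum.reindex_bij_witness[of _ "\<lambda>(a, w). a # w" "\<lambda>\<sigma>. (hd \<sigma>, tl \<sigma>)"])
       (auto simp: words_def length_Suc_conv)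
  then show ?thesis
    by (simp add: sum.cartesian_product)
qed

lemma sum_words_add:
  "(\<Sum>\<sigma>\<in>words (p + q). F \<sigma>) = (\<Sum>u\<in>words p. \<Sum>w\<in>words q. F (u @ w))"
  by (induction p arbitrary: F) (simp_all add: sum_words_Suc)

lemma sum_words_Suc2:
  "(\<Sum>\<sigma>\<in>words (Suc (Suc n)). F \<sigma>) = (\<Sum>a\<in>UNIV. \<Sum>b\<in>UNIV. \<Sum>w\<in>words n. F (a # b # w))"
  by (simp add: sum_words_Suc)

text \<open>The twist conjugates the wrapped site by the spin reversal
  (\<open>twist_sign_spin_matrix\<close>), so the translation under which the twisted chain is
  invariant flips the letter that it carries round the end. On words of length N its N-th power is
  therefore \<open>map flip\<close>, not the identity.\<close>

fun turn :: "3 list \<Rightarrow> 3 list" where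
  "turn [] = []"
| "turn (a # w) = w @ [flip a]"

definition unturn :: "3 list \<Rightarrow> 3 list" where
  "unturn \<sigma> = (if \<sigma> = [] then [] else flip (last \<sigma>) # butlast \<sigma>)"

lemma turn_unturn [simp]: "turn (unturn \<sigma>) = \<sigma>"
  by (auto simp: unturn_def)

lemma unturn_turn [simp]: "unturn (turn \<sigma>) = \<sigma>"
  by (cases \<sigma>) (auto simp: unturn_def)

lemma length_turn [simp]: "length (turn \<sigma>) = length \<sigma>"
  by (cases \<sigma>) auto

lemma length_unturn [simp]: "length (unturn \<sigma>) = length \<sigma>"
  by (metis length_turn turn_unturn)

lemma length_turn_pow [simp]: "length ((turn ^^ k) \<sigma>) = length \<sigma>"
  by (induction k) auto

lemma length_unturn_pow [simp]: "length ((unturn ^^ k) \<sigma>) = length \<sigma>"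
  by (induction k) auto

lemma unturn_turn_pow [simp]: "(unturn ^^ k) ((turn ^^ k) \<sigma>) = \<sigma>"
proof (induction k arbitrary: \<sigma>)
  case (Suc k)
  then show ?case
    by (subst funpow_Suc_right[of k unturn]) simp
qed simp

lemma turn_unturn_pow [simp]: "(turn ^^ k) ((unturn ^^ k) \<sigma>) = \<sigma>"
proof (induction k arbitrary: \<sigma>)
  case (Suc k)
  then show ?case
    by (subst funpow_Suc_right[of k turn]) simp
qed simp

lemma turn_in_words [simp]: "turn \<sigma> \<in> words N \<longleftrightarrow> \<sigma> \<in> words N"
  by (simp add: words_def)

lemma turn_pow_in_words [simp]: "(turn ^^ k) \<sigma> \<in> words N \<longleftrightarrow> \<sigma> \<in> words N"
  by (simp add: words_def)

lemma unturn_pow_in_words [simp]: "(unturn ^^ k) \<sigma> \<in> words N \<longleftrightarrow> \<sigma> \<in> words N"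
  by (simp add: words_def)

lemma map_flip_in_words [simp]: "map flip \<sigma> \<in> words N \<longleftrightarrow> \<sigma> \<in> words N"
  by (simp add: words_def)

lemma sum_turn_pow: "(\<Sum>\<sigma>\<in>words N. F ((turn ^^ k) \<sigma>)) = (\<Sum>\<sigma>\<in>words N. F \<sigma>)"
  by (rule sum.reindex_bij_witness[of _ "unturn ^^ k" "turn ^^ k"]) auto

lemma sum_turn: "(\<Sum>\<sigma>\<in>words N. F (turn \<sigma>)) = (\<Sum>\<sigma>\<in>words N. F \<sigma>)"
  using sum_turn_pow[of F 1] by simp

lemma sum_map_flip: "(\<Sum>\<sigma>\<in>words N. F (map flip \<sigma>)) = (\<Sum>\<sigma>\<in>words N. F \<sigma>)"
  by (rule sum.reindex_bij_witness[of _ "map flip" "map flip"]) simp_all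

lemma turn_pow_append: "(turn ^^ length u) (u @ w) = w @ map flip u"
proof (induction u arbitrary: w)
  case (Cons a u)
  then show ?case
    by (simp add: funpow_swap1)
qed simp

lemma turn_pow_length: "(turn ^^ length u) u = map flip u"
  using turn_pow_append[of u "[]"] by simp

lemma unturn_pow_append: "(unturn ^^ length u) (w @ map flip u) = u @ w"
  by (metis turn_pow_append unturn_turn_pow)

lemma turn_map_flip: "turn (map flip \<sigma>) = map flip (turn \<sigma>)"
  by (cases \<sigma>) auto

lemma turn_pow_map_flip: "(turn ^^ k) (map flip \<sigma>) = map flip ((turn ^^ k) \<sigma>)"
  by (induction k) (auto simp: turn_map_flip)

text \<open>The sign is that of the translation sector in which the supercharge is defined; iterating N times
gives the spin-reversal eigenvalue \<open>(-1)\<close> to the power N.\<close>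

definition twist_inv :: "nat \<Rightarrow> (3 list \<Rightarrow> real) \<Rightarrow> bool" where
  "twist_inv N f \<longleftrightarrow> (\<forall>\<sigma>\<in>words N. f (turn \<sigma>) = (-1) ^ N * f \<sigma>)"

lemma twist_inv_pow:
  assumes "twist_inv N f" "\<sigma> \<in> words N"
  shows "f ((turn ^^ k) \<sigma>) = (-1) ^ (N * k) * f \<sigma>"
proof (induction k)
  case (Suc k)
  have "f (turn ((turn ^^ k) \<sigma>)) = (-1) ^ N * f ((turn ^^ k) \<sigma>)"
    using assms unfolding twist_inv_def by simp
  with Suc show ?case
    by (simp add: power_add)
qed simp

lemma twist_inv_append:
  assumes "twist_inv N f" "length u + length w = N"
  shows "f (w @ map flip u) = (-1) ^ (N * length u) * f (u @ w)"
  using twist_inv_pow[OF assms(1), of "u @ w" "length u"] assms(2)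
  by (simp add: turn_pow_append words_def)

definition flip_sym :: "nat \<Rightarrow> (3 list \<Rightarrow> real) \<Rightarrow> bool" where
  "flip_sym N f \<longleftrightarrow> (\<forall>\<sigma>\<in>words N. f (map flip \<sigma>) = (-1) ^ N * f \<sigma>)"

text \<open>N rotations amount to one spin reversal, and N * N has the parity of N.\<close>

lemma twist_inv_flip_sym:
  assumes "twist_inv N f"
  shows "flip_sym N f"
  unfolding flip_sym_def
proof
  fix \<sigma> assume s: "\<sigma> \<in> words N"
  have "f (map flip \<sigma>) = (-1) ^ (N * length \<sigma>) * f \<sigma>"
    using twist_inv_append[OF assms, of \<sigma> "[]"] s by (simp add: words_def)
  then show "f (map flip \<sigma>) = (-1) ^ N * f \<sigma>"
    using s by (simp add: words_def minus_one_power_iff)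
qed

text \<open>Up to the factor n this projects onto the twisted-translation sector. The rotation has
  period 2 n, but for \<open>flip_sym\<close> functions the signed summands already repeat after n
  steps.\<close>

definition orbit_sum :: "nat \<Rightarrow> (3 list \<Rightarrow> real) \<Rightarrow> 3 list \<Rightarrow> real" where
  "orbit_sum n f \<sigma> = (\<Sum>k<n. (-1) ^ (n * k) * f ((turn ^^ k) \<sigma>))"

lemma orbit_sum_cong:
  assumes "\<And>\<sigma>. \<sigma> \<in> words n \<Longrightarrow> f \<sigma> = g \<sigma>" "\<sigma> \<in> words n"
  shows "orbit_sum n f \<sigma> = orbit_sum n g \<sigma>"
  using assms by (simp add: orbit_sum_def)

lemma orbit_sum_add: "orbit_sum n (\<lambda>\<sigma>. f \<sigma> + g \<sigma>) \<sigma> = orbit_sum n f \<sigma> + orbit_sum n g \<sigma>"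
  by (simp add: orbit_sum_def sum.distrib algebra_simps)

lemma orbit_sum_cmult: "orbit_sum n (\<lambda>\<sigma>. c * f \<sigma>) \<sigma> = c * orbit_sum n f \<sigma>"
  by (simp add: orbit_sum_def sum_distrib_left algebra_simps)

lemma orbit_sum_diff: "orbit_sum n (\<lambda>\<sigma>. f \<sigma> - g \<sigma>) \<sigma> = orbit_sum n f \<sigma> - orbit_sum n g \<sigma>"
  by (simp add: orbit_sum_def sum_subtractf algebra_simps)

lemma orbit_sum_sum: "orbit_sum n (\<lambda>\<sigma>. \<Sum>i\<in>I. f i \<sigma>) \<sigma> = (\<Sum>i\<in>I. orbit_sum n (f i) \<sigma>)"
  unfolding orbit_sum_def by (simp add: sum_distrib_left) (rule sum.swap)

lemma orbit_sum_shift: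
  assumes "flip_sym n f" "\<sigma> \<in> words n"
  shows "orbit_sum n (\<lambda>\<sigma>. (-1) ^ n * f (turn \<sigma>)) \<sigma> = orbit_sum n f \<sigma>"
proof -
  define g where "g k = (-1) ^ (n * k) * f ((turn ^^ k) \<sigma>)" for k
  \<comment> \<open>The n-th rotation is the spin reversal, whose sign (-1)^n cancels (-1)^(n * n);
    this closes the cycle.\<close>
  have "g n = g 0"
    using assms turn_pow_length[of \<sigma>] by (auto simp: g_def flip_sym_def words_def minus_one_power_iff)
  have "orbit_sum n (\<lambda>\<sigma>. (-1) ^ n * f (turn \<sigma>)) \<sigma> = (\<Sum>k<n. g (Suc k))"
    by (simp add: orbit_sum_def g_def power_add algebra_simps)
  also have "\<dots> = (\<Sum>k<n. g k) + g n - g 0"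
    using sum.lessThan_Suc_shift[of g n] by simp
  finally show ?thesis
    using \<open>g n = g 0\<close> by (simp add: orbit_sum_def g_def)
qed

lemma flip_sym_turn_pow:
  assumes "flip_sym n f"
  shows "flip_sym n (\<lambda>\<sigma>. c * f ((turn ^^ k) \<sigma>))"
  using assms by (simp add: flip_sym_def turn_pow_map_flip)

lemma orbit_sum_shift_pow:
  assumes "flip_sym n f" "\<sigma> \<in> words n"
  shows "orbit_sum n (\<lambda>\<sigma>. (-1) ^ (n * k) * f ((turn ^^ k) \<sigma>)) \<sigma> = orbit_sum n f \<sigma>"
proof (induction k)
  case (Suc k)
  have "orbit_sum n (\<lambda>\<sigma>. (-1) ^ (n * Suc k) * f ((turn ^^ Suc k) \<sigma>)) \<sigma>
      = orbit_sum n (\<lambda>\<sigma>. (-1) ^ n * ((-1) ^ (n * k) * f ((turn ^^ k) (turn \<sigma>)))) \<sigma>"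
    by (simp add: power_add algebra_simps funpow_swap1)
  also have "\<dots> = orbit_sum n (\<lambda>\<sigma>. (-1) ^ (n * k) * f ((turn ^^ k) \<sigma>)) \<sigma>"
    by (rule orbit_sum_shift[OF flip_sym_turn_pow[OF assms(1)] assms(2)])
  finally show ?case
    using Suc by simp
qed simp

lemma twist_inv_orbit_sum:
  assumes "flip_sym n f"
  shows "twist_inv n (orbit_sum n f)"
  unfolding twist_inv_def
proof
  fix \<sigma> assume s: "\<sigma> \<in> words n"
  have "orbit_sum n f \<sigma> = (-1) ^ n * orbit_sum n (\<lambda>\<sigma>. f (turn \<sigma>)) \<sigma>"
    using orbit_sum_shift[OF assms s] by (simp add: orbit_sum_cmult)
  also have "orbit_sum n (\<lambda>\<sigma>. f (turn \<sigma>)) \<sigma> = orbit_sum n f (turn \<sigma>)"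
    by (simp add: orbit_sum_def funpow_swap1)
  finally show "orbit_sum n f (turn \<sigma>) = (-1) ^ n * orbit_sum n f \<sigma>"
    by (simp add: minus_one_power_iff)
qed

section \<open>The inner product of real states and its behaviour on orbit sums\<close>

definition ip :: "nat \<Rightarrow> (3 list \<Rightarrow> real) \<Rightarrow> (3 list \<Rightarrow> real) \<Rightarrow> real" where
  "ip N f g = (\<Sum>\<sigma>\<in>words N. f \<sigma> * g \<sigma>)"

lemma ip_commute: "ip N f g = ip N g f"
  by (simp add: ip_def mult.commute)

text \<open>Rotations preserve the inner product and act on \<open>g\<close> by exactly the sign in
  \<open>orbit_sum\<close>, so the n summands agree.\<close>

lemma ip_orbit_sum:
  assumes "twist_inv n g"
  shows "ip n (orbit_sum n f) g = n * ip n f g"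
proof -
  have *: "(\<Sum>\<sigma>\<in>words n. (-1) ^ (n * k) * f ((turn ^^ k) \<sigma>) * g \<sigma>) = ip n f g" for k
  proof -
    have "(\<Sum>\<sigma>\<in>words n. (-1) ^ (n * k) * f ((turn ^^ k) \<sigma>) * g \<sigma>)
        = (\<Sum>\<sigma>\<in>words n. f ((turn ^^ k) \<sigma>) * g ((turn ^^ k) \<sigma>))"
      by (intro sum.cong refl) (simp add: twist_inv_pow[OF assms])
    then show ?thesis
      using sum_turn_pow[of "\<lambda>\<sigma>. f \<sigma> * g \<sigma>"] by (simp add: ip_def)
  qed
  have "ip n (orbit_sum n f) g = (\<Sum>k<n. \<Sum>\<sigma>\<in>words n. (-1) ^ (n * k) * f ((turn ^^ k) \<sigma>) * g \<sigma>)"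
    unfolding ip_def orbit_sum_def by (simp add: sum_distrib_right) (rule sum.swap)
  then show ?thesis
    by (simp add: *)
qed

text \<open>The norm becomes a sum of correlations of \<open>f\<close> with its own rotations; for a
  coproduct, k is the displacement between two insertions.\<close>

lemma ip_orbit_sum_self:
  assumes "flip_sym n f"
  shows "ip n (orbit_sum n f) (orbit_sum n f)
    = n * (\<Sum>k<n. (-1) ^ (n * k) * (\<Sum>\<sigma>\<in>words n. f \<sigma> * f ((turn ^^ k) \<sigma>)))"
proof -
  have "ip n f (orbit_sum n f) = (\<Sum>\<sigma>\<in>words n. \<Sum>k<n. (-1) ^ (n * k) * (f \<sigma> * f ((turn ^^ k) \<sigma>)))"
    by (simp add: ip_def orbit_sum_def sum_distrib_left algebra_simps)
  also have "\<dots> = (\<Sum>k<n. (-1) ^ (n * k) * (\<Sum>\<sigma>\<in>words n. f \<sigma> * f ((turn ^^ k) \<sigma>)))"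
    by (subst sum.swap) (simp add: sum_distrib_left)
  finally show ?thesis
    by (simp add: ip_orbit_sum[OF twist_inv_orbit_sum[OF assms]])
qed

section \<open>The supercharge and the quadratic form of the Hamiltonian\<close>

text \<open>\<open>mult x a b e\<close> is the coefficient of the pair a b in the coproduct of e.
  Read backwards, as the e-component of a product of a and b, it is an antisymmetric multiplication
  of letters.\<close>

definition mult :: "real \<Rightarrow> 3 \<Rightarrow> 3 \<Rightarrow> 3 \<Rightarrow> real" where
  "mult x a b e =
     (if a \<noteq> 2 \<and> b = 2 \<and> e = a then (if a = 1 then x / 2 else - x / 2)
      else if a = 2 \<and> b \<noteq> 2 \<and> e = b then (if b = 1 then - x / 2 else x / 2)
      else if e = 2 \<and> a = 1 \<and> b = 3 then 1
      else if e = 2 \<and> a = 3 \<and> b = 1 then - 1 else 0)"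

text \<open>This sign moves the supercharge from spin-reversal eigenvalue (-1)^N on N sites to
  (-1)^(N + 1) on N + 1 sites.\<close>

lemma mult_flip: "mult x (flip a) (flip b) (flip e) = - mult x a b e"
  using exhaust_3[of a] exhaust_3[of b] exhaust_3[of e] by (elim disjE) (simp_all add: mult_def)

lemma sum_letters: "(\<Sum>a\<in>UNIV. F a) = F 1 + F 2 + F (3::3)"
  by (simp add: sum_3)

lemma sum_mult_flip: "(\<Sum>e\<in>UNIV. mult x (flip a) (flip b) e * F e) = - (\<Sum>e\<in>UNIV. mult x a b e * F (flip e))"
proof -
  have "(\<Sum>e\<in>UNIV. mult x (flip a) (flip b) e * F e)
      = (\<Sum>e\<in>UNIV. mult x (flip a) (flip b) (flip e) * F (flip e))"
    by (rule sum_flip[symmetric])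
  then show ?thesis
    by (simp add: mult_flip sum_negf)
qed

lemma sum_flip_pair: "(\<Sum>a\<in>UNIV. \<Sum>b\<in>UNIV. F (flip a) (flip b)) = (\<Sum>a\<in>UNIV. \<Sum>b\<in>UNIV. F a b)"
proof -
  have "(\<Sum>a\<in>UNIV. \<Sum>b\<in>UNIV. F (flip a) (flip b)) = (\<Sum>a\<in>UNIV. \<Sum>b\<in>UNIV. F (flip a) b)"
    by (intro sum.cong refl sum_flip)
  also have "\<dots> = (\<Sum>a\<in>UNIV. \<Sum>b\<in>UNIV. F a b)"
    by (rule sum_flip)
  finally show ?thesis .
qed

text \<open>The coproduct inserted at the first site only. The supercharge is
  \<open>orbit_sum (Suc N) (coprod x f)\<close>: the rotations supply the other sites together with
  the signs.\<close>

fun coprod :: "real \<Rightarrow> (3 list \<Rightarrow> real) \<Rightarrow> 3 list \<Rightarrow> real" where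
  "coprod x f (a # b # w) = (\<Sum>e\<in>UNIV. mult x a b e * f (e # w))"
| "coprod x f _ = 0"

fun coprod_adj :: "real \<Rightarrow> (3 list \<Rightarrow> real) \<Rightarrow> 3 list \<Rightarrow> real" where
  "coprod_adj x f (e # w) = (\<Sum>a\<in>UNIV. \<Sum>b\<in>UNIV. mult x a b e * f (a # b # w))"
| "coprod_adj x f _ = 0"

lemma flip_sym_coprod:
  assumes "flip_sym N f" "N \<ge> 1"
  shows "flip_sym (Suc N) (coprod x f)"
  unfolding flip_sym_def
proof
  fix \<sigma> assume "\<sigma> \<in> words (Suc N)"
  then obtain a b w where s: "\<sigma> = a # b # w" "Suc (length w) = N"
    using assms(2) by (cases \<sigma>; cases "tl \<sigma>") (auto simp: words_def)
  have f: "f (flip e # map flip w) = (-1) ^ N * f (e # w)" for e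
    using s bspec[OF assms(1)[unfolded flip_sym_def], of "e # w"]
    by (simp add: words_def)
  show "coprod x f (map flip \<sigma>) = (-1) ^ Suc N * coprod x f \<sigma>"
    by (simp add: s sum_mult_flip f sum_distrib_left sum_negf mult.left_commute)
qed

lemma flip_sym_coprod_adj:
  assumes "flip_sym (Suc N) f" "N \<ge> 1"
  shows "flip_sym N (coprod_adj x f)"
  unfolding flip_sym_def
proof
  fix \<sigma> assume "\<sigma> \<in> words N"
  then obtain e w where s: "\<sigma> = e # w" "Suc (length w) = N"
    using assms(2) by (cases \<sigma>) (auto simp: words_def)
  have f: "f (flip a # flip b # map flip w) = (-1) ^ Suc N * f (a # b # w)" for a b
    using s bspec[OF assms(1)[unfolded flip_sym_def], of "a # b # w"]
    by (simp add: words_def)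
  have "coprod_adj x f (map flip \<sigma>)
      = (\<Sum>a\<in>UNIV. \<Sum>b\<in>UNIV. mult x (flip a) (flip b) (flip e) * f (flip a # flip b # map flip w))"
    by (simp add: s sum_flip_pair[of "\<lambda>a b. mult x a b (flip e) * f (a # b # map flip w)"])
  then show "coprod_adj x f (map flip \<sigma>) = (-1) ^ N * coprod_adj x f \<sigma>"
    by (simp add: s mult_flip f sum_distrib_left mult.left_commute)
qed

lemma ip_coprod:
  assumes "N \<ge> 1"
  shows "ip (Suc N) (coprod x f) g = ip N f (coprod_adj x g)"
proof -
  obtain M where N: "N = Suc M"
    using assms by (cases N) auto
  have "ip (Suc N) (coprod x f) g
      = (\<Sum>a\<in>UNIV. \<Sum>b\<in>UNIV. \<Sum>w\<in>words M. \<Sum>e\<in>UNIV. mult x a b e * f (e # w) * g (a # b # w))"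
    by (simp add: ip_def N sum_words_Suc2 sum_distrib_right)
  also have "\<dots> = (\<Sum>a\<in>UNIV. \<Sum>b\<in>UNIV. \<Sum>e\<in>UNIV. \<Sum>w\<in>words M. mult x a b e * f (e # w) * g (a # b # w))"
    by (intro sum.cong refl sum.swap)
  also have "\<dots> = (\<Sum>a\<in>UNIV. \<Sum>e\<in>UNIV. \<Sum>b\<in>UNIV. \<Sum>w\<in>words M. mult x a b e * f (e # w) * g (a # b # w))"
    by (intro sum.cong refl sum.swap)
  also have "\<dots> = (\<Sum>e\<in>UNIV. \<Sum>a\<in>UNIV. \<Sum>b\<in>UNIV. \<Sum>w\<in>words M. mult x a b e * f (e # w) * g (a # b # w))"
    by (rule sum.swap)
  also have "\<dots> = (\<Sum>e\<in>UNIV. \<Sum>a\<in>UNIV. \<Sum>w\<in>words M. \<Sum>b\<in>UNIV. mult x a b e * f (e # w) * g (a # b # w))"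
    by (intro sum.cong refl sum.swap)
  also have "\<dots> = (\<Sum>e\<in>UNIV. \<Sum>w\<in>words M. \<Sum>a\<in>UNIV. \<Sum>b\<in>UNIV. mult x a b e * f (e # w) * g (a # b # w))"
    by (intro sum.cong refl sum.swap)
  also have "\<dots> = ip N f (coprod_adj x g)"
    by (simp add: ip_def N sum_words_Suc sum_distrib_left algebra_simps)
  finally show ?thesis .
qed

section \<open>Insertions that do not overlap\<close>

lemma sum_swap_pair:
  "(\<Sum>a\<in>X. \<Sum>b\<in>Y. \<Sum>u\<in>A. F a b u) = (\<Sum>u\<in>A. \<Sum>a\<in>X. \<Sum>b\<in>Y. F a b u)"
proof -
  have "(\<Sum>a\<in>X. \<Sum>b\<in>Y. \<Sum>u\<in>A. F a b u) = (\<Sum>a\<in>X. \<Sum>u\<in>A. \<Sum>b\<in>Y. F a b u)"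
    by (intro sum.cong refl sum.swap)
  also have "\<dots> = (\<Sum>u\<in>A. \<Sum>a\<in>X. \<Sum>b\<in>Y. F a b u)"
    by (rule sum.swap)
  finally show ?thesis .
qed

lemma sum_words_two_pairs:
  "(\<Sum>\<sigma>\<in>words (Suc (Suc (p + Suc (Suc q)))). F \<sigma>)
    = (\<Sum>u\<in>words p. \<Sum>w\<in>words q. \<Sum>a\<in>UNIV. \<Sum>b\<in>UNIV. \<Sum>c\<in>UNIV. \<Sum>d\<in>UNIV. F (a # b # u @ c # d # w))"
proof -
  have "(\<Sum>\<sigma>\<in>words (Suc (Suc (p + Suc (Suc q)))). F \<sigma>)
      = (\<Sum>a\<in>UNIV. \<Sum>b\<in>UNIV. \<Sum>u\<in>words p. \<Sum>w\<in>words q. \<Sum>c\<in>UNIV. \<Sum>d\<in>UNIV. F (a # b # u @ c # d # w))"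
    unfolding sum_words_Suc2 sum_words_add by (intro sum.cong refl sum_swap_pair)
  also have "\<dots> = (\<Sum>u\<in>words p. \<Sum>a\<in>UNIV. \<Sum>b\<in>UNIV. \<Sum>w\<in>words q. \<Sum>c\<in>UNIV. \<Sum>d\<in>UNIV. F (a # b # u @ c # d # w))"
    by (rule sum_swap_pair)
  also have "\<dots> = (\<Sum>u\<in>words p. \<Sum>w\<in>words q. \<Sum>a\<in>UNIV. \<Sum>b\<in>UNIV. \<Sum>c\<in>UNIV. \<Sum>d\<in>UNIV. F (a # b # u @ c # d # w))"
    by (intro sum.cong refl sum_swap_pair)
  finally show ?thesis .
qed

lemma sum_words_two_letters:
  "(\<Sum>\<sigma>\<in>words (Suc (p + Suc q)). F \<sigma>)
    = (\<Sum>u\<in>words p. \<Sum>w\<in>words q. \<Sum>e\<in>UNIV. \<Sum>f\<in>UNIV. F (e # u @ f # w))"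
proof -
  have "(\<Sum>\<sigma>\<in>words (Suc (p + Suc q)). F \<sigma>)
      = (\<Sum>e\<in>UNIV. \<Sum>u\<in>words p. \<Sum>f\<in>UNIV. \<Sum>w\<in>words q. F (e # u @ f # w))"
    by (simp add: sum_words_Suc sum_words_add del: add_Suc_right)
  also have "\<dots> = (\<Sum>u\<in>words p. \<Sum>e\<in>UNIV. \<Sum>f\<in>UNIV. \<Sum>w\<in>words q. F (e # u @ f # w))"
    by (rule sum.swap)
  also have "\<dots> = (\<Sum>u\<in>words p. \<Sum>w\<in>words q. \<Sum>e\<in>UNIV. \<Sum>f\<in>UNIV. F (e # u @ f # w))"
    by (intro sum.cong refl sum_swap_pair)
  finally show ?thesis .
qed

text \<open>Two ways of bracketing one sixfold sum: \<open>P\<close> carries the pair a b beside the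
  single letter f, \<open>R\<close> the single letter e beside the pair c d.\<close>

lemma sum_mult_exchange:
  fixes P R :: "3 \<Rightarrow> 3 \<Rightarrow> 3 \<Rightarrow> real"
  shows "(\<Sum>a\<in>UNIV. \<Sum>b\<in>UNIV. \<Sum>c\<in>UNIV. \<Sum>d\<in>UNIV.
        (\<Sum>e\<in>UNIV. mult x a b e * R e c d) * (\<Sum>f\<in>UNIV. mult x c d f * P a b f))
    = (\<Sum>e\<in>UNIV. \<Sum>f\<in>UNIV. (\<Sum>a\<in>UNIV. \<Sum>b\<in>UNIV. mult x a b e * P a b f)
        * (\<Sum>c\<in>UNIV. \<Sum>d\<in>UNIV. mult x c d f * R e c d))"
  by (simp only: sum_letters mult_def three_distinct simp_thms if_True if_False mult_zero_left mult_zero_right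
        add_0_left add_0_right mult_1_left)
     (simp only: algebra_simps)

text \<open>The correlation of two disjoint insertions, with the p letters \<open>u\<close> between
  them: one factor merges a b into e, the other merges c d into f.\<close>

definition far_term :: "real \<Rightarrow> (3 list \<Rightarrow> real) \<Rightarrow> nat \<Rightarrow> nat \<Rightarrow> real" where
  "far_term x \<phi> p q = (\<Sum>u\<in>words p. \<Sum>w\<in>words q. \<Sum>a\<in>UNIV. \<Sum>b\<in>UNIV. \<Sum>c\<in>UNIV. \<Sum>d\<in>UNIV.
     (\<Sum>e\<in>UNIV. mult x a b e * \<phi> (e # u @ c # d # w)) * (\<Sum>f\<in>UNIV. mult x c d f * \<phi> (a # b # u @ f # w)))"

text \<open>Undoing the rotation inside the state costs (-1)^(N * (p + 2)). Together with the
  prefactor the exponent is (2 * N + 1) * (p + 2), which has the parity of p.\<close>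

lemma coprod_far:
  assumes "twist_inv N \<phi>" "N = p + q + 3"
  shows "(-1) ^ (Suc N * Suc (Suc p)) * (\<Sum>\<sigma>\<in>words (Suc N). coprod x \<phi> \<sigma> * coprod x \<phi> ((turn ^^ Suc (Suc p)) \<sigma>))
    = (-1) ^ p * far_term x \<phi> p q"
proof -
  have N: "Suc N = Suc (Suc (p + Suc (Suc q)))"
    using assms(2) by simp
  have t: "coprod x \<phi> ((turn ^^ (p + 2)) (a # b # u @ c # d # w))
      = (-1) ^ (N * (p + 2)) * (\<Sum>f\<in>UNIV. mult x c d f * \<phi> (a # b # u @ f # w))"
    if "u \<in> words p" "w \<in> words q" for a b c d u w
  proof -
    have "(turn ^^ (p + 2)) (a # b # u @ c # d # w) = c # d # w @ map flip (a # b # u)"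
      using turn_pow_append[of "a # b # u" "c # d # w"] that by (simp add: words_def)
    moreover have "\<phi> (f # w @ map flip (a # b # u)) = (-1) ^ (N * (p + 2)) * \<phi> (a # b # u @ f # w)" for f
    proof -
      have l: "length (a # b # u) = p + 2" "length (a # b # u) + length (f # w) = N"
        using that assms(2) by (simp_all add: words_def)
      show ?thesis
        using twist_inv_append[OF assms(1) l(2)] unfolding l(1) by simp
    qed
    ultimately show ?thesis
      by (simp add: sum_distrib_left algebra_simps)
  qed
  have "(\<Sum>\<sigma>\<in>words (Suc N). coprod x \<phi> \<sigma> * coprod x \<phi> ((turn ^^ (p + 2)) \<sigma>))
      = (-1) ^ (N * (p + 2)) * far_term x \<phi> p q"
  proof -
    have "(\<Sum>\<sigma>\<in>words (Suc N). coprod x \<phi> \<sigma> * coprod x \<phi> ((turn ^^ (p + 2)) \<sigma>))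
        = (\<Sum>u\<in>words p. \<Sum>w\<in>words q. \<Sum>a\<in>UNIV. \<Sum>b\<in>UNIV. \<Sum>c\<in>UNIV. \<Sum>d\<in>UNIV. (-1) ^ (N * (p + 2)) *
            ((\<Sum>e\<in>UNIV. mult x a b e * \<phi> (e # u @ c # d # w))
              * (\<Sum>f\<in>UNIV. mult x c d f * \<phi> (a # b # u @ f # w))))"
      unfolding N sum_words_two_pairs
      by (intro sum.cong refl) (simp only: t coprod.simps mult.left_commute)
    then show ?thesis
      by (simp only: far_term_def sum_distrib_left)
  qed
  then show ?thesis
    by (simp add: minus_one_power_iff)
qed

text \<open>Here the total exponent is (2 * N + 1) * (p + 1). The sign opposite to that in
  \<open>coprod_far\<close> expresses that distant insertions anticommute; it makes the far terms of
  the two norms cancel.\<close>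

lemma coprod_adj_far:
  assumes "twist_inv (Suc N) \<phi>" "Suc N = p + q + 3"
  shows "(-1) ^ (N * Suc p) * (\<Sum>\<sigma>\<in>words N. coprod_adj x \<phi> \<sigma> * coprod_adj x \<phi> ((turn ^^ Suc p) \<sigma>))
    = - ((-1) ^ p * far_term x \<phi> p q)"
proof -
  have N: "N = Suc (p + Suc q)"
    using assms(2) by simp
  have t: "coprod_adj x \<phi> ((turn ^^ (p + 1)) (e # u @ f # w))
      = (-1) ^ (Suc N * (p + 1)) * (\<Sum>c\<in>UNIV. \<Sum>d\<in>UNIV. mult x c d f * \<phi> (e # u @ c # d # w))"
    if "u \<in> words p" "w \<in> words q" for e f u w
  proof -
    have "(turn ^^ (p + 1)) (e # u @ f # w) = f # w @ map flip (e # u)"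
      using turn_pow_append[of "e # u" "f # w"] that by (simp add: words_def)
    moreover have "\<phi> (c # d # w @ map flip (e # u)) = (-1) ^ (Suc N * (p + 1)) * \<phi> (e # u @ c # d # w)" for c d
    proof -
      have l: "length (e # u) = p + 1" "length (e # u) + length (c # d # w) = Suc N"
        using that assms(2) by (simp_all add: words_def)
      show ?thesis
        using twist_inv_append[OF assms(1) l(2)] unfolding l(1) by simp
    qed
    ultimately show ?thesis
      by (simp add: sum_distrib_left algebra_simps)
  qed
  have "(\<Sum>\<sigma>\<in>words N. coprod_adj x \<phi> \<sigma> * coprod_adj x \<phi> ((turn ^^ (p + 1)) \<sigma>))
      = (\<Sum>u\<in>words p. \<Sum>w\<in>words q. \<Sum>e\<in>UNIV. \<Sum>f\<in>UNIV. (-1) ^ (Suc N * (p + 1)) *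
          ((\<Sum>a\<in>UNIV. \<Sum>b\<in>UNIV. mult x a b e * \<phi> (a # b # u @ f # w))
            * (\<Sum>c\<in>UNIV. \<Sum>d\<in>UNIV. mult x c d f * \<phi> (e # u @ c # d # w))))"
    unfolding N sum_words_two_letters
    by (intro sum.cong refl) (simp only: t[unfolded N] coprod_adj.simps mult.left_commute)
  also have "\<dots> = (-1) ^ (Suc N * (p + 1)) * far_term x \<phi> p q"
    unfolding far_term_def sum_mult_exchange by (simp only: sum_distrib_left)
  finally show ?thesis
    by (simp add: minus_one_power_iff)
qed

text \<open>The local Hamiltonian is determined only up to terms that telescope along the chain. The diagonal
entries are chosen such that \<open>chain_weight_form\<close> holds without boundary terms.\<close>

definition chain_weight :: "real \<Rightarrow> 3 \<Rightarrow> 3 \<Rightarrow> 3 \<Rightarrow> 3 \<Rightarrow> real" where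
  "chain_weight x a b c d =
     (if c = a \<and> d = b then
        (if a = b then (if a = 2 then 2 else x\<^sup>2)
         else if a = 2 then 2 + x\<^sup>2 / 4 else if b = 2 then 3 * x\<^sup>2 / 4 else 1)
      else if c = b \<and> d = a then (if a = 2 \<or> b = 2 then 1 else - 1)
      else if a = 2 \<and> b = 2 \<and> c \<noteq> 2 \<and> d = flip c \<or> c = 2 \<and> d = 2 \<and> a \<noteq> 2 \<and> b = flip a then x
      else 0)"

fun local_op :: "(3 \<Rightarrow> 3 \<Rightarrow> 3 \<Rightarrow> 3 \<Rightarrow> real) \<Rightarrow> (3 list \<Rightarrow> real) \<Rightarrow> 3 list \<Rightarrow> real" where
  "local_op h f (a # b # w) = (\<Sum>c\<in>UNIV. \<Sum>d\<in>UNIV. h a b c d * f (c # d # w))"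
| "local_op h f _ = 0"

text \<open>The squares come from coinciding insertions of the coproduct and of its adjoint. The
  last term is the overlap of splitting the first and splitting the second letter, doubled because
  the displacement can be to either side.\<close>

lemma chain_weight_form:
  fixes \<Phi> :: "3 \<Rightarrow> 3 \<Rightarrow> real"
  shows "(\<Sum>a\<in>UNIV. \<Sum>b\<in>UNIV. \<Phi> a b * (\<Sum>c\<in>UNIV. \<Sum>d\<in>UNIV. chain_weight x a b c d * \<Phi> c d))
    = (\<Sum>a\<in>UNIV. \<Sum>b\<in>UNIV. \<Sum>c\<in>UNIV. (\<Sum>e\<in>UNIV. mult x a b e * \<Phi> e c)\<^sup>2)
      + (\<Sum>e\<in>UNIV. (\<Sum>a\<in>UNIV. \<Sum>b\<in>UNIV. mult x a b e * \<Phi> a b)\<^sup>2)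
      - 2 * (\<Sum>a\<in>UNIV. \<Sum>b\<in>UNIV. \<Sum>c\<in>UNIV.
          (\<Sum>e\<in>UNIV. mult x a b e * \<Phi> e c) * (\<Sum>e\<in>UNIV. mult x b c e * \<Phi> a e))"
  by (simp only: sum_letters mult_def chain_weight_def three_distinct flip_simps simp_thms if_True if_False
        mult_zero_left mult_zero_right add_0_left add_0_right mult_1_left power2_eq_square)
     (simp add: field_simps)

text \<open>Both norms are expanded in the displacement of two insertions. Far displacements cancel
  between them, and the remaining ones add up to the form of a single bond.\<close>

lemma ip_local_op:
  assumes "twist_inv N f" "N = Suc (Suc M)"
  shows "ip N f (local_op (chain_weight x) f)
    = ip (Suc N) (orbit_sum (Suc N) (coprod x f)) (orbit_sum (Suc N) (coprod x f)) / Suc N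
      + ip (Suc M) (orbit_sum (Suc M) (coprod_adj x f)) (orbit_sum (Suc M) (coprod_adj x f)) / Suc M"
proof -
  have fs: "flip_sym N f"
    by (rule twist_inv_flip_sym[OF assms(1)])
  have fs1: "flip_sym (Suc N) (coprod x f)"
    using assms(2) by (intro flip_sym_coprod fs) simp
  have fs2: "flip_sym (Suc M) (coprod_adj x f)"
    using fs assms(2) by (intro flip_sym_coprod_adj) simp_all
  define \<alpha> where "\<alpha> k = (-1) ^ (Suc N * k) * (\<Sum>\<sigma>\<in>words (Suc N). coprod x f \<sigma> * coprod x f ((turn ^^ k) \<sigma>))" for k
  define \<beta> where "\<beta> k = (-1) ^ (Suc M * k) * (\<Sum>\<sigma>\<in>words (Suc M). coprod_adj x f \<sigma> * coprod_adj x f ((turn ^^ k) \<sigma>))" for k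
  \<comment> \<open>Splittings displaced by p + 2 on N + 1 letters match mergings displaced by p + 1
    on N - 1 letters.\<close>
  have far: "\<alpha> (Suc (Suc p)) = - \<beta> (Suc p)" if "p < M" for p
  proof -
    have N: "N = p + (M - 1 - p) + 3"
      using that assms(2) by simp
    show ?thesis
      using coprod_far[OF assms(1) N, of x] coprod_adj_far[OF assms(1)[unfolded assms(2)] N[unfolded assms(2)], of x]
      unfolding \<alpha>_def \<beta>_def by (simp only: minus_minus)
  qed
  \<comment> \<open>On N + 1 letters, rotation by N is up to spin reversal the inverse of rotation
    by one: it is the adjacent displacement to the other side.\<close>
  have ends: "\<alpha> N = \<alpha> 1"
  proof -
    have "(\<Sum>\<sigma>\<in>words (Suc N). coprod x f \<sigma> * coprod x f ((turn ^^ N) \<sigma>))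
        = (\<Sum>\<sigma>\<in>words (Suc N). coprod x f (turn \<sigma>) * coprod x f ((turn ^^ N) (turn \<sigma>)))"
      by (rule sum_turn[symmetric])
    also have "\<dots> = (\<Sum>\<sigma>\<in>words (Suc N). (-1) ^ Suc N * (coprod x f \<sigma> * coprod x f (turn \<sigma>)))"
    proof (intro sum.cong refl)
      fix \<sigma> assume s: "\<sigma> \<in> words (Suc N)"
      then have "(turn ^^ N) (turn \<sigma>) = map flip \<sigma>"
        using turn_pow_length[of \<sigma>] by (simp add: words_def funpow_swap1)
      then show "coprod x f (turn \<sigma>) * coprod x f ((turn ^^ N) (turn \<sigma>))
          = (-1) ^ Suc N * (coprod x f \<sigma> * coprod x f (turn \<sigma>))"
        using fs1 s by (simp add: flip_sym_def)
    qed
    finally show ?thesis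
      unfolding \<alpha>_def sum_distrib_left[symmetric] by (simp add: minus_one_power_iff)
  qed
  have a0: "\<alpha> 0 = (\<Sum>w\<in>words M. \<Sum>a\<in>UNIV. \<Sum>b\<in>UNIV. \<Sum>c\<in>UNIV. (\<Sum>e\<in>UNIV. mult x a b e * f (e # c # w))\<^sup>2)"
  proof -
    have "\<alpha> 0 = (\<Sum>a\<in>UNIV. \<Sum>b\<in>UNIV. \<Sum>c\<in>UNIV. \<Sum>w\<in>words M. (\<Sum>e\<in>UNIV. mult x a b e * f (e # c # w))\<^sup>2)"
      unfolding \<alpha>_def assms(2) sum_words_Suc by (simp only: power2_eq_square funpow_0 coprod.simps mult_0_right power_0 mult_1)
    also have "\<dots> = (\<Sum>a\<in>UNIV. \<Sum>b\<in>UNIV. \<Sum>w\<in>words M. \<Sum>c\<in>UNIV. (\<Sum>e\<in>UNIV. mult x a b e * f (e # c # w))\<^sup>2)"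
      by (intro sum.cong refl sum.swap)
    also have "\<dots> = (\<Sum>w\<in>words M. \<Sum>a\<in>UNIV. \<Sum>b\<in>UNIV. \<Sum>c\<in>UNIV. (\<Sum>e\<in>UNIV. mult x a b e * f (e # c # w))\<^sup>2)"
      by (rule sum_swap_pair)
    finally show ?thesis .
  qed
  \<comment> \<open>After one rotation the second coproduct acts on b c inside a b c. The sign
    (-1)^N for bringing a back and the prefactor (-1)^(N + 1) leave a minus sign.\<close>
  have a1: "\<alpha> 1 = - (\<Sum>w\<in>words M. \<Sum>a\<in>UNIV. \<Sum>b\<in>UNIV. \<Sum>c\<in>UNIV.
      (\<Sum>e\<in>UNIV. mult x a b e * f (e # c # w)) * (\<Sum>e\<in>UNIV. mult x b c e * f (a # e # w)))"
  proof -
    have t: "coprod x f (turn (a # b # c # w)) = (-1) ^ N * (\<Sum>e\<in>UNIV. mult x b c e * f (a # e # w))"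
      if "w \<in> words M" for a b c w
    proof -
      have "f (e # w @ [flip a]) = (-1) ^ N * f (a # e # w)" for e
        using twist_inv_append[OF assms(1), of "[a]" "e # w"] that assms(2) by (simp add: words_def)
      then show ?thesis
        by (simp add: sum_distrib_left mult.left_commute)
    qed
    let ?g = "\<lambda>a b c w. (\<Sum>e\<in>UNIV. mult x a b e * f (e # c # w)) * (\<Sum>e\<in>UNIV. mult x b c e * f (a # e # w))"
    have "(\<Sum>\<sigma>\<in>words (Suc N). coprod x f \<sigma> * coprod x f (turn \<sigma>))
        = (\<Sum>a\<in>UNIV. \<Sum>b\<in>UNIV. \<Sum>c\<in>UNIV. \<Sum>w\<in>words M. (-1) ^ N * ?g a b c w)"
      unfolding assms(2)[THEN arg_cong[of _ _ "\<lambda>N. words (Suc N)"]] sum_words_Suc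
      by (intro sum.cong refl) (simp only: t coprod.simps mult.left_commute)
    also have "\<dots> = (-1) ^ N * (\<Sum>a\<in>UNIV. \<Sum>b\<in>UNIV. \<Sum>c\<in>UNIV. \<Sum>w\<in>words M. ?g a b c w)"
      by (simp only: sum_distrib_left)
    also have "(\<Sum>a\<in>UNIV. \<Sum>b\<in>UNIV. \<Sum>c\<in>UNIV. \<Sum>w\<in>words M. ?g a b c w)
        = (\<Sum>a\<in>UNIV. \<Sum>b\<in>UNIV. \<Sum>w\<in>words M. \<Sum>c\<in>UNIV. ?g a b c w)"
      by (intro sum.cong refl sum.swap)
    also have "\<dots> = (\<Sum>w\<in>words M. \<Sum>a\<in>UNIV. \<Sum>b\<in>UNIV. \<Sum>c\<in>UNIV. ?g a b c w)"
      by (rule sum_swap_pair)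
    finally show ?thesis
      by (simp add: \<alpha>_def minus_one_power_iff)
  qed
  have b0: "\<beta> 0 = (\<Sum>w\<in>words M. \<Sum>e\<in>UNIV. (\<Sum>a\<in>UNIV. \<Sum>b\<in>UNIV. mult x a b e * f (a # b # w))\<^sup>2)"
    unfolding \<beta>_def sum_words_Suc
    by (subst sum.swap) (simp only: power2_eq_square funpow_0 coprod_adj.simps mult_0_right power_0 mult_1)
  \<comment> \<open>The coinciding displacement 0 and the adjacent displacements 1 and N are split
    off; all others cancel by \<open>far\<close>.\<close>
  have "(\<Sum>k<Suc N. \<alpha> k) + (\<Sum>k<Suc M. \<beta> k)
      = \<alpha> 0 + \<alpha> 1 + (\<Sum>p<M. \<alpha> (Suc (Suc p))) + \<alpha> N + \<beta> 0 + (\<Sum>p<M. \<beta> (Suc p))"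
    by (simp only: assms(2) sum.lessThan_Suc_shift[of \<beta>] sum.lessThan_Suc_shift[of \<alpha>]
        sum.lessThan_Suc_shift[of "\<lambda>k. \<alpha> (Suc k)"] sum.lessThan_Suc[of "\<lambda>k. \<alpha> (Suc (Suc k))"] One_nat_def ac_simps)
  also have "\<dots> = \<alpha> 0 + 2 * \<alpha> 1 + \<beta> 0"
  proof -
    have "(\<Sum>p<M. \<alpha> (Suc (Suc p))) = (\<Sum>p<M. - \<beta> (Suc p))"
      by (intro sum.cong refl far) simp
    then show ?thesis
      by (simp add: ends sum_negf)
  qed
  also have "\<dots> = ip N f (local_op (chain_weight x) f)"
  proof -
    have "ip N f (local_op (chain_weight x) f) = (\<Sum>w\<in>words M. \<Sum>a\<in>UNIV. \<Sum>b\<in>UNIV.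
        f (a # b # w) * (\<Sum>c\<in>UNIV. \<Sum>d\<in>UNIV. chain_weight x a b c d * f (c # d # w)))"
      unfolding ip_def assms(2) sum_words_Suc2 local_op.simps by (rule sum_swap_pair)
    then show ?thesis
      unfolding a0 a1 b0 chain_weight_form[of "\<lambda>a b. f (a # b # _)"]
      by (simp only: sum.distrib sum_subtractf sum_distrib_left[symmetric])
  qed
  finally have "(\<Sum>k<Suc N. \<alpha> k) + (\<Sum>k<Suc M. \<beta> k) = ip N f (local_op (chain_weight x) f)" .
  moreover have "(\<Sum>k<Suc N. \<alpha> k)
      = ip (Suc N) (orbit_sum (Suc N) (coprod x f)) (orbit_sum (Suc N) (coprod x f)) / Suc N"
    unfolding ip_orbit_sum_self[OF fs1] \<alpha>_def by (simp del: sum.lessThan_Suc)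
  moreover have "(\<Sum>k<Suc M. \<beta> k)
      = ip (Suc M) (orbit_sum (Suc M) (coprod_adj x f)) (orbit_sum (Suc M) (coprod_adj x f)) / Suc M"
    unfolding ip_orbit_sum_self[OF fs2] \<beta>_def by (simp del: sum.lessThan_Suc)
  ultimately show ?thesis
    by simp
qed

section \<open>Nilpotency of the supercharge\<close>

text \<open>The scalar part of the product of 2 by 2 matrices whose traceless part is \<open>mult\<close>. The full product is
associative, which measures the failure of \<open>mult\<close> to be so.\<close>

definition kappa :: "real \<Rightarrow> 3 \<Rightarrow> 3 \<Rightarrow> real" where
  "kappa x a b = (if a = 2 \<and> b = 2 then x\<^sup>2 / 4 else if a \<noteq> 2 \<and> b = flip a then - x / 2 else 0)"

lemma kappa_flip: "kappa x (flip a) (flip b) = kappa x a b"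
  using exhaust_3[of a] exhaust_3[of b] by (elim disjE) (simp_all add: kappa_def)

text \<open>If ab is the sum of its scalar part \<open>kappa\<close> and its traceless part
  \<open>mult\<close>, comparing the traceless parts of (ab)c and a(bc) gives this associator. The
  check on letters covers x = 0 as well.\<close>

lemma mult_associator:
  "(\<Sum>e\<in>UNIV. mult x a b e * (\<Sum>f\<in>UNIV. mult x e c f * G f))
    - (\<Sum>e\<in>UNIV. mult x b c e * (\<Sum>f\<in>UNIV. mult x a e f * G f))
    = kappa x b c * G a - kappa x a b * G c"
  using exhaust_3[of a] exhaust_3[of b] exhaust_3[of c]
  by (elim disjE) (simp_all add: sum_letters mult_def kappa_def power2_eq_square)

section \<open>Decompositions of words\<close>

lemma word_split:
  assumes "\<sigma> \<in> words (p + q)"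
  obtains u w where "\<sigma> = u @ w" "length u = p" "length w = q"
proof
  show "\<sigma> = take p \<sigma> @ drop p \<sigma>" by simp
qed (use assms in \<open>auto simp: words_def\<close>)

lemma word_Suc:
  assumes "\<sigma> \<in> words (Suc n)"
  obtains a w where "\<sigma> = a # w" "length w = n"
  using assms by (auto simp: words_def length_Suc_conv)

lemma word_Suc_Suc:
  assumes "\<sigma> \<in> words (Suc (Suc n))"
  obtains a b w where "\<sigma> = a # b # w" "length w = n"
  using assms by (auto simp: words_def length_Suc_conv)

lemma word_Suc_Suc_Suc:
  assumes "\<sigma> \<in> words (Suc (Suc (Suc n)))"
  obtains a b c w where "\<sigma> = a # b # c # w" "length w = n"
  using assms by (auto simp: words_def length_Suc_conv)

lemma word_snoc:
  assumes "\<sigma> \<in> words (Suc n)"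
  obtains w c where "\<sigma> = w @ [c]" "length w = n"
  using assms by (cases \<sigma> rule: rev_exhaust) (auto simp: words_def)

text \<open>Disjoint insertions cancel in pairs, and overlapping ones leave the associator of
  \<open>mult\<close>, which is a difference of rotated terms and so has vanishing orbit
  sum.\<close>

lemma coprod_orbit_sum_coprod:
  assumes "twist_inv (Suc M) \<eta>" "\<sigma> \<in> words (M + 3)"
  shows "orbit_sum (M + 3) (coprod x (orbit_sum (Suc (Suc M)) (coprod x \<eta>))) \<sigma> = 0"
proof -
  define n where "n = M + 3"
  have n: "n = Suc (Suc (Suc M))"
    by (simp add: n_def)
  have fs: "flip_sym (Suc M) \<eta>"
    by (rule twist_inv_flip_sym[OF assms(1)])
  have fsc: "flip_sym (Suc (Suc M)) (coprod x \<eta>)"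
    by (rule flip_sym_coprod[OF fs]) simp
  \<comment> \<open>The outer insertion sits at the front, the inner one is displaced by k. The
    insertions overlap for k = 0 and, across the end, for k = M + 1; otherwise they are
    disjoint.\<close>
  define y where "y k \<sigma> = (\<Sum>e\<in>UNIV. mult x (\<sigma> ! 0) (\<sigma> ! 1) e *
      ((-1) ^ (Suc (Suc M) * k) * coprod x \<eta> ((turn ^^ k) (e # drop 2 \<sigma>))))" for k \<sigma>
  \<comment> \<open>The other bracketing of an overlap: the second and third letters are merged
    first.\<close>
  define y1 where "y1 \<sigma> = (\<Sum>e\<in>UNIV. mult x (\<sigma> ! 1) (\<sigma> ! 2) e *
      (\<Sum>f\<in>UNIV. mult x (\<sigma> ! 0) e f * \<eta> (f # drop 3 \<sigma>)))" for \<sigma>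
  define z where "z \<sigma> = kappa x (\<sigma> ! 0) (\<sigma> ! 1) * \<eta> (drop 2 \<sigma>)" for \<sigma>
  have \<sigma>: "\<sigma> \<in> words n"
    using assms(2) by (simp add: n_def)
  have fsy: "flip_sym n (y k)" for k
    unfolding flip_sym_def
  proof
    fix \<tau> assume "\<tau> \<in> words n"
    then obtain a b v where t: "\<tau> = a # b # v" "length v = Suc M"
      unfolding n by (rule word_Suc_Suc)
    have "coprod x \<eta> ((turn ^^ k) (flip e # map flip v)) = (-1) ^ Suc (Suc M) * coprod x \<eta> ((turn ^^ k) (e # v))" for e
      using bspec[OF fsc[unfolded flip_sym_def], of "(turn ^^ k) (e # v)"] t
      by (simp add: turn_pow_map_flip[symmetric] words_def)
    then show "y k (map flip \<tau>) = (-1) ^ n * y k \<tau>"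
      by (simp add: y_def t sum_mult_flip sum_negf sum_distrib_left n mult.left_commute)
  qed
  have fsy1: "flip_sym n y1"
    unfolding flip_sym_def
  proof
    fix \<tau> assume "\<tau> \<in> words n"
    then obtain a b c v where t: "\<tau> = a # b # c # v" "length v = M"
      unfolding n by (rule word_Suc_Suc_Suc)
    have "\<eta> (flip f # map flip v) = (-1) ^ Suc M * \<eta> (f # v)" for f
      using bspec[OF fs[unfolded flip_sym_def], of "f # v"] t by (simp add: words_def)
    then show "y1 (map flip \<tau>) = (-1) ^ n * y1 \<tau>"
      by (simp add: y1_def t sum_mult_flip sum_negf n) (simp add: sum_distrib_left mult.left_commute)
  qed
  have fsz: "flip_sym n z"
    unfolding flip_sym_def
  proof
    fix \<tau> assume "\<tau> \<in> words n"
    then obtain a b v where t: "\<tau> = a # b # v" "length v = Suc M"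
      unfolding n by (rule word_Suc_Suc)
    have "\<eta> (map flip v) = (-1) ^ Suc M * \<eta> v"
      using bspec[OF fs[unfolded flip_sym_def], of v] t by (simp add: words_def)
    then show "z (map flip \<tau>) = (-1) ^ n * z \<tau>"
      by (simp add: z_def t kappa_flip n)
  qed
  \<comment> \<open>Rotation by p + 2 brings the inner pair to the front and so exchanges the two
    insertions, along with their distances p and q. The minus sign is that of
    \<open>mult_flip\<close> for the pair carried round the end.\<close>
  have far: "orbit_sum n (y (Suc q)) \<sigma> = - orbit_sum n (y (Suc p)) \<sigma>" if pq: "p + q + 1 = M" for p q
  proof -
    have "(-1) ^ (n * (p + 2)) * y (Suc q) ((turn ^^ (p + 2)) \<tau>) = - 1 * y (Suc p) \<tau>"
      if "\<tau> \<in> words n" for \<tau>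
    proof -
      have "\<tau> \<in> words ((p + 2) + (q + 2))"
        using that pq by (simp add: n)
      then obtain u' w' where "\<tau> = u' @ w'" "length u' = p + 2" "length w' = q + 2"
        by (rule word_split)
      moreover from this obtain a b u where "u' = a # b # u" "length u = p"
        using word_Suc_Suc[of u' p] by (auto simp: words_def)
      moreover from \<open>length w' = q + 2\<close> obtain c d w where "w' = c # d # w" "length w = q"
        using word_Suc_Suc[of w' q] by (auto simp: words_def)
      ultimately have t: "\<tau> = a # b # u @ c # d # w" "length u = p" "length w = q"
        by simp_all
      have 1: "(turn ^^ (p + 2)) \<tau> = c # d # w @ flip a # flip b # map flip u"
        using turn_pow_append[of "a # b # u" "c # d # w"] t by simp
      have 2: "(turn ^^ Suc p) (e # u @ c # d # w) = c # d # w @ flip e # map flip u" for e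
        using turn_pow_append[of "e # u" "c # d # w"] t by simp
      have 3: "(turn ^^ Suc q) (f # w @ flip a # flip b # map flip u) = flip a # flip b # map flip u @ flip f # map flip w" for f
        using turn_pow_append[of "f # w" "flip a # flip b # map flip u"] t by simp
      have 4: "\<eta> (flip e # map flip u @ flip f # map flip w) = (-1) ^ (Suc M * Suc q) * \<eta> (f # w @ flip e # map flip u)" for e f
        using twist_inv_append[OF assms(1), of "f # w" "flip e # map flip u"] t pq by simp
      define K where "K = (-1::real) ^ (Suc (Suc M) * Suc q)"
      define K' where "K' = (-1::real) ^ (Suc M * Suc q)"
      define L where "L = (-1::real) ^ (Suc (Suc M) * Suc p)"
      have sign: "(-1) ^ (n * (p + 2)) * K * K' = L"
      proof -
        have "M = Suc (p + q)"
          using pq by simp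
        then show ?thesis
          unfolding K_def K'_def L_def n
          by (cases "even p"; cases "even q") (simp_all add: minus_one_power_iff)
      qed
      define T where "T = (\<Sum>e\<in>UNIV. \<Sum>f\<in>UNIV. mult x a b e * (mult x c d f * \<eta> (f # w @ flip e # map flip u)))"
      have T_swap: "T = (\<Sum>f\<in>UNIV. \<Sum>e\<in>UNIV. mult x a b e * (mult x c d f * \<eta> (f # w @ flip e # map flip u)))"
        unfolding T_def by (rule sum.swap)
      have 5: "coprod x \<eta> ((turn ^^ Suc q) (f # w @ flip a # flip b # map flip u))
          = - (K' * (\<Sum>e\<in>UNIV. mult x a b e * \<eta> (f # w @ flip e # map flip u)))" for f
        unfolding 3 coprod.simps sum_mult_flip 4 K'_def by (simp add: sum_distrib_left mult.left_commute)
      have 6: "coprod x \<eta> ((turn ^^ Suc p) (e # u @ c # d # w))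
          = (\<Sum>f\<in>UNIV. mult x c d f * \<eta> (f # w @ flip e # map flip u))" for e
        unfolding 2 by simp
      have "y (Suc q) ((turn ^^ (p + 2)) \<tau>)
          = (\<Sum>f\<in>UNIV. mult x c d f * (K * coprod x \<eta> ((turn ^^ Suc q) (f # w @ flip a # flip b # map flip u))))"
        unfolding 1 y_def K_def by simp
      also have "\<dots> = - (K * K' * T)"
        unfolding 5 T_swap by (simp add: sum_distrib_left sum_negf mult_ac)
      finally have "(-1) ^ (n * (p + 2)) * y (Suc q) ((turn ^^ (p + 2)) \<tau>) = - (L * T)"
        by (simp add: sign[symmetric])
      moreover have "y (Suc p) \<tau> = (\<Sum>e\<in>UNIV. mult x a b e * (L * coprod x \<eta> ((turn ^^ Suc p) (e # u @ c # d # w))))"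
        unfolding t(1) y_def L_def by simp
      then have "y (Suc p) \<tau> = L * T"
        unfolding 6 T_def by (simp add: sum_distrib_left mult_ac)
      ultimately show ?thesis
        by simp
    qed
    then have "orbit_sum n (\<lambda>\<tau>. (-1) ^ (n * (p + 2)) * y (Suc q) ((turn ^^ (p + 2)) \<tau>)) \<sigma>
        = orbit_sum n (\<lambda>\<tau>. - 1 * y (Suc p) \<tau>) \<sigma>"
      by (intro orbit_sum_cong \<sigma>)
    then have "orbit_sum n (y (Suc q)) \<sigma> = orbit_sum n (\<lambda>\<tau>. - 1 * y (Suc p) \<tau>) \<sigma>"
      unfolding orbit_sum_shift_pow[OF fsy \<sigma>] .
    then show ?thesis
      unfolding orbit_sum_cmult by simp
  qed
  \<comment> \<open>Rotating the last letter to the front turns the overlap across the end into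
    \<open>y1\<close>; the outer pair gets flipped, which changes the sign.\<close>
  have last: "orbit_sum n (y (Suc M)) \<sigma> = - orbit_sum n y1 \<sigma>"
  proof -
    have "(-1) ^ (n * (M + 2)) * y1 ((turn ^^ (M + 2)) \<tau>) = - 1 * y (Suc M) \<tau>"
      if "\<tau> \<in> words n" for \<tau>
    proof -
      obtain a b v where v: "\<tau> = a # b # v" "length v = Suc M"
        using \<open>\<tau> \<in> words n\<close> unfolding n by (rule word_Suc_Suc)
      then obtain w c where "v = w @ [c]" "length w = M"
        using word_snoc[of v M] by (auto simp: words_def)
      with v have t: "\<tau> = a # b # w @ [c]" "length w = M"
        by simp_all
      have 1: "(turn ^^ (M + 2)) \<tau> = c # flip a # flip b # map flip w"
        using turn_pow_append[of "a # b # w" "[c]"] t by simp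
      have 2: "(turn ^^ Suc M) (e # w @ [c]) = c # flip e # map flip w" for e
        using turn_pow_append[of "e # w" "[c]"] t by simp
      have "y1 ((turn ^^ (M + 2)) \<tau>) = - y (Suc M) \<tau>"
      proof -
        have "y1 ((turn ^^ (M + 2)) \<tau>) = - (\<Sum>e\<in>UNIV. mult x a b e * (\<Sum>f\<in>UNIV. mult x c (flip e) f * \<eta> (f # map flip w)))"
          unfolding 1 y1_def by (simp add: sum_mult_flip)
        moreover have "y (Suc M) \<tau> = (\<Sum>e\<in>UNIV. mult x a b e * coprod x \<eta> ((turn ^^ Suc M) (e # w @ [c])))"
          unfolding t(1) y_def by (simp add: minus_one_power_iff)
        ultimately show ?thesis
          unfolding 2 by simp
      qed
      then show ?thesis
        by (simp add: n minus_one_power_iff)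
    qed
    then have "orbit_sum n (\<lambda>\<tau>. (-1) ^ (n * (M + 2)) * y1 ((turn ^^ (M + 2)) \<tau>)) \<sigma>
        = orbit_sum n (\<lambda>\<tau>. - 1 * y (Suc M) \<tau>) \<sigma>"
      by (intro orbit_sum_cong \<sigma>)
    then have "orbit_sum n y1 \<sigma> = orbit_sum n (\<lambda>\<tau>. - 1 * y (Suc M) \<tau>) \<sigma>"
      unfolding orbit_sum_shift_pow[OF fsy1 \<sigma>] .
    then show ?thesis
      unfolding orbit_sum_cmult by simp
  qed
  \<comment> \<open>By the associator identity the two bracketings differ by the signed rotation of
    \<open>z\<close> minus \<open>z\<close>, and both have the same orbit sum.\<close>
  have near: "orbit_sum n (y 0) \<sigma> - orbit_sum n y1 \<sigma> = 0"
  proof -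
    have "y 0 \<tau> - y1 \<tau> = (-1) ^ n * z (turn \<tau>) - z \<tau>" if "\<tau> \<in> words n" for \<tau>
    proof -
      obtain a b c v where t: "\<tau> = a # b # c # v" "length v = M"
        using \<open>\<tau> \<in> words n\<close> unfolding n by (rule word_Suc_Suc_Suc)
      have "\<eta> (v @ [flip a]) = (-1) ^ Suc M * \<eta> (a # v)"
        using twist_inv_append[OF assms(1), of "[a]" v] t by simp
      then have "(-1) ^ n * z (turn \<tau>) = kappa x b c * \<eta> (a # v)"
        by (simp add: z_def t n minus_one_power_iff)
      then show ?thesis
        using mult_associator[of x a b c "\<lambda>f. \<eta> (f # v)"] by (auto simp: y_def y1_def z_def t)
    qed
    then have "orbit_sum n (\<lambda>\<tau>. y 0 \<tau> - y1 \<tau>) \<sigma> = orbit_sum n (\<lambda>\<tau>. (-1) ^ n * z (turn \<tau>) - z \<tau>) \<sigma>"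
      by (intro orbit_sum_cong \<sigma>)
    then show ?thesis
      unfolding orbit_sum_diff orbit_sum_shift[OF fsz \<sigma>] by simp
  qed
  define X where "X p = orbit_sum n (y (Suc p)) \<sigma>" for p
  \<comment> \<open>Reversing the order shows that the sum is its own negative; this includes the
    self-paired middle term when M is odd.\<close>
  have "(\<Sum>p<M. X p) = (\<Sum>p<M. X (M - Suc p))"
    by (rule sum.nat_diff_reindex[symmetric])
  also have "\<dots> = (\<Sum>p<M. - X p)"
    unfolding X_def by (intro sum.cong refl far) auto
  finally have middle: "(\<Sum>p<M. X p) = 0"
    by (simp add: sum_negf)
  have "coprod x (orbit_sum (Suc (Suc M)) (coprod x \<eta>)) \<tau> = (\<Sum>k<Suc (Suc M). y k \<tau>)"
    if t: "\<tau> \<in> words n" for \<tau>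
  proof -
    obtain a b v where "\<tau> = a # b # v" "length v = Suc M"
      using t unfolding n by (rule word_Suc_Suc)
    then show ?thesis
      unfolding y_def orbit_sum_def
      by (subst sum.swap) (simp add: sum_distrib_left del: sum.lessThan_Suc)
  qed
  then have "orbit_sum n (coprod x (orbit_sum (Suc (Suc M)) (coprod x \<eta>))) \<sigma>
      = orbit_sum n (\<lambda>\<tau>. \<Sum>k<Suc (Suc M). y k \<tau>) \<sigma>"
    by (intro orbit_sum_cong \<sigma>)
  also have "\<dots> = (\<Sum>k<Suc (Suc M). orbit_sum n (y k) \<sigma>)"
    by (rule orbit_sum_sum)
  also have "\<dots> = orbit_sum n (y 0) \<sigma> + (\<Sum>p<M. X p) + orbit_sum n (y (Suc M)) \<sigma>"
    unfolding X_def by (subst sum.lessThan_Suc_shift) simp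
  finally show ?thesis
    using near last middle by (simp add: n_def)
qed

text \<open>Induction on the support: the part of \<open>S\<close> that vanishes at a new point has codimension at most one.\<close>

lemma orthogonal_projection:
  fixes S :: "('a \<Rightarrow> real) set"
  assumes "finite A"
    and "\<And>f \<sigma>. f \<in> S \<Longrightarrow> \<sigma> \<notin> A \<Longrightarrow> f \<sigma> = 0"
    and "\<And>f g. f \<in> S \<Longrightarrow> g \<in> S \<Longrightarrow> (\<lambda>\<sigma>. f \<sigma> + g \<sigma>) \<in> S"
    and "\<And>c f. f \<in> S \<Longrightarrow> (\<lambda>\<sigma>. c * f \<sigma>) \<in> S"
    and "(\<lambda>\<sigma>. 0) \<in> S"
  shows "\<exists>s\<in>S. \<forall>r\<in>S. (\<Sum>\<sigma>\<in>A. (\<xi> \<sigma> - s \<sigma>) * r \<sigma>) = 0"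
  using assms
proof (induction A arbitrary: S \<xi> rule: finite_induct)
  case empty
  then show ?case by auto
next
  case (insert a A)
  note add = insert.prems(2) and scale = insert.prems(3)
  define S' where "S' = {f \<in> S. f a = 0}"
  have ex: "\<exists>s\<in>S'. \<forall>r\<in>S'. (\<Sum>\<sigma>\<in>A. (\<xi> \<sigma> - s \<sigma>) * r \<sigma>) = 0" for \<xi>
  proof (rule insert.IH)
    show "f \<sigma> = 0" if "f \<in> S'" "\<sigma> \<notin> A" for f \<sigma>
      using that insert.prems(1)[of f \<sigma>] by (cases "\<sigma> = a") (auto simp: S'_def)
  qed (use insert.prems in \<open>auto simp: S'_def\<close>)
  have sum_a: "(\<Sum>\<sigma>\<in>insert a A. f \<sigma> * r \<sigma>) = (\<Sum>\<sigma>\<in>A. f \<sigma> * r \<sigma>)" if "r \<in> S'" for f r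
    using that insert.hyps by (simp add: S'_def)
  obtain s where s: "s \<in> S'" "\<And>r. r \<in> S' \<Longrightarrow> (\<Sum>\<sigma>\<in>A. (\<xi> \<sigma> - s \<sigma>) * r \<sigma>) = 0"
    using ex by metis
  show ?case
  proof (cases "S' = S")
    case True
    then show ?thesis
      using s sum_a by auto
  next
    case False
    then obtain t where t: "t \<in> S" "t a \<noteq> 0"
      by (auto simp: S'_def)
    obtain p where p: "p \<in> S'" "\<And>r. r \<in> S' \<Longrightarrow> (\<Sum>\<sigma>\<in>A. (t \<sigma> - p \<sigma>) * r \<sigma>) = 0"
      using ex by metis
    \<comment> \<open>Gram-Schmidt: \<open>t'\<close> is orthogonal to \<open>S'\<close> and spans
      \<open>S\<close> together with it, so the projection onto \<open>S\<close> adds the component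
      \<open>c\<close> along \<open>t'\<close>.\<close>
    define t' where "t' \<sigma> = t \<sigma> + (- 1) * p \<sigma>" for \<sigma>
    have t': "t' \<in> S" "t' a \<noteq> 0"
      using t p(1) add[OF t(1) scale[of p "- 1"]] by (auto simp: t'_def[abs_def] S'_def)
    define nn where "nn = (\<Sum>\<sigma>\<in>insert a A. t' \<sigma> * t' \<sigma>)"
    have "t' a * t' a > 0"
      using t'(2) not_real_square_gt_zero by blast
    then have "nn > 0"
      unfolding nn_def using insert.hyps by (simp add: add_pos_nonneg sum_nonneg)
    define c where "c = (\<Sum>\<sigma>\<in>insert a A. (\<xi> \<sigma> - s \<sigma>) * t' \<sigma>) / nn"
    have tS': "(\<Sum>\<sigma>\<in>insert a A. t' \<sigma> * r \<sigma>) = 0" if "r \<in> S'" for r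
      using p(2)[OF that] sum_a[OF that, of t'] by (simp add: t'_def)
    show ?thesis
    proof (intro bexI ballI)
      show "(\<lambda>\<sigma>. s \<sigma> + c * t' \<sigma>) \<in> S"
        using s(1) t'(1) add scale[of t' c] by (auto simp: S'_def)
      fix r assume r: "r \<in> S"
      \<comment> \<open>Subtracting \<open>k\<close> times \<open>t'\<close> makes \<open>r\<close>
        vanish at the new point, hence lie in \<open>S'\<close>.\<close>
      define k where "k = r a / t' a"
      define r' where "r' \<sigma> = r \<sigma> + (- k) * t' \<sigma>" for \<sigma>
      have r': "r' \<in> S'"
        using add[OF r scale[OF t'(1), of "- k"]] t'(2) by (auto simp: S'_def r'_def[abs_def] k_def)
      have "r \<sigma> = r' \<sigma> + k * t' \<sigma>" for \<sigma>
        by (simp add: r'_def)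
      then have "(\<Sum>\<sigma>\<in>insert a A. (\<xi> \<sigma> - (s \<sigma> + c * t' \<sigma>)) * r \<sigma>)
          = (\<Sum>\<sigma>\<in>insert a A. (\<xi> \<sigma> - s \<sigma>) * r' \<sigma> - c * (t' \<sigma> * r' \<sigma>)
              + k * ((\<xi> \<sigma> - s \<sigma>) * t' \<sigma>) - k * c * (t' \<sigma> * t' \<sigma>))"
        by (intro sum.cong refl) (simp add: algebra_simps)
      also have "\<dots> = (\<Sum>\<sigma>\<in>insert a A. (\<xi> \<sigma> - s \<sigma>) * r' \<sigma>) - c * (\<Sum>\<sigma>\<in>insert a A. t' \<sigma> * r' \<sigma>)
          + k * (\<Sum>\<sigma>\<in>insert a A. (\<xi> \<sigma> - s \<sigma>) * t' \<sigma>) - k * c * nn"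
        unfolding nn_def by (simp only: sum.distrib sum_subtractf sum_distrib_left)
      also have "\<dots> = 0"
        using sum_a[OF r', of "\<lambda>\<sigma>. \<xi> \<sigma> - s \<sigma>"] s(2)[OF r'] tS'[OF r'] \<open>nn > 0\<close> by (simp add: c_def)
      finally show "(\<Sum>\<sigma>\<in>insert a A. (\<xi> \<sigma> - (s \<sigma> + c * t' \<sigma>)) * r \<sigma>) = 0" .
    qed
  qed
qed

section \<open>Non-trivial cohomology\<close>

definition zeros :: "3 list \<Rightarrow> nat" where
  "zeros \<sigma> = count_list \<sigma> 2"

lemma zeros_simps [simp]:
  "zeros [] = 0" "zeros (a # w) = (if a = 2 then Suc (zeros w) else zeros w)"
  "zeros (u @ w) = zeros u + zeros w"
  by (auto simp: zeros_def)

lemma zeros_map_flip [simp]: "zeros (map flip w) = zeros w"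
  by (induction w) auto

lemma zeros_turn [simp]: "zeros (turn \<sigma>) = zeros \<sigma>"
  by (cases \<sigma>) auto

lemma zeros_turn_pow [simp]: "zeros ((turn ^^ k) \<sigma>) = zeros \<sigma>"
  by (induction k) auto

lemma zeros_unturn_pow [simp]: "zeros ((unturn ^^ k) \<sigma>) = zeros \<sigma>"
  by (metis turn_unturn_pow zeros_turn_pow)

definition even_words :: "nat \<Rightarrow> 3 list set" where
  "even_words N = {\<sigma> \<in> words N. even (zeros \<sigma>)}"

lemma finite_even_words [simp]: "finite (even_words N)"
  by (simp add: even_words_def)

text \<open>The exponent is the sum of the positions of the zeros, counted from 0.\<close>

fun zero_sign :: "3 list \<Rightarrow> real" where
  "zero_sign [] = 1"
| "zero_sign (a # w) = (-1) ^ zeros w * zero_sign w"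

lemma zero_sign_snoc: "zero_sign (w @ [a]) = zero_sign w * (if a = 2 then (-1) ^ length w else 1)"
  by (induction w) auto

lemma zero_sign_map_flip [simp]: "zero_sign (map flip w) = zero_sign w"
  by (induction w) auto

lemma zero_sign_square [simp]: "zero_sign w * zero_sign w = 1"
  by (induction w) (auto simp: minus_one_power_iff)

text \<open>The factor (-1)^N for each \<open>3\<close> provides the sign (-1)^N of the sector
  whenever \<open>turn\<close> flips a non-zero letter.\<close>

definition core_sign :: "nat \<Rightarrow> 3 list \<Rightarrow> real" where
  "core_sign N \<sigma> = zero_sign \<sigma> * (-1) ^ (N * count_list \<sigma> 3)"

lemma core_sign_Cons: "core_sign N (a # w) = (-1) ^ zeros w * (if a = 3 then (-1) ^ N else 1) * core_sign N w"
  by (simp add: core_sign_def power_add)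

lemma core_sign_snoc:
  "core_sign N (w @ [a]) = (if a = 2 then (-1) ^ length w else if a = 3 then (-1) ^ N else 1) * core_sign N w"
  by (simp add: core_sign_def zero_sign_snoc power_add)

lemma core_sign_square [simp]: "core_sign N w * core_sign N w = 1"
  by (simp add: core_sign_def minus_one_power_iff)

text \<open>A non-zero first letter changes the number of letters \<open>3\<close> by one, giving
  (-1)^N, while an even number of zeros shifts by one place. A first letter \<open>2\<close> moves
  from position 0 to N - 1 and the other zeros, odd in number, shift by one: again (-1)^N in
  total.\<close>

lemma core_sign_turn:
  assumes "\<sigma> \<in> even_words N"
  shows "core_sign N (turn \<sigma>) = (-1) ^ N * core_sign N \<sigma>"
proof (cases \<sigma>)
  case (Cons a w)
  then have "length w = N - 1" "N \<ge> 1" "even (zeros (a # w))"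
    using assms by (auto simp: even_words_def words_def)
  then show ?thesis
    using exhaust_3[of a] unfolding Cons
    by (elim disjE) (auto simp: core_sign_Cons core_sign_snoc minus_one_power_iff)
qed (use assms in \<open>auto simp: even_words_def words_def\<close>)

lemma letter_counts: "zeros v + count_list v 1 + count_list v 3 = length v"
proof (induction v)
  case (Cons a v)
  then show ?case
    using exhaust_3[of a] by auto
qed simp

lemma count_list_map_flip: "count_list (map flip v) 3 = count_list v 1"
proof (induction v)
  case (Cons a v)
  then show ?case
    using exhaust_3[of a] by auto
qed simp

text \<open>For N odd the non-zero letters are even in number, so the letters \<open>1\<close> and
  \<open>3\<close> have counts of equal parity; for N even the exponents are even anyway.\<close>

lemma core_sign_map_flip:
  assumes "length v = N" "odd (zeros v)"
  shows "core_sign N (map flip v) = core_sign N v"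
proof -
  have "even (N * count_list v 1) = even (N * count_list v 3)"
    using letter_counts[of v] assms by (metis even_add even_mult_iff)
  then show ?thesis
    by (simp add: core_sign_def count_list_map_flip minus_one_power_iff)
qed

text \<open>Each term of the coproduct changes the number of zeros by one.\<close>

lemma coprod_restrict:
  "coprod x (\<lambda>\<sigma>. if even (zeros \<sigma>) then f \<sigma> else 0) \<sigma> = (if odd (zeros \<sigma>) then coprod x f \<sigma> else 0)"
proof (induction x f \<sigma> rule: coprod.induct)
  case (1 x f a b w)
  then show ?case
    using exhaust_3[of a] exhaust_3[of b] by (elim disjE) (simp_all add: sum_letters mult_def)
qed auto

text \<open>In terms of traceless matrices this is the trace of a product of commutators with a fixed Pauli
matrix, i.e. a Connes character; up to signs it has the entries \<open>\<bar>x\<bar>\<close> to the power of half the number of zeros.\<close>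

definition cocycle :: "nat \<Rightarrow> real \<Rightarrow> 3 list \<Rightarrow> real" where
  "cocycle N x \<sigma> = (if \<sigma> \<in> even_words N then core_sign N \<sigma> * ((-1) ^ N * x) ^ (zeros \<sigma> div 2) else 0)"

lemma twist_inv_cocycle: "twist_inv N (cocycle N x)"
  by (auto simp: twist_inv_def cocycle_def core_sign_turn even_words_def)

text \<open>The coproduct of the cocycle need not vanish, but it is a function minus its signed
  rotation, which the orbit sum annihilates.\<close>

lemma orbit_sum_coprod_cocycle:
  assumes "N \<ge> 1" "\<sigma> \<in> words (Suc N)"
  shows "orbit_sum (Suc N) (coprod x (cocycle N x)) \<sigma> = 0"
proof -
  define \<eta> where "\<eta> = (-1) ^ N * x"
  \<comment> \<open>The factor 1/2 is that of x/2 in \<open>mult\<close>; the x itself raises the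
    power of \<open>\<eta>\<close> by one, whence the rounded-up exponent.\<close>
  define y where "y \<sigma> = (if odd (zeros (tl \<sigma>)) \<and> hd \<sigma> \<noteq> 2
      then (if hd \<sigma> = 1 then (-1) ^ N / 2 else - 1 / 2) * core_sign N (tl \<sigma>) * \<eta> ^ (Suc (zeros (tl \<sigma>)) div 2)
      else 0)" for \<sigma>
  have "coprod x (cocycle N x) \<tau> = y \<tau> - (-1) ^ Suc N * y (turn \<tau>)" if "\<tau> \<in> words (Suc N)" for \<tau>
  proof -
    obtain M where M: "N = Suc M"
      using assms(1) by (cases N) auto
    obtain a b w where t: "\<tau> = a # b # w" "length w = M"
      using \<open>\<tau> \<in> words (Suc N)\<close> unfolding M by (rule word_Suc_Suc)
    have c: "cocycle N x (e # w) = (if even (zeros (e # w))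
        then core_sign N (e # w) * \<eta> ^ (zeros (e # w) div 2) else 0)" for e
      using t by (simp add: cocycle_def even_words_def words_def M \<eta>_def)
    have x: "x = (-1) ^ N * \<eta>"
      by (simp add: \<eta>_def)
    define m where "m = zeros w div 2"
    have "zeros w = 2 * m \<or> zeros w = 2 * m + 1"
      unfolding m_def by arith
    then show ?thesis
      using exhaust_3[of a] exhaust_3[of b] unfolding t(1) coprod.simps sum_letters c y_def
      by (elim disjE; cases "even N")
         (simp_all add: mult_def core_sign_Cons core_sign_snoc x t(2) M minus_one_power_iff)
  qed
  then have eq: "orbit_sum (Suc N) (coprod x (cocycle N x)) \<sigma>
      = orbit_sum (Suc N) (\<lambda>\<tau>. y \<tau> - (-1) ^ Suc N * y (turn \<tau>)) \<sigma>"
    by (intro orbit_sum_cong assms(2))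
  have fs: "flip_sym (Suc N) y"
    unfolding flip_sym_def
  proof
    fix \<tau> assume "\<tau> \<in> words (Suc N)"
    then obtain a v where "\<tau> = a # v" "length v = N"
      by (rule word_Suc)
    then show "y (map flip \<tau>) = (-1) ^ Suc N * y \<tau>"
      using exhaust_3[of a] core_sign_map_flip[of v N]
      by (elim disjE) (auto simp: y_def minus_one_power_iff)
  qed
  show ?thesis
    unfolding eq orbit_sum_diff orbit_sum_shift[OF fs assms(2)] by simp
qed

definition dual_cocycle :: "nat \<Rightarrow> 3 list \<Rightarrow> real" where
  "dual_cocycle N \<sigma> = (if \<sigma> \<in> words N \<and> zeros \<sigma> = 0 then core_sign N \<sigma> else 0)"

lemma twist_inv_dual_cocycle: "twist_inv N (dual_cocycle N)"
  by (auto simp: twist_inv_def dual_cocycle_def core_sign_turn even_words_def)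

text \<open>Pairs merging into a non-zero letter contain a zero, where the state vanishes. The pairs
  \<open>1\<close>, \<open>3\<close> and \<open>3\<close>, \<open>1\<close> merging into
  \<open>2\<close> have equal \<open>core_sign\<close> and opposite coefficients.\<close>

lemma coprod_adj_dual_cocycle: "coprod_adj x (dual_cocycle N) \<sigma> = 0"
proof (cases \<sigma>)
  case (Cons e w)
  then show ?thesis
    using exhaust_3[of e]
    by (elim disjE) (simp_all add: sum_letters mult_def dual_cocycle_def words_def core_sign_Cons)
qed simp

text \<open>Both states equal \<open>core_sign\<close> on words without zeros, also for x = 0
  because the zeroth power is 1. The overlap counts these words; the all-up word is one of
  them.\<close>

lemma ip_cocycle_dual_cocycle: "ip N (cocycle N x) (dual_cocycle N) > 0"
proof -
  let ?u = "replicate N (1::3)"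
  have z: "zeros ?u = 0"
    by (induction N) auto
  have "cocycle N x \<sigma> * dual_cocycle N \<sigma> = (if \<sigma> \<in> words N \<and> zeros \<sigma> = 0 then 1 else 0)" for \<sigma>
    by (simp add: cocycle_def dual_cocycle_def even_words_def)
  then have "ip N (cocycle N x) (dual_cocycle N) = (\<Sum>\<sigma>\<in>words N. if \<sigma> \<in> words N \<and> zeros \<sigma> = 0 then 1 else 0)"
    unfolding ip_def by simp
  also have "\<dots> > 0"
  proof (rule sum_pos2[of _ ?u])
    show "?u \<in> words N" "0 < (if ?u \<in> words N \<and> zeros ?u = 0 then 1 else 0 :: real)"
      by (simp_all add: z words_def)
  qed simp_all
  finally show ?thesis .
qed

section \<open>The harmonic representative of the cohomology class\<close>

lemma ip_self_eq_0_iff: "ip N f f = 0 \<longleftrightarrow> (\<forall>\<sigma>\<in>words N. f \<sigma> = 0)"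
  by (simp add: ip_def sum_nonneg_eq_0_iff)

lemma coprod_cong:
  assumes "\<And>\<sigma>. \<sigma> \<in> words N \<Longrightarrow> f \<sigma> = g \<sigma>" "\<sigma> \<in> words (Suc N)" "N \<ge> 1"
  shows "coprod x f \<sigma> = coprod x g \<sigma>"
proof -
  obtain M where M: "N = Suc M"
    using assms(3) by (cases N) auto
  obtain a b w where "\<sigma> = a # b # w" "length w = M"
    using assms(2) unfolding M by (rule word_Suc_Suc)
  then show ?thesis
    using assms(1) by (simp add: words_def M)
qed

lemma coprod_diff: "coprod x (\<lambda>\<sigma>. f \<sigma> - g \<sigma>) = (\<lambda>\<sigma>. coprod x f \<sigma> - coprod x g \<sigma>)"
proof
  show "coprod x (\<lambda>\<sigma>. f \<sigma> - g \<sigma>) \<sigma> = coprod x f \<sigma> - coprod x g \<sigma>" for \<sigma>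
    by (induction x f \<sigma> rule: coprod.induct) (auto simp: sum_subtractf algebra_simps)
qed

lemma coprod_add: "coprod x (\<lambda>\<sigma>. f \<sigma> + g \<sigma>) = (\<lambda>\<sigma>. coprod x f \<sigma> + coprod x g \<sigma>)"
proof
  show "coprod x (\<lambda>\<sigma>. f \<sigma> + g \<sigma>) \<sigma> = coprod x f \<sigma> + coprod x g \<sigma>" for \<sigma>
    by (induction x f \<sigma> rule: coprod.induct) (auto simp: sum.distrib algebra_simps)
qed

lemma coprod_cmult: "coprod x (\<lambda>\<sigma>. c * f \<sigma>) = (\<lambda>\<sigma>. c * coprod x f \<sigma>)"
proof
  show "coprod x (\<lambda>\<sigma>. c * f \<sigma>) \<sigma> = c * coprod x f \<sigma>" for \<sigma>
    by (induction x f \<sigma> rule: coprod.induct) (auto simp: sum_distrib_left algebra_simps)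
qed

text \<open>Hodge theory: the cocycle minus its orthogonal projection onto the image of the
  supercharge is annihilated by the supercharge and by its adjoint, and its overlap with the dual
  cocycle is still positive.\<close>

lemma harmonic_state_exists:
  assumes N: "N = Suc (Suc M)"
  obtains h where "twist_inv N h" "\<And>\<sigma>. \<sigma> \<notin> even_words N \<Longrightarrow> h \<sigma> = 0" "\<exists>\<sigma>. h \<sigma> \<noteq> 0"
    "ip N h (local_op (chain_weight x) h) = 0"
proof -
  \<comment> \<open>The supercharge cut down to words with an even number of zeros, where the
    cocycle lives and where the sign gauge is available.\<close>
  define Q where "Q \<eta> \<sigma> = (if \<sigma> \<in> even_words N then orbit_sum N (coprod x \<eta>) \<sigma> else 0)" for \<eta> \<sigma>
  define S where "S = {Q \<eta> |\<eta>. twist_inv (Suc M) \<eta>}"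
  have Q_twist: "twist_inv N (Q \<eta>)" if "twist_inv (Suc M) \<eta>" for \<eta>
  proof -
    have "twist_inv N (orbit_sum N (coprod x \<eta>))"
      unfolding N by (intro twist_inv_orbit_sum flip_sym_coprod twist_inv_flip_sym that) simp
    then show ?thesis
      by (auto simp: twist_inv_def Q_def even_words_def)
  qed
  have "\<exists>s\<in>S. \<forall>r\<in>S. (\<Sum>\<sigma>\<in>words N. (cocycle N x \<sigma> - s \<sigma>) * r \<sigma>) = 0"
  proof (rule orthogonal_projection)
    show "f \<sigma> = 0" if "f \<in> S" "\<sigma> \<notin> words N" for f \<sigma>
      using that by (auto simp: S_def Q_def even_words_def)
    show "(\<lambda>\<sigma>. f \<sigma> + g \<sigma>) \<in> S" if "f \<in> S" "g \<in> S" for f g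
    proof -
      from that obtain \<eta> \<theta> where "f = Q \<eta>" "g = Q \<theta>" "twist_inv (Suc M) \<eta>" "twist_inv (Suc M) \<theta>"
        by (auto simp: S_def)
      moreover from this have "twist_inv (Suc M) (\<lambda>\<sigma>. \<eta> \<sigma> + \<theta> \<sigma>)"
        by (simp add: twist_inv_def algebra_simps)
      ultimately show ?thesis
        by (auto simp: S_def Q_def coprod_add orbit_sum_add fun_eq_iff intro!: exI[of _ "\<lambda>\<sigma>. \<eta> \<sigma> + \<theta> \<sigma>"])
    qed
    show "(\<lambda>\<sigma>. c * f \<sigma>) \<in> S" if "f \<in> S" for c f
    proof -
      from that obtain \<eta> where "f = Q \<eta>" "twist_inv (Suc M) \<eta>"
        by (auto simp: S_def)
      moreover from this have "twist_inv (Suc M) (\<lambda>\<sigma>. c * \<eta> \<sigma>)"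
        by (simp add: twist_inv_def algebra_simps)
      ultimately show ?thesis
        by (auto simp: S_def Q_def coprod_cmult orbit_sum_cmult fun_eq_iff intro!: exI[of _ "\<lambda>\<sigma>. c * \<eta> \<sigma>"])
    qed
    have "coprod x (\<lambda>_. 0) = (\<lambda>_. 0)"
      using coprod_cmult[of x 0 "\<lambda>_. 0"] by simp
    then have "Q (\<lambda>_. 0) = (\<lambda>_. 0)"
      by (auto simp: Q_def fun_eq_iff orbit_sum_def)
    then show "(\<lambda>\<sigma>. 0) \<in> S"
      by (auto simp: S_def twist_inv_def intro!: exI[of _ "\<lambda>_. 0"])
  qed simp
  then obtain \<eta>0 where \<eta>0: "twist_inv (Suc M) \<eta>0"
    and orth: "\<And>\<eta>. twist_inv (Suc M) \<eta> \<Longrightarrow> ip N (\<lambda>\<sigma>. cocycle N x \<sigma> - Q \<eta>0 \<sigma>) (Q \<eta>) = 0"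
    by (auto simp: S_def ip_def)
  define h where "h \<sigma> = cocycle N x \<sigma> - Q \<eta>0 \<sigma>" for \<sigma>
  have h_twist: "twist_inv N h"
    using twist_inv_cocycle[of N x] Q_twist[OF \<eta>0] by (simp add: twist_inv_def h_def algebra_simps)
  have h_even: "h \<sigma> = 0" if "\<sigma> \<notin> even_words N" for \<sigma>
    using that by (simp add: h_def cocycle_def Q_def)
  \<comment> \<open>The cut is invisible to a state supported on even words, so the adjoint of
    \<open>Q\<close> is still given by \<open>coprod_adj\<close>.\<close>
  have pairing: "ip N (Q \<eta>) g = N * ip (Suc M) \<eta> (coprod_adj x g)"
    if g: "twist_inv N g" "\<And>\<sigma>. \<sigma> \<notin> even_words N \<Longrightarrow> g \<sigma> = 0" for \<eta> g
  proof -
    have "ip N (Q \<eta>) g = ip N (orbit_sum N (coprod x \<eta>)) g"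
      unfolding ip_def Q_def using g(2) by (intro sum.cong) auto
    also have "\<dots> = N * ip (Suc M) \<eta> (coprod_adj x g)"
      using ip_coprod[of "Suc M" x \<eta> g] unfolding ip_orbit_sum[OF g(1)] by (simp add: N)
    finally show ?thesis .
  qed
  have "ip N h (dual_cocycle N) > 0"
  proof -
    have "ip N (Q \<eta>0) (dual_cocycle N) = 0"
    proof (subst pairing[OF twist_inv_dual_cocycle])
      show "dual_cocycle N \<sigma> = 0" if "\<sigma> \<notin> even_words N" for \<sigma>
        using that by (auto simp: dual_cocycle_def even_words_def)
    qed (simp add: ip_def coprod_adj_dual_cocycle)
    moreover have "ip N h (dual_cocycle N) = ip N (cocycle N x) (dual_cocycle N) - ip N (Q \<eta>0) (dual_cocycle N)"
      by (simp add: ip_def h_def sum_subtractf algebra_simps)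
    ultimately show ?thesis
      using ip_cocycle_dual_cocycle[of N x] by simp
  qed
  then have h_nonzero: "\<exists>\<sigma>. h \<sigma> \<noteq> 0"
    by (rule contrapos_pp) (simp add: ip_def)
  \<comment> \<open>By parity the cut passes through the coproduct, so nilpotency of the full
    supercharge applies to \<open>Q \<eta>0\<close>.\<close>
  have coboundary: "orbit_sum (Suc N) (coprod x h) \<sigma> = 0" if s: "\<sigma> \<in> words (Suc N)" for \<sigma>
  proof -
    have "orbit_sum (Suc N) (coprod x (Q \<eta>0)) \<sigma>
        = orbit_sum (Suc N) (\<lambda>\<tau>. if odd (zeros \<tau>) then coprod x (orbit_sum N (coprod x \<eta>0)) \<tau> else 0) \<sigma>"
    proof (rule orbit_sum_cong[OF _ s])
      fix \<tau> assume t: "\<tau> \<in> words (Suc N)"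
      have "coprod x (Q \<eta>0) \<tau>
          = coprod x (\<lambda>\<sigma>. if even (zeros \<sigma>) then orbit_sum N (coprod x \<eta>0) \<sigma> else 0) \<tau>"
        by (rule coprod_cong[OF _ t]) (auto simp: Q_def even_words_def N)
      then show "coprod x (Q \<eta>0) \<tau> = (if odd (zeros \<tau>) then coprod x (orbit_sum N (coprod x \<eta>0)) \<tau> else 0)"
        by (simp only: coprod_restrict)
    qed
    also have "\<dots> = (if odd (zeros \<sigma>) then orbit_sum (Suc N) (coprod x (orbit_sum N (coprod x \<eta>0))) \<sigma> else 0)"
      by (simp add: orbit_sum_def)
    also have "\<dots> = 0"
      using coprod_orbit_sum_coprod[OF \<eta>0, of \<sigma> x] s by (simp add: N eval_nat_numeral)
    finally have "orbit_sum (Suc N) (coprod x (Q \<eta>0)) \<sigma> = 0" .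
    moreover have "orbit_sum (Suc N) (coprod x (cocycle N x)) \<sigma> = 0"
      by (rule orbit_sum_coprod_cocycle[OF _ s]) (simp add: N)
    ultimately show ?thesis
      by (simp add: h_def[abs_def] coprod_diff orbit_sum_diff)
  qed
  \<comment> \<open>Orthogonality of \<open>h\<close> to the image of \<open>Q\<close> is tested on
    the adjoint supercharge of \<open>h\<close> itself; the result is the squared norm of
    \<open>r\<close>.\<close>
  define r where "r = orbit_sum (Suc M) (coprod_adj x h)"
  have r_twist: "twist_inv (Suc M) r"
    unfolding r_def using twist_inv_flip_sym[OF h_twist] N
    by (intro twist_inv_orbit_sum flip_sym_coprod_adj) simp_all
  have "0 = N * ip (Suc M) r (coprod_adj x h)"
    using orth[OF r_twist] pairing[OF h_twist h_even, of r] by (simp add: h_def[abs_def] ip_commute)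
  then have "ip (Suc M) (coprod_adj x h) r = 0"
    using N by (simp add: ip_commute)
  then have "ip (Suc M) r r = 0"
    using ip_orbit_sum[OF r_twist, of "coprod_adj x h"] by (simp add: r_def)
  moreover have "ip (Suc N) (orbit_sum (Suc N) (coprod x h)) (orbit_sum (Suc N) (coprod x h)) = 0"
    using coboundary by (simp add: ip_self_eq_0_iff)
  ultimately have "ip N h (local_op (chain_weight x) h) = 0"
    by (simp add: ip_local_op[OF h_twist N] r_def)
  with h_twist h_even h_nonzero show ?thesis
    by (rule that)
qed

section \<open>The sign gauge\<close>

text \<open>The value 1 at x = 0 makes \<open>gauge_sign\<close> a genuine sign for every x.\<close>

definition sg :: "real \<Rightarrow> real" where
  "sg x = (if x \<ge> 0 then 1 else - 1)"

lemma sg_simps [simp]: "sg x * sg x = 1" "sg x * x = \<bar>x\<bar>" "x * sg x = \<bar>x\<bar>" "sg x * \<bar>x\<bar> = x"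
  by (auto simp: sg_def)

text \<open>For x non-zero this is the sign of the entries of \<open>cocycle\<close> on even
  words.\<close>

definition gauge_sign :: "nat \<Rightarrow> real \<Rightarrow> 3 list \<Rightarrow> real" where
  "gauge_sign N x \<sigma> = core_sign N \<sigma> * ((-1) ^ N * sg x) ^ (zeros \<sigma> div 2)"

lemma gauge_sign_square [simp]: "gauge_sign N x \<sigma> * gauge_sign N x \<sigma> = 1"
proof -
  have "((-1) ^ N * sg x) * ((-1) ^ N * sg x) = 1"
    by (simp add: minus_one_power_iff)
  then have "((-1) ^ N * sg x) ^ k * ((-1) ^ N * sg x) ^ k = 1" for k
    by (simp flip: power_mult_distrib)
  moreover have "gauge_sign N x \<sigma> * gauge_sign N x \<sigma> = (core_sign N \<sigma> * core_sign N \<sigma>)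
      * (((-1) ^ N * sg x) ^ (zeros \<sigma> div 2) * ((-1) ^ N * sg x) ^ (zeros \<sigma> div 2))"
    unfolding gauge_sign_def by (simp only: mult_ac)
  ultimately show ?thesis
    by simp
qed

lemma gauge_sign_square_left [simp]: "gauge_sign N x \<sigma> * (gauge_sign N x \<sigma> * y) = y"
  by (simp flip: mult.assoc)

lemma abs_gauge_sign [simp]: "\<bar>gauge_sign N x \<sigma>\<bar> = 1"
  using power2_eq_1_iff[of "gauge_sign N x \<sigma>"] by (auto simp: power2_eq_square)

lemma gauge_sign_turn:
  assumes "\<sigma> \<in> even_words N"
  shows "gauge_sign N x (turn \<sigma>) = (-1) ^ N * gauge_sign N x \<sigma>"
  by (simp add: gauge_sign_def core_sign_turn[OF assms])

lemma gauge_sign_unturn_pow: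
  assumes "\<sigma> \<in> even_words N"
  shows "gauge_sign N x ((unturn ^^ j) \<sigma>) = (-1) ^ (N * j) * gauge_sign N x \<sigma>"
proof -
  have "gauge_sign N x ((turn ^^ j) \<tau>) = (-1) ^ (N * j) * gauge_sign N x \<tau>" if "\<tau> \<in> even_words N" for \<tau>
  proof (induction j)
    case (Suc j)
    have "(turn ^^ j) \<tau> \<in> even_words N"
      using that by (simp add: even_words_def)
    from gauge_sign_turn[OF this] Suc show ?case
      by (simp add: power_add)
  qed simp
  from this[of "(unturn ^^ j) \<sigma>"] assms show ?thesis
    by (simp add: even_words_def minus_one_power_iff)
qed

definition gauge_weight :: "real \<Rightarrow> 3 \<Rightarrow> 3 \<Rightarrow> 3 \<Rightarrow> 3 \<Rightarrow> real" where
  "gauge_weight x a b c d = (if c = a \<and> d = b then chain_weight x a b a b else - \<bar>chain_weight x a b c d\<bar>)"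

lemma chain_weight_sym: "chain_weight x a b c d = chain_weight x c d a b"
  using exhaust_3[of a] exhaust_3[of b] exhaust_3[of c] exhaust_3[of d]
  by (elim disjE) (simp_all add: chain_weight_def)

lemma gauge_weight_sym: "gauge_weight x a b c d = gauge_weight x c d a b"
  using chain_weight_sym[of x a b c d] unfolding gauge_weight_def by (cases "c = a \<and> d = b") auto

lemma chain_weight_flip: "chain_weight x (flip a) (flip b) (flip c) (flip d) = chain_weight x a b c d"
  using exhaust_3[of a] exhaust_3[of b] exhaust_3[of c] exhaust_3[of d]
  by (elim disjE) (simp_all add: chain_weight_def)

lemma gauge_weight_flip: "gauge_weight x (flip a) (flip b) (flip c) (flip d) = gauge_weight x a b c d"
  by (simp add: gauge_weight_def chain_weight_flip)

lemma chain_weight_parity: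
  assumes "chain_weight x a b c d \<noteq> 0"
  shows "even (zeros (a # b # w)) = even (zeros (c # d # w))"
  using assms exhaust_3[of a] exhaust_3[of b] exhaust_3[of c] exhaust_3[of d]
  by (elim disjE) (simp_all add: chain_weight_def)

text \<open>Swapping a zero with a neighbour changes the parity of its position; swapping
  \<open>1\<close> and \<open>3\<close> changes no sign, but has weight -1 already. Replacing
  \<open>2\<close>, \<open>2\<close> by a letter and its flip changes the position sum by 1, the
  number of letters \<open>3\<close> by one and that of zeros by two: the powers of (-1)^N cancel
  and - \<open>sg x\<close> remains, turning x into -|x|.\<close>

lemma chain_weight_gauge_sign:
  assumes "even (zeros (a # b # w))"
  shows "chain_weight x a b c d * gauge_sign N x (c # d # w) = gauge_sign N x (a # b # w) * gauge_weight x a b c d"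
proof -
  define m where "m = zeros w div 2"
  have m: "zeros w = 2 * m \<or> zeros w = 2 * m + 1"
    unfolding m_def by arith
  consider "c = a" "d = b" | "c = b" "d = a" "a \<noteq> b" | "a = 2" "b = 2" "c \<noteq> 2" "d = flip c"
    | "c = 2" "d = 2" "a \<noteq> 2" "b = flip a" | "chain_weight x a b c d = 0"
    unfolding chain_weight_def by fastforce
  then show ?thesis
  proof cases
    case 1
    then show ?thesis
      by (simp add: gauge_weight_def)
  next
    case 2
    then show ?thesis
      using m assms exhaust_3[of a] exhaust_3[of b]
      by (elim disjE)
         (simp_all add: chain_weight_def gauge_weight_def gauge_sign_def core_sign_Cons)
  next
    case 3
    then show ?thesis
      using m assms exhaust_3[of c]
      by (elim disjE)
         (simp_all add: chain_weight_def gauge_weight_def gauge_sign_def core_sign_Cons minus_one_power_iff)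
  next
    case 4
    then show ?thesis
      using m assms exhaust_3[of a]
      by (elim disjE)
         (simp_all add: chain_weight_def gauge_weight_def gauge_sign_def core_sign_Cons minus_one_power_iff)
  next
    case 5
    then have "gauge_weight x a b c d = 0"
      by (cases "c = a \<and> d = b") (auto simp: gauge_weight_def)
    with 5 show ?thesis
      by simp
  qed
qed

text \<open>The bond operators are conjugates of the first bond by the twisted rotation; j = N - 1
  gives the bond across the twisted end.\<close>

definition chain_op :: "(3 \<Rightarrow> 3 \<Rightarrow> 3 \<Rightarrow> 3 \<Rightarrow> real) \<Rightarrow> nat \<Rightarrow> (3 list \<Rightarrow> real) \<Rightarrow> 3 list \<Rightarrow> real" where
  "chain_op h N f \<sigma> = (\<Sum>j<N. local_op h (\<lambda>\<tau>. f ((unturn ^^ j) \<tau>)) ((turn ^^ j) \<sigma>))"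

lemma local_op_gauge_sign:
  assumes "even (zeros \<sigma>)"
  shows "local_op (chain_weight x) (\<lambda>\<tau>. gauge_sign N x \<tau> * g \<tau>) \<sigma>
    = gauge_sign N x \<sigma> * local_op (gauge_weight x) g \<sigma>"
proof (cases "(chain_weight x, g, \<sigma>)" rule: local_op.cases)
  case (1 h f a b w)
  then have s: "\<sigma> = a # b # w"
    by simp
  have "chain_weight x a b c d * (gauge_sign N x (c # d # w) * y)
      = gauge_sign N x (a # b # w) * (gauge_weight x a b c d * y)" for c d y
    using chain_weight_gauge_sign[of a b w x c d N] assms unfolding s by (simp only: mult.assoc[symmetric])
  then show ?thesis
    by (simp only: s local_op.simps sum_distrib_left)
qed auto

lemma local_op_cong:
  assumes "\<And>\<sigma>. \<sigma> \<in> even_words N \<Longrightarrow> f \<sigma> = g \<sigma>" "\<sigma> \<in> even_words N"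
  shows "local_op (chain_weight x) f \<sigma> = local_op (chain_weight x) g \<sigma>"
proof (cases "(chain_weight x, g, \<sigma>)" rule: local_op.cases)
  case (1 h f' a b w)
  then have s: "\<sigma> = a # b # w"
    by simp
  have "chain_weight x a b c d * f (c # d # w) = chain_weight x a b c d * g (c # d # w)" for c d
  proof (cases "chain_weight x a b c d = 0")
    case False
    then have "c # d # w \<in> even_words N"
      using chain_weight_parity[OF False, of w] assms(2) unfolding s
      by (simp add: even_words_def words_def del: zeros_simps)
    then show ?thesis
      by (simp add: assms(1))
  qed simp
  then show ?thesis
    by (simp only: s local_op.simps)
qed auto

lemma local_op_parity:
  assumes "\<And>a b c d. chain_weight x a b c d = 0 \<Longrightarrow> h a b c d = 0"
    and "\<And>\<sigma>. odd (zeros \<sigma>) \<Longrightarrow> f \<sigma> = 0" "odd (zeros \<sigma>)"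
  shows "local_op h f \<sigma> = 0"
proof (cases "(h, f, \<sigma>)" rule: local_op.cases)
  case (1 h' f' a b w)
  then have s: "\<sigma> = a # b # w"
    by simp
  have "h a b c d * f (c # d # w) = 0" for c d
    using chain_weight_parity[of x a b c d w] assms(1)[of a b c d] assms(2)[of "c # d # w"] assms(3)
    unfolding s by fastforce
  then show ?thesis
    by (simp only: s local_op.simps sum.neutral_const)
qed auto

lemma local_op_cmult: "local_op h (\<lambda>\<sigma>. c * f \<sigma>) \<sigma> = c * local_op h f \<sigma>"
  by (induction h f \<sigma> rule: local_op.induct) (simp_all add: sum_distrib_left mult_ac)

lemma local_op_add: "local_op h (\<lambda>\<sigma>. f \<sigma> + g \<sigma>) \<sigma> = local_op h f \<sigma> + local_op h g \<sigma>"
  by (induction h f \<sigma> rule: local_op.induct) (simp_all add: sum.distrib algebra_simps)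

lemma chain_op_cmult: "chain_op h N (\<lambda>\<sigma>. c * f \<sigma>) \<sigma> = c * chain_op h N f \<sigma>"
  by (simp add: chain_op_def local_op_cmult sum_distrib_left)

lemma chain_op_add: "chain_op h N (\<lambda>\<sigma>. f \<sigma> + g \<sigma>) \<sigma> = chain_op h N f \<sigma> + chain_op h N g \<sigma>"
  by (simp add: chain_op_def local_op_add sum.distrib)

text \<open>Rotating a bond to the front and back multiplies the gauge sign by (-1)^(N * j) twice,
  so the local gauge transformation carries over to the chain.\<close>

lemma chain_op_gauge_sign:
  assumes "\<sigma> \<in> even_words N"
  shows "chain_op (chain_weight x) N (\<lambda>\<tau>. gauge_sign N x \<tau> * g \<tau>) \<sigma>
    = gauge_sign N x \<sigma> * chain_op (gauge_weight x) N g \<sigma>"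
  unfolding chain_op_def sum_distrib_left
proof (intro sum.cong refl)
  fix j
  have t: "(turn ^^ j) \<sigma> \<in> even_words N"
    using assms by (simp add: even_words_def)
  have "local_op (chain_weight x) (\<lambda>\<tau>. gauge_sign N x ((unturn ^^ j) \<tau>) * g ((unturn ^^ j) \<tau>)) ((turn ^^ j) \<sigma>)
      = local_op (chain_weight x) (\<lambda>\<tau>. (-1) ^ (N * j) * (gauge_sign N x \<tau> * g ((unturn ^^ j) \<tau>))) ((turn ^^ j) \<sigma>)"
    by (rule local_op_cong[OF _ t]) (simp add: gauge_sign_unturn_pow)
  also have "\<dots> = (-1) ^ (N * j) * gauge_sign N x ((turn ^^ j) \<sigma>)
      * local_op (gauge_weight x) (\<lambda>\<tau>. g ((unturn ^^ j) \<tau>)) ((turn ^^ j) \<sigma>)"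
    using t by (simp add: local_op_cmult local_op_gauge_sign even_words_def)
  also have "(-1) ^ (N * j) * gauge_sign N x ((turn ^^ j) \<sigma>) = gauge_sign N x \<sigma>"
    using gauge_sign_unturn_pow[OF t, of x j] by simp
  finally show "local_op (chain_weight x) (\<lambda>\<tau>. gauge_sign N x ((unturn ^^ j) \<tau>) * g ((unturn ^^ j) \<tau>)) ((turn ^^ j) \<sigma>)
      = gauge_sign N x \<sigma> * local_op (gauge_weight x) (\<lambda>\<tau>. g ((unturn ^^ j) \<tau>)) ((turn ^^ j) \<sigma>)" .
qed

section \<open>Quadratic forms of chain operators\<close>

lemma ip_chain_op:
  "ip N r (chain_op h N g)
    = (\<Sum>j<N. ip N (\<lambda>\<tau>. r ((unturn ^^ j) \<tau>)) (local_op h (\<lambda>\<tau>. g ((unturn ^^ j) \<tau>))))"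
proof -
  have "ip N r (chain_op h N g)
      = (\<Sum>j<N. \<Sum>\<sigma>\<in>words N. r ((unturn ^^ j) ((turn ^^ j) \<sigma>)) * local_op h (\<lambda>\<tau>. g ((unturn ^^ j) \<tau>)) ((turn ^^ j) \<sigma>))"
    unfolding ip_def chain_op_def sum_distrib_left by (subst sum.swap) simp
  also have "\<dots> = (\<Sum>j<N. ip N (\<lambda>\<tau>. r ((unturn ^^ j) \<tau>)) (local_op h (\<lambda>\<tau>. g ((unturn ^^ j) \<tau>))))"
    unfolding ip_def
    by (intro sum.cong refl sum_turn_pow[of "\<lambda>\<tau>. r ((unturn ^^ _) \<tau>) * local_op h (\<lambda>\<tau>. g ((unturn ^^ _) \<tau>)) \<tau>"])
  finally show ?thesis .
qed

lemma ip_local_op_expand: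
  assumes "N = Suc (Suc M)"
  shows "ip N r (local_op h g) = (\<Sum>w\<in>words M. \<Sum>a\<in>UNIV. \<Sum>b\<in>UNIV. \<Sum>c\<in>UNIV. \<Sum>d\<in>UNIV.
    h a b c d * (r (a # b # w) * g (c # d # w)))"
proof -
  have "ip N r (local_op h g) = (\<Sum>a\<in>UNIV. \<Sum>b\<in>UNIV. \<Sum>w\<in>words M. \<Sum>c\<in>UNIV. \<Sum>d\<in>UNIV.
      h a b c d * (r (a # b # w) * g (c # d # w)))"
    unfolding ip_def assms sum_words_Suc2 by (simp add: sum_distrib_left mult_ac)
  then show ?thesis
    by (rule trans[OF _ sum_swap_pair])
qed

lemma ip_local_op_commute:
  assumes "\<And>a b c d. h a b c d = h c d a b" "N = Suc (Suc M)"
  shows "ip N r (local_op h g) = ip N g (local_op h r)"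
proof -
  have "(\<Sum>a\<in>UNIV. \<Sum>b\<in>UNIV. \<Sum>c\<in>UNIV. \<Sum>d\<in>UNIV. h a b c d * (r (a # b # w) * g (c # d # w)))
      = (\<Sum>a\<in>UNIV. \<Sum>b\<in>UNIV. \<Sum>c\<in>UNIV. \<Sum>d\<in>UNIV. h a b c d * (g (a # b # w) * r (c # d # w)))" for w
  proof -
    define F where "F a b c d = h a b c d * (g (a # b # w) * r (c # d # w))" for a b c d
    have F: "h a b c d * (r (a # b # w) * g (c # d # w)) = F c d a b" for a b c d
      unfolding F_def using assms(1)[of a b c d] by simp
    have "(\<Sum>a\<in>UNIV. \<Sum>b\<in>UNIV. \<Sum>c\<in>UNIV. \<Sum>d\<in>UNIV. F c d a b)
        = (\<Sum>c\<in>UNIV. \<Sum>a\<in>UNIV. \<Sum>b\<in>UNIV. \<Sum>d\<in>UNIV. F c d a b)"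
      by (rule sum_swap_pair)
    also have "\<dots> = (\<Sum>c\<in>UNIV. \<Sum>d\<in>UNIV. \<Sum>a\<in>UNIV. \<Sum>b\<in>UNIV. F c d a b)"
      by (intro sum.cong refl sum_swap_pair)
    finally show ?thesis
      unfolding F by (simp only: F_def)
  qed
  then show ?thesis
    by (simp only: ip_local_op_expand[OF assms(2)])
qed

section \<open>Positivity\<close>

text \<open>The diagonal terms agree because the squares add up. Off the diagonal the Cauchy-Schwarz
  inequality bounds the products of the F i, and the weights are non-positive.\<close>

lemma gauge_form_mono:
  assumes N: "N = Suc (Suc M)" and "finite I"
    and sq: "\<And>\<sigma>. \<sigma> \<in> words N \<Longrightarrow> (\<Sum>i\<in>I. (F i \<sigma>)\<^sup>2) = (G \<sigma>)\<^sup>2" and nonneg: "\<And>\<sigma>. G \<sigma> \<ge> 0"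
  shows "ip N G (local_op (gauge_weight x) G) \<le> (\<Sum>i\<in>I. ip N (F i) (local_op (gauge_weight x) (F i)))"
proof -
  have le: "gauge_weight x a b c d * (G (a # b # w) * G (c # d # w))
      \<le> (\<Sum>i\<in>I. gauge_weight x a b c d * (F i (a # b # w) * F i (c # d # w)))"
    if w: "w \<in> words M" for a b c d w
  proof (cases "c = a \<and> d = b")
    case True
    then show ?thesis
      using sq[of "a # b # w"] w
      by (simp add: words_def N power2_eq_square flip: sum_distrib_left)
  next
    case False
    have "(\<Sum>i\<in>I. F i (a # b # w) * F i (c # d # w))\<^sup>2
        \<le> (\<Sum>i\<in>I. (F i (a # b # w))\<^sup>2) * (\<Sum>i\<in>I. (F i (c # d # w))\<^sup>2)"
      by (rule Cauchy_Schwarz_ineq_sum)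
    also have "\<dots> = (G (a # b # w) * G (c # d # w))\<^sup>2"
      using sq[of "a # b # w"] sq[of "c # d # w"] w by (simp add: words_def N power_mult_distrib)
    finally have "(\<Sum>i\<in>I. F i (a # b # w) * F i (c # d # w)) \<le> G (a # b # w) * G (c # d # w)"
      by (rule power2_le_imp_le) (simp add: nonneg)
    moreover have "gauge_weight x a b c d \<le> 0"
      unfolding gauge_weight_def if_not_P[OF False] by simp
    ultimately show ?thesis
      by (simp add: mult_left_mono_neg flip: sum_distrib_left)
  qed
  have "ip N G (local_op (gauge_weight x) G) \<le> (\<Sum>w\<in>words M. \<Sum>a\<in>UNIV. \<Sum>b\<in>UNIV. \<Sum>c\<in>UNIV. \<Sum>d\<in>UNIV.
      \<Sum>i\<in>I. gauge_weight x a b c d * (F i (a # b # w) * F i (c # d # w)))"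
    unfolding ip_local_op_expand[OF N] by (intro sum_mono le)
  also have "\<dots> = (\<Sum>w\<in>words M. \<Sum>a\<in>UNIV. \<Sum>b\<in>UNIV. \<Sum>i\<in>I. \<Sum>c\<in>UNIV. \<Sum>d\<in>UNIV.
      gauge_weight x a b c d * (F i (a # b # w) * F i (c # d # w)))"
    by (intro sum.cong refl sum_swap_pair)
  also have "\<dots> = (\<Sum>w\<in>words M. \<Sum>i\<in>I. \<Sum>a\<in>UNIV. \<Sum>b\<in>UNIV. \<Sum>c\<in>UNIV. \<Sum>d\<in>UNIV.
      gauge_weight x a b c d * (F i (a # b # w) * F i (c # d # w)))"
    by (intro sum.cong refl sum_swap_pair)
  also have "\<dots> = (\<Sum>i\<in>I. ip N (F i) (local_op (gauge_weight x) (F i)))"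
    unfolding ip_local_op_expand[OF N] by (rule sum.swap)
  finally show ?thesis .
qed

lemma ip_local_op_map_flip:
  "ip N (\<lambda>\<sigma>. F (map flip \<sigma>)) (local_op (gauge_weight x) (\<lambda>\<sigma>. F (map flip \<sigma>)))
    = ip N F (local_op (gauge_weight x) F)"
proof -
  have "local_op (gauge_weight x) (\<lambda>\<sigma>. F (map flip \<sigma>)) \<sigma> = local_op (gauge_weight x) F (map flip \<sigma>)" for \<sigma>
  proof (cases "(gauge_weight x, F, \<sigma>)" rule: local_op.cases)
    case (1 h f a b w)
    then have s: "\<sigma> = a # b # w"
      by simp
    have "(\<Sum>c\<in>UNIV. \<Sum>d\<in>UNIV. gauge_weight x a b c d * F (flip c # flip d # map flip w))
        = (\<Sum>c\<in>UNIV. \<Sum>d\<in>UNIV. gauge_weight x (flip a) (flip b) (flip c) (flip d) * F (flip c # flip d # map flip w))"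
      by (simp only: gauge_weight_flip)
    also have "\<dots> = (\<Sum>c\<in>UNIV. \<Sum>d\<in>UNIV. gauge_weight x (flip a) (flip b) c d * F (c # d # map flip w))"
      by (rule sum_flip_pair)
    finally show ?thesis
      by (simp add: s)
  qed auto
  then show ?thesis
    using sum_map_flip[of "\<lambda>\<sigma>. F \<sigma> * local_op (gauge_weight x) F \<sigma>"] by (simp add: ip_def)
qed

lemma unturn_pow_length:
  assumes "length \<sigma> = N"
  shows "(unturn ^^ N) \<sigma> = map flip \<sigma>"
  using unturn_pow_append[of "map flip \<sigma>" "[]"] assms by simp

text \<open>Summing over two periods restores the invariance under \<open>turn\<close>, whose N-th power is the spin reversal.\<close>

lemma ip_chain_op_double:
  "2 * ip N g (chain_op (gauge_weight x) N g)
    = (\<Sum>j<2 * N. ip N (\<lambda>\<tau>. g ((unturn ^^ j) \<tau>)) (local_op (gauge_weight x) (\<lambda>\<tau>. g ((unturn ^^ j) \<tau>))))"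
proof -
  define X where "X j = ip N (\<lambda>\<tau>. g ((unturn ^^ j) \<tau>)) (local_op (gauge_weight x) (\<lambda>\<tau>. g ((unturn ^^ j) \<tau>)))" for j
  have agree: "local_op h F \<sigma> = local_op h F' \<sigma>"
    if "\<And>\<tau>. \<tau> \<in> words N \<Longrightarrow> F \<tau> = F' \<tau>" "\<sigma> \<in> words N" for h F F' \<sigma>
    using that by (cases "(h, F, \<sigma>)" rule: local_op.cases) (auto simp: words_def)
  \<comment> \<open>N further rotations are a spin reversal, under which \<open>gauge_weight\<close>
    is invariant.\<close>
  have period: "X (N + j) = X j" for j
  proof -
    have "X (N + j) = ip N (\<lambda>\<tau>. g ((unturn ^^ j) (map flip \<tau>)))
        (local_op (gauge_weight x) (\<lambda>\<tau>. g ((unturn ^^ j) (map flip \<tau>))))"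
      unfolding X_def ip_def
    proof (intro sum.cong refl arg_cong2[of _ _ _ _ "(*)"] agree)
      show "g ((unturn ^^ (N + j)) \<tau>) = g ((unturn ^^ j) (map flip \<tau>))" if "\<tau> \<in> words N" for \<tau>
        using that unturn_pow_length[of \<tau> N] by (simp add: add.commute[of N] funpow_add words_def)
      then show "g ((unturn ^^ (N + j)) \<tau>) = g ((unturn ^^ j) (map flip \<tau>))" if "\<tau> \<in> words N" for \<tau>
        using that by blast
    qed
    then show ?thesis
      unfolding X_def by (simp only: ip_local_op_map_flip[of N "\<lambda>\<tau>. g ((unturn ^^ j) \<tau>)"])
  qed
  have split: "(\<Sum>j<N + k. X j) = (\<Sum>j<N. X j) + (\<Sum>j<k. X (N + j))" for k
    by (induction k) simp_all
  have "(\<Sum>j<2 * N. X j) = 2 * (\<Sum>j<N. X j)"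
    unfolding mult_2 split period ..
  then show ?thesis
    by (simp add: ip_chain_op X_def)
qed

text \<open>The root of the summed squares over all rotations is rotation invariant, so with gauge
  signs it lies in the sector where the energy is a sum of squares; its energy bounds that of
  \<open>g\<close> from below.\<close>

lemma chain_op_nonneg:
  assumes N: "N = Suc (Suc M)" and g: "\<And>\<sigma>. \<sigma> \<notin> even_words N \<Longrightarrow> g \<sigma> = 0"
  shows "ip N g (chain_op (gauge_weight x) N g) \<ge> 0"
proof -
  \<comment> \<open>The range is a full period of the rotation: 2 N steps, since N steps only give
    the spin reversal.\<close>
  define G where "G \<sigma> = sqrt (\<Sum>j<2 * N. (g ((unturn ^^ j) \<sigma>))\<^sup>2)" for \<sigma>
  define f where "f \<sigma> = gauge_sign N x \<sigma> * G \<sigma>" for \<sigma>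
  have G0: "G \<sigma> = 0" if "\<sigma> \<notin> even_words N" for \<sigma>
    using that by (simp add: G_def g even_words_def)
  have turn_G: "G (turn \<sigma>) = G \<sigma>" if "\<sigma> \<in> words N" for \<sigma>
  proof -
    define y where "y j = (g ((unturn ^^ j) (turn \<sigma>)))\<^sup>2" for j
    have "(unturn ^^ (2 * N)) (turn \<sigma>) = turn \<sigma>"
      using that by (simp add: mult_2 funpow_add unturn_pow_length words_def)
    then have "y (2 * N) = y 0"
      by (simp add: y_def)
    then have "(\<Sum>j<2 * N. y j) = (\<Sum>j<2 * N. y (Suc j))"
      using sum.lessThan_Suc_shift[of y "2 * N"] sum.lessThan_Suc[of y "2 * N"] by simp
    moreover have "y (Suc j) = (g ((unturn ^^ j) \<sigma>))\<^sup>2" for j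
      by (simp add: y_def funpow_swap1)
    ultimately show ?thesis
      by (simp add: G_def y_def)
  qed
  have tw: "twist_inv N f"
    unfolding twist_inv_def
  proof
    fix \<sigma> assume s: "\<sigma> \<in> words N"
    show "f (turn \<sigma>) = (-1) ^ N * f \<sigma>"
    proof (cases "\<sigma> \<in> even_words N")
      case True
      then show ?thesis
        by (simp add: f_def gauge_sign_turn turn_G[OF s])
    next
      case False
      then show ?thesis
        by (simp add: f_def turn_G[OF s] G0)
    qed
  qed
  have "0 \<le> ip N f (local_op (chain_weight x) f)"
    unfolding ip_local_op[OF tw N] by (simp add: ip_def sum_nonneg)
  also have "\<dots> = ip N G (local_op (gauge_weight x) G)"
    unfolding ip_def
  proof (intro sum.cong refl)
    fix \<sigma> assume "\<sigma> \<in> words N"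
    show "f \<sigma> * local_op (chain_weight x) f \<sigma> = G \<sigma> * local_op (gauge_weight x) G \<sigma>"
    proof (cases "even (zeros \<sigma>)")
      case True
      then show ?thesis
        unfolding f_def[abs_def] local_op_gauge_sign[OF True] by simp
    next
      case False
      then show ?thesis
        by (simp add: f_def G0 even_words_def)
    qed
  qed
  also have "\<dots> \<le> (\<Sum>j<2 * N. ip N (\<lambda>\<tau>. g ((unturn ^^ j) \<tau>)) (local_op (gauge_weight x) (\<lambda>\<tau>. g ((unturn ^^ j) \<tau>))))"
    by (rule gauge_form_mono[OF N]) (simp_all add: G_def sum_nonneg)
  also have "\<dots> = 2 * ip N g (chain_op (gauge_weight x) N g)"
    by (rule ip_chain_op_double[symmetric])
  finally show ?thesis
    by simp
qed

lemma chain_op_commute: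
  assumes "\<And>a b c d. h a b c d = h c d a b" "N = Suc (Suc M)"
  shows "ip N r (chain_op h N g) = ip N g (chain_op h N r)"
  unfolding ip_chain_op
  by (intro sum.cong refl ip_local_op_commute[OF assms])

text \<open>A state of energy zero minimises a non-negative form, so the first variation
  \<open>b\<close> in the direction of each basis vector vanishes.\<close>

lemma chain_op_null:
  assumes N: "N = Suc (Suc M)" and g: "\<And>\<sigma>. \<sigma> \<notin> even_words N \<Longrightarrow> g \<sigma> = 0"
    and null: "ip N g (chain_op (gauge_weight x) N g) \<le> 0" and s: "\<sigma> \<in> even_words N"
  shows "chain_op (gauge_weight x) N g \<sigma> = 0"
proof -
  let ?H = "chain_op (gauge_weight x) N"
  define \<delta> where "\<delta> \<tau> = (if \<tau> = \<sigma> then 1 else 0 :: real)" for \<tau>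
  define b where "b = ip N \<delta> (?H g)"
  define C where "C = ip N \<delta> (?H \<delta>)"
  have nonneg: "0 \<le> 2 * t * b + t\<^sup>2 * C" for t
  proof -
    have "0 \<le> ip N (\<lambda>\<tau>. g \<tau> + t * \<delta> \<tau>) (?H (\<lambda>\<tau>. g \<tau> + t * \<delta> \<tau>))"
      using g s by (intro chain_op_nonneg[OF N]) (auto simp: \<delta>_def)
    also have "\<dots> = ip N g (?H g) + t * ip N g (?H \<delta>) + t * b + t * t * C"
      by (simp add: chain_op_add chain_op_cmult ip_def b_def C_def sum.distrib sum_distrib_left algebra_simps)
    also have "ip N g (?H \<delta>) = b"
      unfolding b_def by (rule chain_op_commute[OF gauge_weight_sym N])
    finally show ?thesis
      using null by (simp add: power2_eq_square algebra_simps)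
  qed
  have "C \<ge> 0"
    unfolding C_def using s by (intro chain_op_nonneg[OF N]) (auto simp: \<delta>_def)
  have "b = 0"
  proof (rule ccontr)
    assume "b \<noteq> 0"
    \<comment> \<open>With t = -k the bound becomes -k^2 * (C + 2), which is negative; the 1 in the
      denominator covers C = 0.\<close>
    define k where "k = b / (C + 1)"
    have b: "b = k * (C + 1)" "k \<noteq> 0"
      using \<open>b \<noteq> 0\<close> \<open>C \<ge> 0\<close> by (auto simp: k_def)
    have "0 \<le> - (k\<^sup>2 * (C + 2))"
      using nonneg[of "- k"] unfolding b(1) by (simp add: power2_eq_square algebra_simps)
    moreover have "k\<^sup>2 * (C + 2) > 0"
      using b(2) \<open>C \<ge> 0\<close> by simp
    ultimately show False
      by simp
  qed
  moreover have "b = ?H g \<sigma>"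
  proof -
    have "b = (\<Sum>\<tau>\<in>words N. if \<tau> = \<sigma> then ?H g \<tau> else 0)"
      unfolding b_def ip_def \<delta>_def by (intro sum.cong) auto
    then show ?thesis
      using s by (simp add: even_words_def)
  qed
  ultimately show ?thesis
    by simp
qed

text \<open>The absolute value is the one-term case of \<open>gauge_form_mono\<close>: the energy
  does not increase, hence it stays zero.\<close>

lemma chain_op_abs:
  assumes N: "N = Suc (Suc M)" and g: "\<And>\<sigma>. \<sigma> \<notin> even_words N \<Longrightarrow> g \<sigma> = 0"
    and ker: "\<And>\<sigma>. \<sigma> \<in> even_words N \<Longrightarrow> chain_op (gauge_weight x) N g \<sigma> = 0" and s: "\<sigma> \<in> even_words N"
  shows "chain_op (gauge_weight x) N (\<lambda>\<sigma>. \<bar>g \<sigma>\<bar>) \<sigma> = 0"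
proof (rule chain_op_null[OF N _ _ s])
  have "ip N (\<lambda>\<sigma>. \<bar>g \<sigma>\<bar>) (chain_op (gauge_weight x) N (\<lambda>\<sigma>. \<bar>g \<sigma>\<bar>)) \<le> ip N g (chain_op (gauge_weight x) N g)"
    unfolding ip_chain_op
  proof (rule sum_mono)
    fix j
    show "ip N (\<lambda>\<tau>. \<bar>g ((unturn ^^ j) \<tau>)\<bar>) (local_op (gauge_weight x) (\<lambda>\<tau>. \<bar>g ((unturn ^^ j) \<tau>)\<bar>))
        \<le> ip N (\<lambda>\<tau>. g ((unturn ^^ j) \<tau>)) (local_op (gauge_weight x) (\<lambda>\<tau>. g ((unturn ^^ j) \<tau>)))"
      using gauge_form_mono[OF N, of "{()}" "\<lambda>_ \<tau>. g ((unturn ^^ j) \<tau>)" "\<lambda>\<tau>. \<bar>g ((unturn ^^ j) \<tau>)\<bar>" x]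
      by simp
  qed
  also have "\<dots> = 0"
    unfolding ip_def
  proof (intro sum.neutral ballI)
    fix \<sigma>
    show "g \<sigma> * chain_op (gauge_weight x) N g \<sigma> = 0"
      using g ker by (cases "\<sigma> \<in> even_words N") auto
  qed
  finally show "ip N (\<lambda>\<sigma>. \<bar>g \<sigma>\<bar>) (chain_op (gauge_weight x) N (\<lambda>\<sigma>. \<bar>g \<sigma>\<bar>)) \<le> 0" .
qed (simp add: g)

lemma chain_op_odd:
  assumes "\<And>a b c d. chain_weight x a b c d = 0 \<Longrightarrow> h a b c d = 0"
    and "\<And>\<sigma>. odd (zeros \<sigma>) \<Longrightarrow> f \<sigma> = 0" "odd (zeros \<sigma>)"
  shows "chain_op h N f \<sigma> = 0"
  unfolding chain_op_def
proof (rule sum.neutral, rule ballI)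
  fix j
  show "local_op h (\<lambda>\<tau>. f ((unturn ^^ j) \<tau>)) ((turn ^^ j) \<sigma>) = 0"
    by (rule local_op_parity[of x]) (simp_all add: assms)
qed

text \<open>For the harmonic state only the energy is known to vanish. Positivity in the gauge
  without translation invariance makes it a minimiser, hence a kernel vector.\<close>

lemma kernel_state_exists:
  assumes N: "N = Suc (Suc M)"
  obtains h where "twist_inv N h" "\<And>\<sigma>. \<sigma> \<notin> even_words N \<Longrightarrow> h \<sigma> = 0" "\<exists>\<sigma>. h \<sigma> \<noteq> 0"
    "\<And>\<sigma>. \<sigma> \<in> words N \<Longrightarrow> chain_op (chain_weight x) N h \<sigma> = 0"
proof (rule harmonic_state_exists[OF N, where x = x])
  fix h assume h: "twist_inv N h" "\<And>\<sigma>. \<sigma> \<notin> even_words N \<Longrightarrow> h \<sigma> = 0" "\<exists>\<sigma>. h \<sigma> \<noteq> 0"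
    "ip N h (local_op (chain_weight x) h) = 0"
  define g where "g \<sigma> = gauge_sign N x \<sigma> * h \<sigma>" for \<sigma>
  have hg: "h = (\<lambda>\<tau>. gauge_sign N x \<tau> * g \<tau>)"
    by (simp add: g_def)
  have op: "chain_op (chain_weight x) N h \<sigma> = gauge_sign N x \<sigma> * chain_op (gauge_weight x) N g \<sigma>"
    if "\<sigma> \<in> even_words N" for \<sigma>
    unfolding hg by (rule chain_op_gauge_sign[OF that])
  have h_unturn: "h ((unturn ^^ j) \<sigma>) = (-1) ^ (N * j) * h \<sigma>" if "\<sigma> \<in> words N" for j \<sigma>
    using twist_inv_pow[OF h(1), of "(unturn ^^ j) \<sigma>" j] that by (simp add: minus_one_power_iff)
  have "ip N g (chain_op (gauge_weight x) N g) = ip N h (chain_op (chain_weight x) N h)"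
    unfolding ip_def
  proof (intro sum.cong refl)
    fix \<sigma>
    show "g \<sigma> * chain_op (gauge_weight x) N g \<sigma> = h \<sigma> * chain_op (chain_weight x) N h \<sigma>"
      using op[of \<sigma>] h(2)[of \<sigma>] by (cases "\<sigma> \<in> even_words N") (simp_all add: g_def mult_ac)
  qed
  \<comment> \<open>By twisted invariance every bond contributes the same form; the sign (-1)^(N *
    j) occurs twice.\<close>
  also have "\<dots> = (\<Sum>j<N. ip N h (local_op (chain_weight x) h))"
    unfolding ip_chain_op
  proof (intro sum.cong refl)
    fix j
    have l: "local_op (chain_weight x) (\<lambda>\<tau>. h ((unturn ^^ j) \<tau>)) \<sigma> = (-1) ^ (N * j) * local_op (chain_weight x) h \<sigma>"
      if "\<sigma> \<in> even_words N" for \<sigma>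
      unfolding local_op_cmult[symmetric]
      by (rule local_op_cong[OF _ that]) (simp add: h_unturn even_words_def)
    show "ip N (\<lambda>\<tau>. h ((unturn ^^ j) \<tau>)) (local_op (chain_weight x) (\<lambda>\<tau>. h ((unturn ^^ j) \<tau>)))
        = ip N h (local_op (chain_weight x) h)"
      unfolding ip_def
    proof (intro sum.cong refl)
      fix \<sigma> assume "\<sigma> \<in> words N"
      then show "h ((unturn ^^ j) \<sigma>) * local_op (chain_weight x) (\<lambda>\<tau>. h ((unturn ^^ j) \<tau>)) \<sigma>
          = h \<sigma> * local_op (chain_weight x) h \<sigma>"
        using l[of \<sigma>] h(2)[of \<sigma>] by (cases "\<sigma> \<in> even_words N") (simp_all add: h_unturn minus_one_power_iff)
    qed
  qed
  finally have null: "ip N g (chain_op (gauge_weight x) N g) = 0"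
    by (simp add: h(4))
  have "chain_op (chain_weight x) N h \<sigma> = 0" if "\<sigma> \<in> words N" for \<sigma>
  proof (cases "\<sigma> \<in> even_words N")
    case True
    then show ?thesis
      using op[OF True] chain_op_null[OF N _ _ True, of g x] null by (simp add: g_def h(2))
  next
    case False
    then have "odd (zeros \<sigma>)"
      using that by (simp add: even_words_def)
    then show ?thesis
      by (intro chain_op_odd[of x]) (simp_all add: h(2) even_words_def)
  qed
  with h(1-3) show thesis
    by (rule that)
qed

section \<open>The Hamiltonian in the tensor basis\<close>

lemma site_op_append: "site_op (length u) A \<phi> (u @ a # v) = (\<Sum>t\<in>UNIV. A $ a $ t * \<phi> (u @ t # v))"
  by (simp add: site_op_def nth_append list_update_append)

lemma site_op_append_Suc: "site_op (Suc (length u)) A \<phi> (u @ c # b # v) = (\<Sum>t\<in>UNIV. A $ b $ t * \<phi> (u @ c # t # v))"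
  using site_op_append[of "u @ [c]" A \<phi> b v] by simp

lemma spin_matrix_entries:
  fixes r :: complex
  defines "r \<equiv> complex_of_real (1 / sqrt 2)"
  shows "spin_matrix 1 $ 1 $ 1 = 0" "spin_matrix 1 $ 1 $ 2 = r" "spin_matrix 1 $ 1 $ 3 = 0"
    "spin_matrix 1 $ 2 $ 1 = r" "spin_matrix 1 $ 2 $ 2 = 0" "spin_matrix 1 $ 2 $ 3 = r"
    "spin_matrix 1 $ 3 $ 1 = 0" "spin_matrix 1 $ 3 $ 2 = r" "spin_matrix 1 $ 3 $ 3 = 0"
    "spin_matrix 2 $ 1 $ 1 = 0" "spin_matrix 2 $ 1 $ 2 = - (r * \<i>)" "spin_matrix 2 $ 1 $ 3 = 0"
    "spin_matrix 2 $ 2 $ 1 = r * \<i>" "spin_matrix 2 $ 2 $ 2 = 0" "spin_matrix 2 $ 2 $ 3 = - (r * \<i>)"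
    "spin_matrix 2 $ 3 $ 1 = 0" "spin_matrix 2 $ 3 $ 2 = r * \<i>" "spin_matrix 2 $ 3 $ 3 = 0"
    "spin_matrix 3 $ 1 $ 1 = 1" "spin_matrix 3 $ 1 $ 2 = 0" "spin_matrix 3 $ 1 $ 3 = 0"
    "spin_matrix 3 $ 2 $ 1 = 0" "spin_matrix 3 $ 2 $ 2 = 0" "spin_matrix 3 $ 2 $ 3 = 0"
    "spin_matrix 3 $ 3 $ 1 = 0" "spin_matrix 3 $ 3 $ 2 = 0" "spin_matrix 3 $ 3 $ 3 = - 1"
  by (simp_all add: spin_matrix_def vector_3 r_def scaleR_conv_of_real[where 'a = complex] del: of_real_divide)

text \<open>The twist is conjugation by the spin reversal; this justifies the flip in
  \<open>turn\<close>.\<close>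

lemma twist_sign_spin_matrix:
  "twist_sign s * spin_matrix s $ b $ d = spin_matrix s $ flip b $ flip d"
  using exhaust_3[of s] exhaust_3[of b] exhaust_3[of d]
  by (elim disjE) (simp_all add: spin_matrix_entries twist_sign_def)

definition bond_op :: "real \<Rightarrow> 3 \<Rightarrow> 3 \<Rightarrow> (3 \<Rightarrow> 3 \<Rightarrow> complex) \<Rightarrow> complex" where
  "bond_op x a b \<Phi> =
     (\<Sum>s\<in>UNIV. complex_of_real (coupling_J x s) *
        ((\<Sum>c\<in>UNIV. spin_matrix s $ a $ c * (\<Sum>d\<in>UNIV. spin_matrix s $ b $ d * \<Phi> c d))
          + 2 * (\<Sum>c\<in>UNIV. spin_matrix s $ a $ c * (\<Sum>e\<in>UNIV. spin_matrix s $ c $ e * \<Phi> e b))))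
     - (\<Sum>s\<in>UNIV. \<Sum>t\<in>UNIV. complex_of_real (coupling_A x s t) *
        (\<Sum>c\<in>UNIV. spin_matrix s $ a $ c * (\<Sum>e\<in>UNIV. spin_matrix t $ c $ e *
          (\<Sum>d\<in>UNIV. spin_matrix s $ b $ d * (\<Sum>f\<in>UNIV. spin_matrix t $ d $ f * \<Phi> e f)))))"

text \<open>The telescoping difference between the summand of the Hamiltonian and \<open>chain_weight\<close>.\<close>

definition edge_term :: "real \<Rightarrow> 3 \<Rightarrow> real" where
  "edge_term x a = (if a = 2 then 1 else x\<^sup>2 / 4)"

lemma couplings:
  "coupling_J x 1 = 1" "coupling_J x 2 = 1" "coupling_J x 3 = (x\<^sup>2 - 2) / 2"
  "coupling_A x 1 1 = 1" "coupling_A x 2 2 = 1" "coupling_A x 3 3 = (x\<^sup>2 - 2) / 2"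
  "coupling_A x 1 2 = 1" "coupling_A x 2 1 = 1" "coupling_A x 1 3 = x - 1" "coupling_A x 3 1 = x - 1"
  "coupling_A x 2 3 = x - 1" "coupling_A x 3 2 = x - 1"
  by (simp_all add: coupling_J_def coupling_A_def doubleton_eq_iff)

lemma bond_op_eq:
  "bond_op x a b \<Phi> = (\<Sum>c\<in>UNIV. \<Sum>d\<in>UNIV. complex_of_real (chain_weight x a b c d) * \<Phi> c d)
    + complex_of_real (edge_term x a - edge_term x b) * \<Phi> a b"
proof -
  define r where "r = complex_of_real (1 / sqrt 2)"
  have rr: "r * r = 1 / 2"
    unfolding r_def by (simp flip: of_real_mult)
  have rr': "r * (r * y) = y / 2" for y
    by (simp add: rr flip: mult.assoc)
  have ii: "\<i> * (\<i> * y) = - y" for y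
    by (simp flip: mult.assoc)
  show ?thesis
    using exhaust_3[of a] exhaust_3[of b]
    by (elim disjE; hypsubst;
        simp only: bond_op_def sum_letters spin_matrix_entries[folded r_def] couplings
          mult_zero_left mult_zero_right add_0_left add_0_right mult_1_left mult_1_right mult_minus_left mult_minus_right
          chain_weight_def edge_term_def three_distinct flip_simps simp_thms if_True if_False of_real_0 of_real_1 diff_self;
        simp add: algebra_simps rr rr' ii power2_eq_square add_divide_distrib diff_divide_distrib)
qed

section \<open>Bonds of the twisted chain as rotated first bonds\<close>

lemma turn_pow_word:
  assumes "\<sigma> \<in> words (Suc (Suc M))"
  obtains a b w where "(turn ^^ j) \<sigma> = a # b # w" "length w = M"
proof -
  have "(turn ^^ j) \<sigma> \<in> words (Suc (Suc M))"
    using assms by simp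
  then show ?thesis
    using that by (rule word_Suc_Suc)
qed

text \<open>Each bond ends on the letter where the next one begins. After N rotations the first
  letter returns flipped, with the same value of \<open>\<epsilon>\<close>.\<close>

lemma sum_edge_telescope:
  assumes "\<sigma> \<in> words (Suc (Suc M))" and flip: "\<And>a. \<epsilon> (flip a) = (\<epsilon> a :: real)"
  shows "(\<Sum>j<Suc (Suc M). \<epsilon> ((turn ^^ j) \<sigma> ! 0) - \<epsilon> ((turn ^^ j) \<sigma> ! 1)) = 0"
proof -
  have "(turn ^^ j) \<sigma> ! 1 = (turn ^^ Suc j) \<sigma> ! 0" for j
  proof -
    obtain a b w where "(turn ^^ j) \<sigma> = a # b # w" "length w = M"
      using assms(1) by (rule turn_pow_word)
    then show ?thesis
      by simp
  qed
  then have "(\<Sum>j<Suc (Suc M). \<epsilon> ((turn ^^ j) \<sigma> ! 0) - \<epsilon> ((turn ^^ j) \<sigma> ! 1))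
      = (\<Sum>j<Suc (Suc M). \<epsilon> ((turn ^^ j) \<sigma> ! 0) - \<epsilon> ((turn ^^ Suc j) \<sigma> ! 0))"
    by simp
  also have "\<dots> = \<epsilon> ((turn ^^ 0) \<sigma> ! 0) - \<epsilon> ((turn ^^ Suc (Suc M)) \<sigma> ! 0)"
    by (rule sum_lessThan_telescope')
  also have "(turn ^^ Suc (Suc M)) \<sigma> = map flip \<sigma>"
    using turn_pow_length[of \<sigma>] assms(1) by (simp add: words_def del: funpow.simps)
  also have "\<epsilon> ((turn ^^ 0) \<sigma> ! 0) - \<epsilon> (map flip \<sigma> ! 0) = 0"
    using assms(1) flip by (simp add: words_def nth_map)
  finally show ?thesis .
qed

definition bond_summand :: "nat \<Rightarrow> real \<Rightarrow> nat \<Rightarrow> state \<Rightarrow> state" where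
  "bond_summand N x j \<phi> =
     (\<Sum>a\<in>UNIV. complex_of_real (coupling_J x a) \<bullet>\<^sub>v
         (spin_op N a j (spin_op N a (Suc j) \<phi>) + 2 \<bullet>\<^sub>v spin_op N a j (spin_op N a j \<phi>)))
       - (\<Sum>a\<in>UNIV. \<Sum>b\<in>UNIV. complex_of_real (coupling_A x a b) \<bullet>\<^sub>v
           spin_op N a j (spin_op N b j (spin_op N a (Suc j) (spin_op N b (Suc j) \<phi>))))"

lemma bond_summand_eq:
  assumes "\<sigma> \<in> words N" "N = Suc (Suc M)" "j < N" "(turn ^^ j) \<sigma> = a # b # w"
  shows "bond_summand N x j \<phi> \<sigma> = bond_op x a b (\<lambda>c d. \<phi> ((unturn ^^ j) (c # d # w)))"
proof (cases "Suc j < N")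
  case True
  then have "\<sigma> \<in> words (j + Suc (Suc (N - 2 - j)))"
    using assms(1,2) by simp
  then obtain u v where uv: "\<sigma> = u @ v" "length u = j" "length v = Suc (Suc (N - 2 - j))"
    by (rule word_split)
  from uv(3) obtain a' b' v' where v: "v = a' # b' # v'"
    by (auto simp: length_Suc_conv)
  have "(turn ^^ j) \<sigma> = a' # b' # v' @ map flip u"
    using turn_pow_append[of u v] uv v by simp
  with assms(4) have eqs: "a' = a" "b' = b" "w = v' @ map flip u"
    by simp_all
  have s: "\<sigma> = u @ a # b # v'" "length u = j"
    using uv v eqs by simp_all
  have un: "(unturn ^^ j) (c # d # w) = u @ c # d # v'" for c d
    using unturn_pow_append[of u "c # d # v'"] s(2) eqs by simp
  have j: "spin_op N k j = site_op j (spin_matrix k)" "spin_op N k (Suc j) = site_op (Suc j) (spin_matrix k)" for k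
    using True by (auto simp: spin_op_def fun_eq_iff)
  show ?thesis
    unfolding bond_summand_def j bond_op_def un
    by (simp add: sum_fun_apply vscale_def s(1) site_op_append[of u, unfolded s(2)] site_op_append_Suc[of u, unfolded s(2)])
next
  \<comment> \<open>The last bond joins site N - 1 to position N, the twisted copy of site
    0.\<close>
  case False
  then have j: "j = Suc M"
    using assms(2,3) by simp
  have "\<sigma> \<in> words (Suc (Suc M))"
    using assms(1,2) by simp
  then obtain u a' where ua: "\<sigma> = u @ [a']" "length u = Suc M"
    by (rule word_snoc)
  from ua(2) obtain b' v where u: "u = b' # v" "length v = M"
    by (auto simp: length_Suc_conv)
  have "(turn ^^ j) \<sigma> = a' # flip b' # map flip v"
    using turn_pow_append[of u "[a']"] ua u j by simp
  with assms(4) have eqs: "a' = a" "b = flip b'" "w = map flip v"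
    by simp_all
  have s: "\<sigma> = b' # v @ [a]"
    using ua u eqs by simp
  have un: "(unturn ^^ j) (c # d # w) = flip d # v @ [c]" for c d
    using unturn_pow_append[of "flip d # v" "[c]"] u j eqs by simp
  have j_op: "spin_op N k j = site_op j (spin_matrix k)" for k
    using j assms(2) by (auto simp: spin_op_def fun_eq_iff)
  \<comment> \<open>The twist sign is absorbed by flipping both indices of the spin matrix, so the
    bond acts on the flipped first letter.\<close>
  have wrap_op: "spin_op N k (Suc j) \<psi> (b # v @ [c]) = (\<Sum>d\<in>UNIV. spin_matrix k $ flip b $ d * \<psi> (flip d # v @ [c]))"
    for k \<psi> b c
  proof -
    have "spin_op N k (Suc j) \<psi> (b # v @ [c]) = (\<Sum>d\<in>UNIV. (twist_sign k * spin_matrix k $ b $ d) * \<psi> (d # v @ [c]))"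
      using j assms(2) site_op_append[of "[]" "spin_matrix k" \<psi> b "v @ [c]"]
      by (simp add: spin_op_def vscale_def sum_distrib_left mult_ac)
    also have "\<dots> = (\<Sum>d\<in>UNIV. spin_matrix k $ flip b $ flip d * \<psi> (d # v @ [c]))"
      by (simp only: twist_sign_spin_matrix)
    also have "\<dots> = (\<Sum>d\<in>UNIV. spin_matrix k $ flip b $ d * \<psi> (flip d # v @ [c]))"
      using sum_flip[of "\<lambda>d. spin_matrix k $ flip b $ d * \<psi> (flip d # v @ [c])"] by simp
    finally show ?thesis .
  qed
  have last_op: "site_op j A \<psi> (b # v @ [a]) = (\<Sum>c\<in>UNIV. A $ a $ c * \<psi> (b # v @ [c]))" for A \<psi> b a
    using site_op_append[of "b # v" A \<psi> a "[]"] u(2) j by simp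
  show ?thesis
    unfolding bond_summand_def j_op bond_op_def un
    by (simp add: sum_fun_apply vscale_def s wrap_op last_op eqs)
qed

lemma hamiltonian_eq_sum:
  assumes "\<sigma> \<in> words N" "N = Suc (Suc M)"
  shows "hamiltonian N x \<phi> \<sigma> = (\<Sum>j<N. \<Sum>c\<in>UNIV. \<Sum>d\<in>UNIV.
      complex_of_real (chain_weight x ((turn ^^ j) \<sigma> ! 0) ((turn ^^ j) \<sigma> ! 1) c d)
        * \<phi> ((unturn ^^ j) (c # d # drop 2 ((turn ^^ j) \<sigma>))))"
proof -
  let ?e = "\<lambda>j. edge_term x ((turn ^^ j) \<sigma> ! 0) - edge_term x ((turn ^^ j) \<sigma> ! 1)"
  have "bond_summand N x j \<phi> \<sigma> = (\<Sum>c\<in>UNIV. \<Sum>d\<in>UNIV.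
      complex_of_real (chain_weight x ((turn ^^ j) \<sigma> ! 0) ((turn ^^ j) \<sigma> ! 1) c d)
        * \<phi> ((unturn ^^ j) (c # d # drop 2 ((turn ^^ j) \<sigma>)))) + complex_of_real (?e j) * \<phi> \<sigma>"
    if "j < N" for j
  proof -
    obtain a b w where t: "(turn ^^ j) \<sigma> = a # b # w" "length w = M"
      using assms(1) unfolding assms(2) by (rule turn_pow_word)
    have "\<phi> ((unturn ^^ j) (a # b # w)) = \<phi> \<sigma>"
      using unturn_turn_pow[of j \<sigma>] unfolding t(1) by simp
    then show ?thesis
      using bond_summand_eq[OF assms that t(1), of x \<phi>] by (simp add: bond_op_eq t)
  qed
  then have "hamiltonian N x \<phi> \<sigma> = (\<Sum>j<N. (\<Sum>c\<in>UNIV. \<Sum>d\<in>UNIV.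
      complex_of_real (chain_weight x ((turn ^^ j) \<sigma> ! 0) ((turn ^^ j) \<sigma> ! 1) c d)
        * \<phi> ((unturn ^^ j) (c # d # drop 2 ((turn ^^ j) \<sigma>)))) + complex_of_real (?e j) * \<phi> \<sigma>)"
    unfolding hamiltonian_def bond_summand_def[symmetric] sum_fun_apply by (intro sum.cong refl) simp
  moreover have "(\<Sum>j<N. complex_of_real (?e j) * \<phi> \<sigma>) = complex_of_real (\<Sum>j<N. ?e j) * \<phi> \<sigma>"
    by (simp only: of_real_sum sum_distrib_right)
  moreover have "(\<Sum>j<N. ?e j) = 0"
    unfolding assms(2)
    by (rule sum_edge_telescope) (use assms in \<open>auto simp: edge_term_def\<close>)
  ultimately show ?thesis
    by (simp only: sum.distrib) simp
qed

lemma chain_op_eq_sum: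
  assumes "\<sigma> \<in> words N" "N = Suc (Suc M)"
  shows "chain_op h N f \<sigma> = (\<Sum>j<N. \<Sum>c\<in>UNIV. \<Sum>d\<in>UNIV.
      h ((turn ^^ j) \<sigma> ! 0) ((turn ^^ j) \<sigma> ! 1) c d
        * f ((unturn ^^ j) (c # d # drop 2 ((turn ^^ j) \<sigma>))))"
  unfolding chain_op_def
proof (intro sum.cong refl)
  fix j
  obtain a b w where t: "(turn ^^ j) \<sigma> = a # b # w" "length w = M"
    using assms(1) unfolding assms(2) by (rule turn_pow_word)
  show "local_op h (\<lambda>\<tau>. f ((unturn ^^ j) \<tau>)) ((turn ^^ j) \<sigma>) = (\<Sum>c\<in>UNIV. \<Sum>d\<in>UNIV.
      h ((turn ^^ j) \<sigma> ! 0) ((turn ^^ j) \<sigma> ! 1) c d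
        * f ((unturn ^^ j) (c # d # drop 2 ((turn ^^ j) \<sigma>))))"
    by (simp add: t)
qed

text \<open>The Hamiltonian has real entries in the tensor basis, so real and imaginary parts
  decouple.\<close>

lemma Re_hamiltonian:
  assumes "\<sigma> \<in> words N" "N = Suc (Suc M)"
  shows "Re (hamiltonian N x \<phi> \<sigma>) = chain_op (chain_weight x) N (\<lambda>\<tau>. Re (\<phi> \<tau>)) \<sigma>"
  unfolding hamiltonian_eq_sum[OF assms] chain_op_eq_sum[OF assms] by simp

lemma Im_hamiltonian:
  assumes "\<sigma> \<in> words N" "N = Suc (Suc M)"
  shows "Im (hamiltonian N x \<phi> \<sigma>) = chain_op (chain_weight x) N (\<lambda>\<tau>. Im (\<phi> \<tau>)) \<sigma>"
  unfolding hamiltonian_eq_sum[OF assms] chain_op_eq_sum[OF assms] by simp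

lemma hamiltonian_state_space:
  assumes "\<phi> \<in> state_space N"
  shows "hamiltonian N x \<phi> \<in> state_space N"
proof -
  have spin: "spin_op N k j \<psi> \<in> state_space N" if "\<psi> \<in> state_space N" for k j \<psi>
    using that by (auto simp: state_space_def spin_op_def site_op_def vscale_def)
  have "hamiltonian N x \<phi> \<sigma> = 0" if s: "length \<sigma> \<noteq> N" for \<sigma>
  proof -
    have z: "\<psi> \<sigma> = 0" if "\<psi> \<in> state_space N" for \<psi>
      using that s by (simp add: state_space_def)
    show ?thesis
      unfolding hamiltonian_def by (simp add: sum_fun_apply vscale_def z spin assms)
  qed
  then show ?thesis
    by (simp add: state_space_def)
qed

section \<open>Uniqueness of the zero-energy state\<close>

text \<open>Adjacent transpositions generate all permutations: letter by letter, the required one is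
  moved into place behind the settled prefix \<open>u\<close>.\<close>

lemma mset_closed_under_swaps:
  assumes swap: "\<And>u a b w. length (u @ a # b # w) = N \<Longrightarrow> P (u @ a # b # w) \<Longrightarrow> P (u @ b # a # w)"
    and "mset \<sigma> = mset \<tau>" "length \<sigma> = N" "P \<sigma>"
  shows "P \<tau>"
proof -
  have move: "P (u @ v @ a # w)" if "P (u @ a # v @ w)" "length (u @ a # v @ w) = N" for u a v w
    using that
  proof (induction v arbitrary: u)
    case (Cons b v)
    have "P ((u @ [b]) @ a # v @ w)"
      using swap[of u a b "v @ w"] Cons.prems by simp
    from Cons.IH[OF this] Cons.prems show ?case
      by simp
  qed simp
  have "P (u @ \<tau>)" if "mset \<sigma> = mset \<tau>" "P (u @ \<sigma>)" "length (u @ \<sigma>) = N" for u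
    using that
  proof (induction \<sigma> arbitrary: \<tau> u)
    case (Cons a \<sigma>)
    then have "a \<in> set \<tau>"
      by (metis list.set_intros(1) mset_eq_setD)
    then obtain v w where t: "\<tau> = v @ a # w"
      by (auto simp: in_set_conv_decomp)
    then have m: "mset \<sigma> = mset (v @ w)"
      using Cons.prems(1) by simp
    have "P ((u @ [a]) @ (v @ w))"
      by (rule Cons.IH[OF m]) (use Cons.prems in simp_all)
    moreover have "length \<sigma> = length (v @ w)"
      using m by (rule mset_eq_length)
    ultimately show ?case
      unfolding t using move[of u a v w] Cons.prems by simp
  qed simp
  from this[of "[]"] assms show ?thesis
    by simp
qed

lemma mset_word_pairE:
  assumes "{#a, b#} \<subseteq># mset \<sigma>"
  obtains w where "mset \<sigma> = mset (a # b # w)" "length \<sigma> = Suc (Suc (length w))"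
proof -
  obtain w where w: "mset w = mset \<sigma> - {#a, b#}"
    using ex_mset by blast
  with assms have "mset \<sigma> = mset w + {#a, b#}"
    by (metis subset_mset.diff_add)
  then have m: "mset \<sigma> = mset (a # b # w)"
    by simp
  from mset_eq_length[OF m] m show ?thesis
    by (intro that) simp_all
qed

lemma repeated_letterE:
  assumes "count_list \<sigma> a \<ge> 2"
  obtains w where "mset \<sigma> = mset (a # a # w)" "length \<sigma> = Suc (Suc (length w))"
proof -
  have "{#a, a#} \<subseteq># mset \<sigma>"
    using assms by (auto simp: subseteq_mset_def simp flip: count_mset)
  then show ?thesis
    using that by (rule mset_word_pairE)
qed

text \<open>The setting of a Perron-Frobenius argument: \<open>p\<close> stands for the absolute
  value of a zero-energy state, and its zeros spread along negative off-diagonal weights.\<close>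

locale zero_set =
  fixes N M :: nat and x :: real and p :: "3 list \<Rightarrow> real"
  assumes N: "N = Suc (Suc M)"
    and nonneg: "p \<sigma> \<ge> 0"
    and odd_zero: "odd (zeros \<sigma>) \<Longrightarrow> p \<sigma> = 0"
    and kernel: "\<sigma> \<in> even_words N \<Longrightarrow> chain_op (gauge_weight x) N p \<sigma> = 0"
begin

text \<open>In the kernel equation at a zero of \<open>p\<close> the diagonal terms vanish and all
  others are non-positive, so each of them is zero.\<close>

lemma neighbour_zero:
  assumes s: "\<sigma> \<in> words N" "even (zeros \<sigma>)" "p \<sigma> = 0" and j: "j < N"
    and t: "(turn ^^ j) \<sigma> = a # b # w" and neg: "gauge_weight x a b c d < 0"
  shows "p ((unturn ^^ j) (c # d # w)) = 0"
proof -
  define X where "X i = local_op (gauge_weight x) (\<lambda>\<tau>. p ((unturn ^^ i) \<tau>)) ((turn ^^ i) \<sigma>)" for i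
  have term_le: "gauge_weight x a b c d * p ((unturn ^^ i) (c # d # w)) \<le> 0"
    if "(turn ^^ i) \<sigma> = a # b # w" for i a b w c d
  proof (cases "c = a \<and> d = b")
    case True
    then have "p ((unturn ^^ i) (c # d # w)) = 0"
      using s(3) unturn_turn_pow[of i \<sigma>] that by simp
    then show ?thesis
      by simp
  next
    case False
    then have "gauge_weight x a b c d \<le> 0"
      unfolding gauge_weight_def if_not_P[OF False] by simp
    then show ?thesis
      using nonneg by (simp add: mult_nonpos_nonneg)
  qed
  have X_le: "X i \<le> 0" for i
  proof -
    obtain a b w where "(turn ^^ i) \<sigma> = a # b # w" "length w = M"
      using s(1) unfolding N by (rule turn_pow_word)
    then show ?thesis
      unfolding X_def using term_le[of i a b w] by (simp add: sum_nonpos)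
  qed
  have "(\<Sum>i<N. - X i) = 0"
    using kernel[of \<sigma>] s by (simp add: chain_op_def X_def even_words_def sum_negf)
  then have "X j = 0"
    using sum_nonneg_eq_0_iff[of "{..<N}" "\<lambda>i. - X i"] X_le j by simp
  then have "(\<Sum>c\<in>UNIV. \<Sum>d\<in>UNIV. - (gauge_weight x a b c d * p ((unturn ^^ j) (c # d # w)))) = 0"
    unfolding X_def t by (simp add: sum_negf)
  then have "(\<Sum>d\<in>UNIV. - (gauge_weight x a b c d * p ((unturn ^^ j) (c # d # w)))) = 0"
    by (subst (asm) sum_nonneg_eq_0_iff) (use term_le[OF t] in \<open>auto intro!: sum_nonneg\<close>)
  then have "- (gauge_weight x a b c d * p ((unturn ^^ j) (c # d # w))) = 0"
    by (subst (asm) sum_nonneg_eq_0_iff) (use term_le[OF t] in auto)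
  then show ?thesis
    using neg by simp
qed

lemma bulk_move:
  assumes "length (u @ a # b # w) = N" "p (u @ a # b # w) = 0" "even (zeros (u @ a # b # w))"
    and neg: "gauge_weight x a b c d < 0"
  shows "p (u @ c # d # w) = 0"
proof -
  have "(turn ^^ length u) (u @ a # b # w) = a # b # w @ map flip u"
    using turn_pow_append[of u "a # b # w"] by simp
  moreover have "(unturn ^^ length u) (c # d # w @ map flip u) = u @ c # d # w"
    using unturn_pow_append[of u "c # d # w"] by simp
  ultimately show ?thesis
    using neighbour_zero[of "u @ a # b # w" "length u" a b "w @ map flip u" c d] assms
    by (simp add: words_def)
qed

text \<open>The bond across the end sees the last letter followed by the flip of the first
  one.\<close>

lemma wrap_move:
  assumes "length (a # w @ [b]) = N" "p (a # w @ [b]) = 0" "even (zeros (a # w @ [b]))"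
    and neg: "gauge_weight x b (flip a) c d < 0"
  shows "p (flip d # w @ [c]) = 0"
proof -
  have "(turn ^^ Suc (length w)) (a # w @ [b]) = b # flip a # map flip w"
    using turn_pow_append[of "a # w" "[b]"] by simp
  moreover have "(unturn ^^ Suc (length w)) (c # d # map flip w) = flip d # w @ [c]"
    using unturn_pow_append[of "flip d # w" "[c]"] by simp
  ultimately show ?thesis
    using neighbour_zero[of "a # w @ [b]" "Suc (length w)" b "flip a" "map flip w" c d] assms
    by (simp add: words_def)
qed

lemma gauge_weight_swap: "a \<noteq> b \<Longrightarrow> gauge_weight x a b b a < 0"
  by (auto simp: gauge_weight_def chain_weight_def)

lemma mset_invariant:
  assumes "mset \<sigma> = mset \<tau>" "length \<sigma> = N" "p \<sigma> = 0"
  shows "p \<tau> = 0"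
proof (rule mset_closed_under_swaps[where P = "\<lambda>\<sigma>. p \<sigma> = 0", OF _ assms])
  fix u a b w assume uw: "length (u @ a # b # w) = N" "p (u @ a # b # w) = 0"
  show "p (u @ b # a # w) = 0"
  proof (cases "odd (zeros (u @ a # b # w)) \<or> a = b")
    case True
    moreover have "zeros (u @ b # a # w) = zeros (u @ a # b # w)"
      by auto
    ultimately show ?thesis
      using uw(2) odd_zero[of "u @ b # a # w"] by metis
  next
    case False
    then show ?thesis
      using bulk_move[OF uw] gauge_weight_swap[of a b] by blast
  qed
qed

text \<open>Placed at the two ends, an equal pair a a appears to the wrap bond as a followed by its
  flip. The bond connects this to \<open>1\<close>, \<open>3\<close>, that is to \<open>1\<close> at
  both ends, with weight -|x| for a = \<open>2\<close> and -1 for a = \<open>3\<close>.\<close>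

lemma replace_equal_pair:
  assumes m: "mset \<sigma> = mset (a # a # w)" "length \<sigma> = N" and x: "a = 2 \<Longrightarrow> x \<noteq> 0"
    and ev: "even (zeros (a # a # w))" and zero: "p (1 # w @ [1]) = 0"
  shows "p \<sigma> = 0"
proof -
  have len: "length w = M"
    using mset_eq_length[OF m(1)] m(2) N by simp
  have "p (a # w @ [a]) = 0"
  proof (cases "a = 1")
    case False
    have ev1: "even (zeros (1 # w @ [1]))"
      using ev by (auto split: if_splits)
    have "gauge_weight x 1 (flip 1) a (flip a) < 0"
      using False exhaust_3[of a] x by (auto simp: gauge_weight_def chain_weight_def)
    then have "p (flip (flip a) # w @ [a]) = 0"
      by (intro wrap_move[of 1 w 1] zero ev1) (simp_all add: len N)
    then show ?thesis
      by simp
  qed (use zero in simp)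
  then show ?thesis
    using m len by - (rule mset_invariant[of "a # w @ [a]"], simp_all add: N)
qed

lemma all_up_mset:
  assumes "zeros \<sigma> = 0" "count_list \<sigma> 3 = 0"
  shows "\<sigma> = replicate (length \<sigma>) 1"
proof -
  have "a = 1" if "a \<in> set \<sigma>" for a
    using that assms exhaust_3[of a] by (auto simp: zeros_def count_list_0_iff)
  then show ?thesis
    by (metis replicate_eqI)
qed

text \<open>Letters \<open>3\<close> are traded in pairs for letters \<open>1\<close> until the
  all-up word is reached.\<close>

lemma no_zeros_even_down:
  assumes "p (replicate N 1) = 0" "length \<sigma> = N" "zeros \<sigma> = 0" "even (count_list \<sigma> 3)"
  shows "p \<sigma> = 0"
  using assms(2-4)
proof (induction "count_list \<sigma> 3" arbitrary: \<sigma> rule: less_induct)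
  case less
  show ?case
  proof (cases "count_list \<sigma> 3 = 0")
    case True
    then show ?thesis
      using all_up_mset[of \<sigma>] less.prems assms(1) by simp
  next
    case False
    then have "count_list \<sigma> 3 \<ge> 2"
      using less.prems(3) by presburger
    then obtain w where w: "mset \<sigma> = mset (3 # 3 # w)" "length \<sigma> = Suc (Suc (length w))"
      by (rule repeated_letterE)
    have c: "count_list \<sigma> 3 = Suc (Suc (count_list w 3))" "zeros w = 0"
      using w(1) less.prems(2) by (simp_all add: zeros_def flip: count_mset)
    have "p (1 # w @ [1]) = 0"
      by (rule less.hyps) (use c w less.prems in simp_all)
    then show ?thesis
      using w less.prems c by (intro replace_equal_pair[of \<sigma> 3 w]) simp_all
  qed
qed

text \<open>Induction on the number of letters other than \<open>1\<close>: repeated zeros or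
  repeated \<open>3\<close> are traded for \<open>1\<close> in pairs.\<close>

lemma vanishes_nonzero:
  assumes "x \<noteq> 0" "p (replicate N 1) = 0" "length \<sigma> = N" "even (zeros \<sigma>)"
  shows "p \<sigma> = 0"
  using assms(3-4)
proof (induction "zeros \<sigma> + count_list \<sigma> 3" arbitrary: \<sigma> rule: less_induct)
  case less
  consider "zeros \<sigma> \<ge> 2" | "zeros \<sigma> = 0" "count_list \<sigma> 3 \<noteq> 1" | "zeros \<sigma> = 0" "count_list \<sigma> 3 = 1"
    using less.prems(2) by fastforce
  then show ?case
  proof cases
    case 1
    then obtain w where w: "mset \<sigma> = mset (2 # 2 # w)" "length \<sigma> = Suc (Suc (length w))"
      unfolding zeros_def by (rule repeated_letterE)
    have c: "zeros \<sigma> = Suc (Suc (zeros w))" "count_list \<sigma> 3 = count_list w 3"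
      using w(1) by (simp_all add: zeros_def flip: count_mset)
    have "p (1 # w @ [1]) = 0"
      by (rule less.hyps) (use c w less.prems in simp_all)
    then show ?thesis
      using w less.prems c assms(1) by (intro replace_equal_pair[of \<sigma> 2 w]) simp_all
  next
    case 2
    show ?thesis
    proof (cases "count_list \<sigma> 3 = 0")
      case True
      then show ?thesis
        using all_up_mset[of \<sigma>] 2 less.prems assms(2) by simp
    next
      case False
      then have "count_list \<sigma> 3 \<ge> 2"
        using 2 by simp
      then obtain w where w: "mset \<sigma> = mset (3 # 3 # w)" "length \<sigma> = Suc (Suc (length w))"
        by (rule repeated_letterE)
      have c: "count_list \<sigma> 3 = Suc (Suc (count_list w 3))" "zeros w = 0"
        using w(1) 2 by (simp_all add: zeros_def flip: count_mset)
      have "p (1 # w @ [1]) = 0"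
        by (rule less.hyps) (use c w less.prems in simp_all)
      then show ?thesis
        using w less.prems c by (intro replace_equal_pair[of \<sigma> 3 w]) simp_all
    qed
  next
    \<comment> \<open>A lone \<open>3\<close> cannot be paired. Together with a \<open>1\<close> it
      arises from \<open>2\<close>, \<open>2\<close>, which in turn arises from \<open>1\<close> at
      both ends.\<close>
    case 3
    then have "count_list \<sigma> 1 \<ge> 1"
      using letter_counts[of \<sigma>] less.prems(1) N by simp
    then have "{#1, 3#} \<subseteq># mset \<sigma>"
      using 3 by (auto simp: subseteq_mset_def simp flip: count_mset)
    then obtain w where w: "mset \<sigma> = mset (1 # 3 # w)" "length \<sigma> = Suc (Suc (length w))"
      by (rule mset_word_pairE)
    have c: "zeros w = 0" "count_list w 3 = 0"
      using w(1) 3 by (simp_all add: zeros_def flip: count_mset)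
    have "p (1 # w @ [1]) = 0"
      by (rule less.hyps) (use c w less.prems 3 in simp_all)
    then have "p (2 # 2 # w) = 0"
      using w less.prems c assms(1) by (intro replace_equal_pair[of "2 # 2 # w" 2 w]) simp_all
    then have "p ([] @ 1 # 3 # w) = 0"
      using w less.prems c assms(1)
      by (intro bulk_move[of "[]" 2 2 w 1 3]) (simp_all add: gauge_weight_def chain_weight_def)
    then show ?thesis
      using w less.prems by - (rule mset_invariant[of "1 # 3 # w"], simp_all)
  qed
qed

text \<open>At x = 0 the constant vector is mapped to twice the number of adjacent zero pairs, up to
  telescoping terms. By symmetry its pairing with the kernel vector \<open>p\<close> vanishes, so
  \<open>p\<close> does wherever this number is positive.\<close>

lemma adjacent_zeros_vanish:
  assumes "x = 0" "length w = M"
  shows "p (2 # 2 # w) = 0"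
proof -
  define pairs where "pairs \<sigma> = (\<Sum>j<N. if (turn ^^ j) \<sigma> ! 0 = 2 \<and> (turn ^^ j) \<sigma> ! 1 = 2 then 2 else 0 :: real)" for \<sigma>
  define \<epsilon> where "\<epsilon> a = (if a = 2 then 1 else 0 :: real)" for a :: 3
  have row: "(\<Sum>c\<in>UNIV. \<Sum>d\<in>UNIV. gauge_weight 0 a b c d) = (if a = 2 \<and> b = 2 then 2 else 0) + (\<epsilon> a - \<epsilon> b)" for a b
    using exhaust_3[of a] exhaust_3[of b]
    by (elim disjE) (simp_all add: sum_letters gauge_weight_def chain_weight_def \<epsilon>_def)
  have op1: "chain_op (gauge_weight x) N (\<lambda>_. 1) \<sigma> = pairs \<sigma>" if s: "\<sigma> \<in> words N" for \<sigma>
  proof -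
    have "chain_op (gauge_weight x) N (\<lambda>_. 1) \<sigma> = pairs \<sigma>
        + (\<Sum>j<N. \<epsilon> ((turn ^^ j) \<sigma> ! 0) - \<epsilon> ((turn ^^ j) \<sigma> ! 1))"
      unfolding chain_op_eq_sum[OF s N] pairs_def assms(1) mult_1_right row sum.distrib ..
    also have "(\<Sum>j<N. \<epsilon> ((turn ^^ j) \<sigma> ! 0) - \<epsilon> ((turn ^^ j) \<sigma> ! 1)) = 0"
      unfolding N by (rule sum_edge_telescope) (use s in \<open>simp_all add: N \<epsilon>_def\<close>)
    finally show ?thesis
      by simp
  qed
  have op_p: "chain_op (gauge_weight x) N p \<sigma> = 0" if "\<sigma> \<in> words N" for \<sigma>
  proof (cases "even (zeros \<sigma>)")
    case True
    then show ?thesis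
      using that by (intro kernel) (simp add: even_words_def)
  next
    case False
    then show ?thesis
      by (intro chain_op_odd[of x]) (auto simp: odd_zero gauge_weight_def)
  qed
  have "(\<Sum>\<sigma>\<in>words N. p \<sigma> * pairs \<sigma>) = ip N p (chain_op (gauge_weight x) N (\<lambda>_. 1))"
    by (simp add: ip_def op1)
  also have "\<dots> = ip N (\<lambda>_. 1) (chain_op (gauge_weight x) N p)"
    by (rule chain_op_commute[OF gauge_weight_sym N])
  also have "\<dots> = 0"
    by (simp add: ip_def op_p)
  finally have "(\<Sum>\<sigma>\<in>words N. p \<sigma> * pairs \<sigma>) = 0" .
  moreover have pairs_nonneg: "pairs \<sigma> \<ge> 0" for \<sigma>
    unfolding pairs_def by (intro sum_nonneg) auto
  ultimately have "\<forall>\<sigma>\<in>words N. p \<sigma> * pairs \<sigma> = 0"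
    using sum_nonneg_eq_0_iff[of "words N" "\<lambda>\<sigma>. p \<sigma> * pairs \<sigma>"] nonneg by simp
  moreover have "2 # 2 # w \<in> words N"
    using assms(2) by (simp add: words_def N)
  ultimately have "p (2 # 2 # w) * pairs (2 # 2 # w) = 0"
    by blast
  moreover have "pairs (2 # 2 # w) > 0"
    unfolding pairs_def
  proof (rule sum_pos2[of _ 0])
    show "0 < (if (turn ^^ 0) (2 # 2 # w) ! 0 = 2 \<and> (turn ^^ 0) (2 # 2 # w) ! 1 = 2 then 2 else 0 :: real)"
      by simp
  qed (simp_all add: N)
  ultimately show ?thesis
    by simp
qed

text \<open>Words with two zeros can be rearranged to make them adjacent. Words without zeros fall
  into two classes by the parity of the letters \<open>3\<close>; for odd N the spin reversal maps
  the odd class to that of the all-up word.\<close>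

lemma vanishes_odd:
  assumes "x = 0" "odd N" "p (replicate N 1) = 0" "length \<sigma> = N" "even (zeros \<sigma>)"
    and flip: "\<And>\<sigma>. \<sigma> \<in> words N \<Longrightarrow> p (map flip \<sigma>) = p \<sigma>"
  shows "p \<sigma> = 0"
proof -
  consider "zeros \<sigma> \<ge> 2" | "zeros \<sigma> = 0"
    using assms(5) by fastforce
  then show ?thesis
  proof cases
    case 1
    then obtain w where w: "mset \<sigma> = mset (2 # 2 # w)" "length \<sigma> = Suc (Suc (length w))"
      unfolding zeros_def by (rule repeated_letterE)
    then show ?thesis
      using adjacent_zeros_vanish[OF assms(1), of w] assms(4)
      by - (rule mset_invariant[of "2 # 2 # w"], simp_all add: N)
  next
    case 2
    show ?thesis
    proof (cases "even (count_list \<sigma> 3)")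
      case True
      then show ?thesis
        using no_zeros_even_down[OF assms(3,4) 2] by simp
    next
      case False
      then have "even (count_list (map flip \<sigma>) 3)"
        using letter_counts[of \<sigma>] assms(2,4) 2 unfolding count_list_map_flip by presburger
      then have "p (map flip \<sigma>) = 0"
        using assms(4) 2 by (intro no_zeros_even_down[OF assms(3)]) simp_all
      then show ?thesis
        using flip[of \<sigma>] assms(4) by (simp add: words_def)
    qed
  qed
qed

end

text \<open>In the gauge, the absolute value of \<open>f\<close> is a kernel vector, so the zero at
  the all-up word spreads everywhere.\<close>

lemma kernel_vanishes:
  assumes N: "N = Suc (Suc M)" and sup: "\<And>\<sigma>. \<sigma> \<notin> even_words N \<Longrightarrow> f \<sigma> = 0"
    and ker: "\<And>\<sigma>. \<sigma> \<in> words N \<Longrightarrow> chain_op (chain_weight x) N f \<sigma> = 0"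
    and "flip_sym N f" "f (replicate N 1) = 0" "x \<noteq> 0 \<or> odd N"
  shows "f \<sigma> = 0"
proof (cases "\<sigma> \<in> even_words N")
  case True
  define g where "g \<tau> = gauge_sign N x \<tau> * f \<tau>" for \<tau>
  have fg: "f = (\<lambda>\<tau>. gauge_sign N x \<tau> * g \<tau>)"
    by (simp add: g_def)
  have ker_g: "chain_op (gauge_weight x) N g \<tau> = 0" if t: "\<tau> \<in> even_words N" for \<tau>
  proof -
    have "gauge_sign N x \<tau> * chain_op (gauge_weight x) N g \<tau> = 0"
      using ker[of \<tau>] t unfolding fg chain_op_gauge_sign[OF t] by (simp add: even_words_def)
    then show ?thesis
      using gauge_sign_square[of N x \<tau>] by (metis mult_eq_0_iff zero_neq_one)
  qed
  have g_abs: "(\<lambda>\<tau>. \<bar>g \<tau>\<bar>) = (\<lambda>\<tau>. \<bar>f \<tau>\<bar>)"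
    by (simp add: g_def abs_mult)
  have sup_g: "g \<tau> = 0" if "\<tau> \<notin> even_words N" for \<tau>
    using that by (simp add: g_def sup)
  interpret zero_set N M x "\<lambda>\<tau>. \<bar>f \<tau>\<bar>"
  proof
    show "chain_op (gauge_weight x) N (\<lambda>\<tau>. \<bar>f \<tau>\<bar>) \<tau> = 0" if "\<tau> \<in> even_words N" for \<tau>
      unfolding g_abs[symmetric] by (rule chain_op_abs[OF N sup_g ker_g that])
  qed (simp_all add: N sup even_words_def)
  have "\<bar>f (map flip \<tau>)\<bar> = \<bar>f \<tau>\<bar>" if "\<tau> \<in> words N" for \<tau>
    using assms(4) that by (simp add: flip_sym_def abs_mult power_abs)
  then have "\<bar>f \<sigma>\<bar> = 0"
    using vanishes_nonzero[of \<sigma>] vanishes_odd[of \<sigma>] assms(5,6) True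
    by (cases "x = 0") (auto simp: even_words_def words_def)
  then show ?thesis
    by simp
qed (simp add: sup)

section \<open>The eigenvalue zero in the subsector\<close>

lemma weight_Cons: "weight (a # w) = (if a = 1 then 1 else if a = 2 then 0 else - 1) + weight w"
  unfolding weight_def by (simp only: length_Cons sum.lessThan_Suc_shift nth_Cons_0 nth_Cons_Suc)

lemma even_weight: "even (weight \<sigma>) \<longleftrightarrow> even (length \<sigma> + zeros \<sigma>)"
proof (induction \<sigma>)
  case Nil
  then show ?case by (simp add: weight_def)
next
  case (Cons a \<sigma>)
  then show ?case
    using exhaust_3[of a] by (elim disjE) (simp_all add: weight_Cons)
qed

lemma minus_one_powi_weight: "(-1 :: complex) powi weight \<sigma> = (-1) ^ (length \<sigma> + zeros \<sigma>)"
proof (cases "even (weight \<sigma>)")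
  case True
  then have "(-1 :: complex) powi weight \<sigma> = 1"
    by (elim evenE) (simp add: power_int_mult)
  then show ?thesis
    using True even_weight[of \<sigma>] by simp
next
  case False
  then obtain k where "weight \<sigma> = 2 * k + 1"
    by (elim oddE)
  then have "(-1 :: complex) powi weight \<sigma> = - 1"
    by (simp add: power_int_mult power_int_add)
  then show ?thesis
    using False even_weight[of \<sigma>] by simp
qed

lemma spin_reversal_apply:
  assumes "\<sigma> \<in> words N"
  shows "spin_reversal N \<phi> \<sigma> = \<phi> (map flip \<sigma>)"
proof -
  let ?R = "vector [vector [0, 0, 1], vector [0, 1, 0], vector [1, 0, 0]] :: complex^3^3"
  have R: "?R $ a $ b = (if b = flip a then 1 else 0)" for a b
    using exhaust_3[of a] exhaust_3[of b] by (elim disjE) (simp_all add: vector_3)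
  have P: "(\<Prod>j<N. ?R $ (\<sigma> ! j) $ (\<tau> ! j)) = (if \<tau> = map flip \<sigma> then 1 else 0)"
    if t: "\<tau> \<in> words N" for \<tau>
  proof (cases "\<tau> = map flip \<sigma>")
    case True
    then show ?thesis
      using assms by (simp add: R words_def)
  next
    case False
    then obtain j where "j < N" "\<tau> ! j \<noteq> flip (\<sigma> ! j)"
      using t assms by (auto simp: words_def list_eq_iff_nth_eq)
    then show ?thesis
      using False by (auto simp: R intro!: prod_zero)
  qed
  have "spin_reversal N \<phi> \<sigma> = (\<Sum>\<tau>\<in>words N. (\<Prod>j<N. ?R $ (\<sigma> ! j) $ (\<tau> ! j)) * \<phi> \<tau>)"
    using assms by (simp add: spin_reversal_def tensor_power_op_def words_def)
  also have "\<dots> = (\<Sum>\<tau>\<in>words N. if \<tau> = map flip \<sigma> then \<phi> \<tau> else 0)"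
    by (intro sum.cong refl) (simp add: P)
  also have "\<dots> = \<phi> (map flip \<sigma>)"
    using assms by simp
  finally show ?thesis .
qed

text \<open>The magnetisation has the parity of the number of non-zero letters, so the condition on
  it says that the number of zeros is even.\<close>

lemma subsector_iff:
  "\<phi> \<in> subsector N \<longleftrightarrow> (\<forall>\<sigma>. \<sigma> \<notin> even_words N \<longrightarrow> \<phi> \<sigma> = 0)
    \<and> (\<forall>\<sigma>\<in>words N. \<phi> (map flip \<sigma>) = (-1) ^ N * \<phi> \<sigma>)"
proof -
  have par: "magnetisation_parity \<phi> = (-1) ^ N \<bullet>\<^sub>v \<phi> \<longleftrightarrow> (\<forall>\<sigma>. odd (zeros \<sigma>) \<longrightarrow> \<phi> \<sigma> = 0)"
    if "\<phi> \<in> state_space N"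
  proof -
    have "(-1) powi weight \<sigma> * \<phi> \<sigma> = (-1) ^ N * \<phi> \<sigma> \<longleftrightarrow> (odd (zeros \<sigma>) \<longrightarrow> \<phi> \<sigma> = 0)" for \<sigma>
      using that by (cases "length \<sigma> = N")
        (auto simp: minus_one_powi_weight state_space_def minus_one_power_iff)
    then show ?thesis
      by (simp add: magnetisation_parity_def vscale_def fun_eq_iff)
  qed
  have rev: "spin_reversal N \<phi> = (-1) ^ N \<bullet>\<^sub>v \<phi> \<longleftrightarrow> (\<forall>\<sigma>\<in>words N. \<phi> (map flip \<sigma>) = (-1) ^ N * \<phi> \<sigma>)"
    if "\<phi> \<in> state_space N"
  proof -
    have "spin_reversal N \<phi> \<sigma> = (-1) ^ N * \<phi> \<sigma> \<longleftrightarrow> (\<sigma> \<in> words N \<longrightarrow> \<phi> (map flip \<sigma>) = (-1) ^ N * \<phi> \<sigma>)" for \<sigma>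
      using that by (cases "\<sigma> \<in> words N")
        (simp_all add: spin_reversal_apply, simp add: spin_reversal_def tensor_power_op_def words_def state_space_def)
    then show ?thesis
      by (auto simp: vscale_def fun_eq_iff)
  qed
  show ?thesis
    unfolding subsector_def even_words_def words_def
    using par rev by (auto simp: state_space_def words_def)
qed

section \<open>Self-adjointness and the generalised eigenspace\<close>

lemma subsector_state_space: "\<phi> \<in> subsector N \<Longrightarrow> \<phi> \<in> state_space N"
  by (simp add: subsector_def)

lemma hamiltonian_eq_0_iff:
  assumes "\<phi> \<in> state_space N" "N = Suc (Suc M)"
  shows "hamiltonian N x \<phi> = 0 \<longleftrightarrow> (\<forall>\<sigma>\<in>words N. chain_op (chain_weight x) N (\<lambda>\<tau>. Re (\<phi> \<tau>)) \<sigma> = 0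
    \<and> chain_op (chain_weight x) N (\<lambda>\<tau>. Im (\<phi> \<tau>)) \<sigma> = 0)"
proof -
  have "hamiltonian N x \<phi> \<sigma> = 0" if "\<sigma> \<notin> words N" for \<sigma>
    using hamiltonian_state_space[OF assms(1), of x] that by (simp add: state_space_def words_def)
  then have "hamiltonian N x \<phi> = 0 \<longleftrightarrow> (\<forall>\<sigma>\<in>words N. hamiltonian N x \<phi> \<sigma> = 0)"
    by (auto simp: fun_eq_iff)
  then show ?thesis
    using Re_hamiltonian[OF _ assms(2)] Im_hamiltonian[OF _ assms(2)] by (simp add: complex_eq_iff)
qed

text \<open>By symmetry the squared norm of the image of \<open>f\<close> is the pairing of
  \<open>f\<close> with the image applied once more, which is zero.\<close>

lemma chain_op_square_null:
  assumes N: "N = Suc (Suc M)" and r: "\<And>\<sigma>. \<sigma> \<in> words N \<Longrightarrow> r \<sigma> = chain_op (chain_weight x) N f \<sigma>"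
    and "\<And>\<sigma>. \<sigma> \<in> words N \<Longrightarrow> chain_op (chain_weight x) N r \<sigma> = 0"
  shows "\<forall>\<sigma>\<in>words N. r \<sigma> = 0"
proof -
  have "ip N r r = ip N r (chain_op (chain_weight x) N f)"
    by (simp add: ip_def r)
  also have "\<dots> = ip N f (chain_op (chain_weight x) N r)"
    by (rule chain_op_commute[OF chain_weight_sym N])
  also have "\<dots> = 0"
    by (simp add: ip_def assms(3))
  finally show ?thesis
    by (simp only: ip_self_eq_0_iff)
qed

lemma hamiltonian_square_null:
  assumes "\<phi> \<in> state_space N" "N = Suc (Suc M)" "hamiltonian N x (hamiltonian N x \<phi>) = 0"
  shows "hamiltonian N x \<phi> = 0"
proof -
  have H: "hamiltonian N x \<phi> \<in> state_space N"
    by (rule hamiltonian_state_space[OF assms(1)])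
  note ker = assms(3)[unfolded hamiltonian_eq_0_iff[OF H assms(2)]]
  have "\<forall>\<sigma>\<in>words N. Re (hamiltonian N x \<phi> \<sigma>) = 0"
    by (rule chain_op_square_null[OF assms(2) Re_hamiltonian[OF _ assms(2)]]) (use ker in auto)
  moreover have "\<forall>\<sigma>\<in>words N. Im (hamiltonian N x \<phi> \<sigma>) = 0"
    by (rule chain_op_square_null[OF assms(2) Im_hamiltonian[OF _ assms(2)]]) (use ker in auto)
  ultimately have "hamiltonian N x \<phi> \<sigma> = 0" if "\<sigma> \<in> words N" for \<sigma>
    using that by (simp add: complex_eq_iff)
  then show ?thesis
    using H by (auto simp: fun_eq_iff state_space_def words_def)
qed

lemma hamiltonian_zero: "hamiltonian N x 0 = 0"
proof -
  have "spin_op N a j 0 = 0" for a j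
    by (auto simp: spin_op_def site_op_def vscale_def fun_eq_iff)
  moreover have "c \<bullet>\<^sub>v 0 = 0" for c
    by (simp add: vscale_def fun_eq_iff)
  ultimately show ?thesis
    by (simp only: hamiltonian_def add_0_left sum.neutral_const diff_self)
qed

text \<open>A symmetric operator has no Jordan blocks: vanishing of a power of H reduces step by
  step to vanishing of H itself, so the algebraic multiplicity is the dimension of the
  kernel.\<close>

lemma generalised_eigenspace_0:
  assumes "N = Suc (Suc M)"
  shows "generalised_eigenspace (hamiltonian N x) (subsector N) 0 = {\<phi> \<in> subsector N. hamiltonian N x \<phi> = 0}"
proof -
  let ?H = "hamiltonian N x"
  have H: "(\<lambda>\<psi>. ?H \<psi> - 0 \<bullet>\<^sub>v \<psi>) = ?H"
    by (simp add: fun_eq_iff vscale_def)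
  have pow: "(?H ^^ k) \<phi> \<in> state_space N" if "\<phi> \<in> state_space N" for k \<phi>
    by (induction k) (simp_all add: that hamiltonian_state_space)
  have "?H \<phi> = 0" if "\<phi> \<in> state_space N" "(?H ^^ k) \<phi> = 0" for k \<phi>
    using that
  proof (induction k)
    case 0
    then show ?case
      by (simp only: funpow_0 hamiltonian_zero)
  next
    case (Suc k)
    show ?case
    proof (cases k)
      case 0
      then show ?thesis
        using Suc.prems by simp
    next
      case (Suc l)
      have "?H (?H ((?H ^^ l) \<phi>)) = 0"
        using Suc.prems(2) unfolding Suc by (simp only: funpow.simps o_apply)
      then have "(?H ^^ k) \<phi> = 0"
        unfolding Suc funpow.simps o_apply
        by (rule hamiltonian_square_null[OF pow[OF Suc.prems(1)] assms])
      then show ?thesis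
        by (rule Suc.IH[OF Suc.prems(1)])
    qed
  qed
  moreover have "(?H ^^ 1) \<phi> = 0" if "?H \<phi> = 0" for \<phi>
    using that by simp
  ultimately show ?thesis
    unfolding generalised_eigenspace_def H using subsector_state_space by blast
qed

lemma kernel_multiple:
  assumes N: "N = Suc (Suc M)" and x: "x \<noteq> 0 \<or> odd N"
    and f: "\<And>\<sigma>. \<sigma> \<notin> even_words N \<Longrightarrow> f \<sigma> = 0" "flip_sym N f"
      "\<And>\<sigma>. \<sigma> \<in> words N \<Longrightarrow> chain_op (chain_weight x) N f \<sigma> = 0"
    and h: "\<And>\<sigma>. \<sigma> \<notin> even_words N \<Longrightarrow> h \<sigma> = 0" "flip_sym N h"
      "\<And>\<sigma>. \<sigma> \<in> words N \<Longrightarrow> chain_op (chain_weight x) N h \<sigma> = 0"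
    and u: "h (replicate N 1) \<noteq> 0"
  shows "f \<sigma> = f (replicate N 1) / h (replicate N 1) * h \<sigma>"
proof -
  \<comment> \<open>Chosen to cancel the entry at the all-up word, so that
    \<open>kernel_vanishes\<close> applies to the combination.\<close>
  define c where "c = - f (replicate N 1) / h (replicate N 1)"
  have "f \<sigma> + c * h \<sigma> = 0"
  proof (rule kernel_vanishes[OF N, where f = "\<lambda>\<sigma>. f \<sigma> + c * h \<sigma>"])
    show "flip_sym N (\<lambda>\<sigma>. f \<sigma> + c * h \<sigma>)"
      using f(2) h(2) by (simp add: flip_sym_def algebra_simps)
    show "chain_op (chain_weight x) N (\<lambda>\<sigma>. f \<sigma> + c * h \<sigma>) \<tau> = 0" if "\<tau> \<in> words N" for \<tau>
      using that by (simp add: chain_op_add chain_op_cmult f(3) h(3))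
  qed (use x u in \<open>simp_all add: f(1) h(1) c_def\<close>)
  then show ?thesis
    by (simp add: c_def)
qed

theorem theorem2p4:
  fixes N :: nat and x :: real
  assumes "N \<ge> 2"
  shows "eigenvalue_on (hamiltonian N x) (subsector N) 0 \<and>
    (x \<noteq> 0 \<or> odd N \<longrightarrow> simple_eigenvalue_on (hamiltonian N x) (subsector N) 0)"
proof -
  obtain M where N: "N = Suc (Suc M)"
    using assms by (metis One_nat_def Suc_1 Suc_le_D Suc_le_mono)
  obtain h where h: "twist_inv N h" "\<forall>\<sigma>. \<sigma> \<notin> even_words N \<longrightarrow> h \<sigma> = 0" "\<exists>\<sigma>. h \<sigma> \<noteq> 0"
    "\<forall>\<sigma>\<in>words N. chain_op (chain_weight x) N h \<sigma> = 0"
    using kernel_state_exists[OF N, where x = x] by metis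
  note flip_h = twist_inv_flip_sym[OF h(1)]
  define \<phi>0 :: state where "\<phi>0 \<sigma> = complex_of_real (h \<sigma>)" for \<sigma>
  have \<phi>0_sub: "\<phi>0 \<in> subsector N"
    using h(2) flip_h by (simp add: subsector_iff \<phi>0_def flip_sym_def)
  have \<phi>0_ker: "hamiltonian N x \<phi>0 = 0"
  proof -
    have "chain_op (chain_weight x) N (\<lambda>_. 0) \<sigma> = 0" for \<sigma>
      using chain_op_cmult[of "chain_weight x" N 0 "\<lambda>_. 0" \<sigma>] by simp
    then show ?thesis
      using h(4) by (simp add: hamiltonian_eq_0_iff[OF subsector_state_space[OF \<phi>0_sub] N] \<phi>0_def)
  qed
  have \<phi>0_nonzero: "\<phi>0 \<noteq> 0"
    using h(3) by (auto simp: \<phi>0_def fun_eq_iff)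
  have zero_scale: "0 \<bullet>\<^sub>v \<psi> = 0" for \<psi>
    by (simp add: vscale_def fun_eq_iff)
  have ev: "eigenvalue_on (hamiltonian N x) (subsector N) 0"
    unfolding eigenvalue_on_def using \<phi>0_sub \<phi>0_ker \<phi>0_nonzero zero_scale by metis
  moreover have "simple_eigenvalue_on (hamiltonian N x) (subsector N) 0" if x: "x \<noteq> 0 \<or> odd N"
  proof -
    interpret vs: vector_space vscale
      by (rule vector_space_vscale)
    let ?u = "replicate N (1::3)"
    let ?G = "generalised_eigenspace (hamiltonian N x) (subsector N) 0"
    \<comment> \<open>Otherwise \<open>kernel_vanishes\<close> would force \<open>h\<close> to be
      zero.\<close>
    have hu: "h ?u \<noteq> 0"
      using kernel_vanishes[OF N, of h x] h flip_h x by blast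
    have "\<phi> \<in> vs.span {\<phi>0}" if "\<phi> \<in> ?G" for \<phi>
    proof -
      have \<phi>: "\<phi> \<in> subsector N" "hamiltonian N x \<phi> = 0"
        using that by (simp_all add: generalised_eigenspace_0[OF N])
      note sub = \<phi>(1)[unfolded subsector_iff]
      note ker = \<phi>(2)[unfolded hamiltonian_eq_0_iff[OF subsector_state_space[OF \<phi>(1)] N]]
      have sgn: "(-1 :: complex) ^ N = complex_of_real ((-1) ^ N)"
        by simp
      have fs: "flip_sym N (\<lambda>\<tau>. Re (\<phi> \<tau>))" "flip_sym N (\<lambda>\<tau>. Im (\<phi> \<tau>))"
        using sub unfolding flip_sym_def sgn by (simp_all del: of_real_power)
      \<comment> \<open>Real and imaginary parts of \<open>\<phi>\<close> are kernel states, hence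
        real multiples of \<open>h\<close>; \<open>c\<close> collects the two factors.\<close>
      define c where "c = \<phi> ?u / complex_of_real (h ?u)"
      have c: "Re c = Re (\<phi> ?u) / h ?u" "Im c = Im (\<phi> ?u) / h ?u"
        by (simp_all add: c_def)
      have "Re (\<phi> \<sigma>) = Re c * h \<sigma>" for \<sigma>
        unfolding c by (rule kernel_multiple[OF N x _ fs(1)]) (use sub ker h flip_h hu in auto)
      moreover have "Im (\<phi> \<sigma>) = Im c * h \<sigma>" for \<sigma>
        unfolding c by (rule kernel_multiple[OF N x _ fs(2)]) (use sub ker h flip_h hu in auto)
      ultimately have multiple: "\<phi> = c \<bullet>\<^sub>v \<phi>0"
        by (simp add: fun_eq_iff vscale_def \<phi>0_def complex_eq_iff)
      show ?thesis
        unfolding multiple by (intro vs.span_scale vs.span_base singletonI)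
    qed
    then have "vs.dim ?G = 1"
      using \<phi>0_sub \<phi>0_ker \<phi>0_nonzero
      by (intro vs.dim_unique[of "{\<phi>0}"]) (auto simp: generalised_eigenspace_0[OF N])
    with ev show ?thesis
      by (simp add: simple_eigenvalue_on_def)
  qed
  ultimately show ?thesis
    by blast
qed

end
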